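(* Let $\phi:\mathbb{R}^n\to\mathbb{R}$ be $\mathcal{C}^2$ and suppose there exist $\theta>0$, $L>0$ with $|\nabla\phi(z')-\nabla\phi(z'')|\le L|z'-z''|$ and $(\nabla\phi(z')-\nabla\phi(z''))^\top(z'-z'')\ge\theta|z'-z''|^2$ for all $z',z''\in\mathbb{R}^n$; let $z^*$ be its unique minimizer and $\phi^*=\phi(z^* )$. Let $\kappa_1,\dots,\kappa_n$ be pairwise distinct positive rational numbers, $k>0$, and $0<T_{\min}<T_{\max}$ with \[ T_{\max}^2-T_{\min}^2\ge\frac{1}{2\theta k}. \] Consider the hybrid system $\mathcal{H}_{a,\varepsilon}$ ($a,\varepsilon>0$) with state $\tilde x=(x,\mu,\tau)$, $x=(x_1,x_2)\in\mathbb{R}^n\times\mathbb{R}^n$, $\mu\in\mathbb{R}^{2n}$, given by \[ \text{flows: } (x,\tau,\mu)\in\mathbb{R}^{2n}\times[T_{\min},T_{\max}]\times\mathbb{T}^n,\quad \dot x_1=\tfrac{2}{\tau}(x_2-x_1),\ \dot x_2=-\tfrac4a k\tau\phi(z)\tilde\mu,\ \dot\tau=\tfrac12,\ \dot\mu=\tfrac1\varepsilon R\mu, \] \[ \text{jumps: } (x,\tau,\mu)\in\mathbb{R}^{2n}\times\{T_{\max}\}\times\mathbb{T}^n,\quad x_1^+=x_1,\ x_2^+=x_1,\ \tau^+=T_{\min},\ \mu^+=\mu, \] with $z=x_1+a\tilde\mu$, $\tilde\mu=(\mu_1,\mu_3,\dots,\mu_{2n-1})$. Let $\mathcal{A}_x=\{z^*\}\times\{z^*\}$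 and $\mathcal{A}=\mathcal{A}_x\times[T_{\min},T_{\max}]\times\mathbb{T}^n$. Then: (a) there exists an exponential-form $\beta_2\in\mathcal{KL}$ such that $\mathcal{A}$ is SGPES as $(a,\varepsilon)\to0^+$ with $\beta_2$, and $\mathcal{H}_{a,\varepsilon}$ is Structurally Robust; (b) for each compact $K_0\subset\mathbb{R}^{2n}$ with $\mathcal{A}_x\subset\operatorname{int}(K_0)$ and each $\nu>0$, there exists $a^*>0$ such that for all $a\in(0,a^* )$ there exists $\varepsilon^*>0$ such that for all $\varepsilon\in(0,\varepsilon^* )$, every solution with $x(0,0)\in K_0$, $\tau(0,0)=T_{\min}$ and $x_1(0,0)=x_2(0,0)$ satisfies \[ \phi(z(t,j))-\phi^*\le\alpha_0\tilde\gamma^j\big(\phi(z(0,0))-\phi^*\big)+\nu \] for all $(t,j)\in\operatorname{dom}(\tilde x)$ with $t>\underline t_j:=\min\{t:(t,j)\in\operatorname{dom}(\tilde x)\}$, where $z(t,j)=x_1(t,j)+a\tilde\mu(t,j)$, $\tilde\gamma=\frac{1}{kT_{\max}^2}\left(\frac{1}{2\theta}+kT_{\min}^2\right)$ and $\alpha_0=T_{\max}^2/T_{\min}^2$.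
   Context: $\mathbb{T}^n=\mathbb{S}^1\times\cdots\times\mathbb{S}^1\subset\mathbb{R}^{2n}$ ($\mathbb{S}^1$ the unit circle in $\mathbb{R}^2$). $R\in\mathbb{R}^{2n\times2n}$ is block diagonal with $\ell$-th block $2\pi\kappa_\ell\begin{pmatrix}0&1\\-1&0\end{pmatrix}$. $|x|_{\mathcal{S}}$ denotes distance to a set. Solutions are hybrid arcs on hybrid time domains (Goebel–Sanfelice–Teel). SGPES as $(a,\varepsilon)\to0^+$ with $\beta(r,s)=c_1re^{-c_2s}$ ($c_1,c_2>0$): for every compact $K$ and $\nu>0$ there is $a^*>0$ such that for every $a\in(0,a^* )$ there is $\varepsilon^*>0$ such that for every $\varepsilon\in(0,\varepsilon^* )$ every solution starting in $K$ satisfies $|\tilde x(t,j)|_{\mathcal{A}}\le\beta(|\tilde x(0,0)|_{\mathcal{A}},t+j)+\nu$ on its domain, and all such solutions are complete (SGPpAS: same without completeness and with $\beta\in\mathcal{KL}$). Structural Robustness: for every measurable $e$ with $\sup_t|e(t)|\le\bar e$, the perturbed system $\tilde x+e\in C$, $\dot{\tilde x}=F(\tilde x+e)+e$; $\tilde x+e\in D$, $\tilde x^+=G(\tilde x+e)+e$ (with $C,F,D,G$ the flow set, flow map, jump set, jump map above) renders $\mathcal{A}$ SGPpAS as $(a,\varepsilon,\bar e)\to0^+$ with the same $\beta$. *)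

theory Defs
  imports "HOL-Analysis.Analysis"
begin

definition compact_htd :: "(real \<times> nat) set \<Rightarrow> bool" where
  "compact_htd E \<longleftrightarrow> (\<exists>(J::nat) (t::nat \<Rightarrow> real). t 0 = 0 \<and> (\<forall>i<J. t i \<le> t (Suc i)) \<and>
      E = {(s, j). j < J \<and> t j \<le> s \<and> s \<le> t (Suc j)})"

definition htd :: "(real \<times> nat) set \<Rightarrow> bool" where
  "htd E \<longleftrightarrow> E \<subseteq> {0..} \<times> UNIV \<and>
     (\<forall>T J. (T, J) \<in> E \<longrightarrow> compact_htd (E \<inter> ({0..T} \<times> {0..J})))"

text \<open>Solution of the (possibly perturbed) hybrid system with flow set C, flow map F,
  jump set D, jump map G and perturbation e (e = 0 gives the nominal system):
  x + e \<in> C, x' = F(x + e) + e  and  x + e \<in> D, x^+ = G(x + e) + e.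
  The hybrid arc is the pair (E, x) with domain E; the flow condition expresses local
  absolute continuity of t \<mapsto> x(t,j) on each I^j with derivative a.e. equal to
  F(x + e) + e (integral representation with an absolutely integrable integrand).\<close>
definition is_solution ::
  "'s::euclidean_space set \<Rightarrow> ('s \<Rightarrow> 's) \<Rightarrow> 's set \<Rightarrow> ('s \<Rightarrow> 's) \<Rightarrow> (real \<Rightarrow> 's)
     \<Rightarrow> (real \<times> nat) set \<Rightarrow> (real \<times> nat \<Rightarrow> 's) \<Rightarrow> bool" where
  "is_solution C F D G e E x \<longleftrightarrow>
     htd E \<and> (0, 0) \<in> E \<and>
     x (0, 0) + e 0 \<in> closure C \<union> D \<and>
     (\<forall>j. \<forall>t \<in> interior {s. (s, j) \<in> E}. x (t, j) + e t \<in> C) \<and>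
     (\<forall>j s t. (s, j) \<in> E \<longrightarrow> (t, j) \<in> E \<longrightarrow> s \<le> t \<longrightarrow>
        (\<lambda>r. F (x (r, j) + e r) + e r) absolutely_integrable_on {s..t} \<and>
        x (t, j) - x (s, j) = integral {s..t} (\<lambda>r. F (x (r, j) + e r) + e r)) \<and>
     (\<forall>t j. (t, j) \<in> E \<longrightarrow> (t, Suc j) \<in> E \<longrightarrow>
        x (t, j) + e t \<in> D \<and> x (t, Suc j) = G (x (t, j) + e t) + e t)"

definition is_maximal_solution ::
  "'s::euclidean_space set \<Rightarrow> ('s \<Rightarrow> 's) \<Rightarrow> 's set \<Rightarrow> ('s \<Rightarrow> 's) \<Rightarrow> (real \<Rightarrow> 's)
     \<Rightarrow> (real \<times> nat) set \<Rightarrow> (real \<times> nat \<Rightarrow> 's) \<Rightarrow> bool" where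
  "is_maximal_solution C F D G e E x \<longleftrightarrow> is_solution C F D G e E x \<and>
     \<not> (\<exists>E' x'. is_solution C F D G e E' x' \<and> E \<subset> E' \<and> (\<forall>p\<in>E. x' p = x p))"

definition complete_domain :: "(real \<times> nat) set \<Rightarrow> bool" where
  "complete_domain E \<longleftrightarrow> (\<forall>M. \<exists>(t, j) \<in> E. t + real j \<ge> M)"

text \<open>State (x1, x2, tau, mc, ms): mc = (mu_1, mu_3, ..., mu_(2n-1)) = \<mu>~ and
  ms = (mu_2, mu_4, ..., mu_2n); the l-th circle of the torus is (mc_l, ms_l).
  Since the Euclidean norm is invariant under permuting coordinates, the product norm
  on this type is the Euclidean norm of (x, \<mu>, \<tau>).\<close>
type_synonym 'n hstate = "(real^'n) \<times> (real^'n) \<times> real \<times> (real^'n) \<times> (real^'n)"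

definition torus :: "((real^'n) \<times> (real^'n)) set" where
  "torus = {(mc, ms). \<forall>l. (mc $ l)^2 + (ms $ l)^2 = 1}"

definition flow_set :: "real \<Rightarrow> real \<Rightarrow> ('n::finite) hstate set" where
  "flow_set Tmin Tmax = {(x1, x2, \<tau>, mc, ms). Tmin \<le> \<tau> \<and> \<tau> \<le> Tmax \<and> (mc, ms) \<in> torus}"

definition jump_set :: "real \<Rightarrow> ('n::finite) hstate set" where
  "jump_set Tmax = {(x1, x2, \<tau>, mc, ms). \<tau> = Tmax \<and> (mc, ms) \<in> torus}"

text \<open>Flow map; the rotation R has l-th block 2 pi kappa_l [[0,1],[-1,0]].\<close>
definition flow_map ::
  "(real^'n \<Rightarrow> real) \<Rightarrow> ('n \<Rightarrow> real) \<Rightarrow> real \<Rightarrow> real \<Rightarrow> real \<Rightarrow> ('n::finite) hstate \<Rightarrow> ('n::finite) hstate" where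
  "flow_map \<phi> \<kappa> k a \<epsilon> = (\<lambda>(x1, x2, \<tau>, mc, ms).
     ((2 / \<tau>) *\<^sub>R (x2 - x1),
      (- (4 / a) * k * \<tau> * \<phi> (x1 + a *\<^sub>R mc)) *\<^sub>R mc,
      1 / 2,
      (\<chi> l. (1 / \<epsilon>) * (2 * pi * \<kappa> l) * ms $ l),
      (\<chi> l. - (1 / \<epsilon>) * (2 * pi * \<kappa> l) * mc $ l)))"

definition jump_map :: "real \<Rightarrow> ('n::finite) hstate \<Rightarrow> ('n::finite) hstate" where
  "jump_map Tmin = (\<lambda>(x1, x2, \<tau>, mc, ms). (x1, x1, Tmin, mc, ms))"

definition attractor :: "real^'n \<Rightarrow> real \<Rightarrow> real \<Rightarrow> ('n::finite) hstate set" where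
  "attractor zs Tmin Tmax = {(x1, x2, \<tau>, mc, ms). x1 = zs \<and> x2 = zs \<and> Tmin \<le> \<tau> \<and> \<tau> \<le> Tmax \<and> (mc, ms) \<in> torus}"

definition H_solution ::
  "(real^'n \<Rightarrow> real) \<Rightarrow> ('n \<Rightarrow> real) \<Rightarrow> real \<Rightarrow> real \<Rightarrow> real \<Rightarrow> real \<Rightarrow> real
     \<Rightarrow> (real \<Rightarrow> ('n::finite) hstate) \<Rightarrow> (real \<times> nat) set \<Rightarrow> (real \<times> nat \<Rightarrow> ('n::finite) hstate) \<Rightarrow> bool" where
  "H_solution \<phi> \<kappa> k Tmin Tmax a \<epsilon> e E x \<longleftrightarrow>
     is_solution (flow_set Tmin Tmax) (flow_map \<phi> \<kappa> k a \<epsilon>) (jump_set Tmax) (jump_map Tmin) e E x"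

definition H_maximal_solution ::
  "(real^'n \<Rightarrow> real) \<Rightarrow> ('n \<Rightarrow> real) \<Rightarrow> real \<Rightarrow> real \<Rightarrow> real \<Rightarrow> real \<Rightarrow> real
     \<Rightarrow> (real \<times> nat) set \<Rightarrow> (real \<times> nat \<Rightarrow> ('n::finite) hstate) \<Rightarrow> bool" where
  "H_maximal_solution \<phi> \<kappa> k Tmin Tmax a \<epsilon> E x \<longleftrightarrow>
     is_maximal_solution (flow_set Tmin Tmax) (flow_map \<phi> \<kappa> k a \<epsilon>) (jump_set Tmax) (jump_map Tmin) (\<lambda>_. 0) E x"

definition exp_bound :: "real \<Rightarrow> real \<Rightarrow> ('n::finite) hstate set \<Rightarrow> real
     \<Rightarrow> (real \<times> nat) set \<Rightarrow> (real \<times> nat \<Rightarrow> ('n::finite) hstate) \<Rightarrow> bool" where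
  "exp_bound c1 c2 A \<nu> E x \<longleftrightarrow> (\<forall>t j. (t, j) \<in> E \<longrightarrow>
     infdist (x (t, j)) A \<le> c1 * infdist (x (0, 0)) A * exp (- c2 * (t + real j)) + \<nu>)"

definition SGPES ::
  "(real^'n \<Rightarrow> real) \<Rightarrow> ('n \<Rightarrow> real) \<Rightarrow> real \<Rightarrow> real \<Rightarrow> real \<Rightarrow> ('n::finite) hstate set
     \<Rightarrow> real \<Rightarrow> real \<Rightarrow> bool" where
  "SGPES \<phi> \<kappa> k Tmin Tmax A c1 c2 \<longleftrightarrow>
     (\<forall>K \<nu>. compact K \<and> \<nu> > 0 \<longrightarrow>
       (\<exists>as > 0. \<forall>a. 0 < a \<and> a < as \<longrightarrow>
         (\<exists>es > 0. \<forall>\<epsilon>. 0 < \<epsilon> \<and> \<epsilon> < es \<longrightarrow>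
           (\<forall>E x. H_solution \<phi> \<kappa> k Tmin Tmax a \<epsilon> (\<lambda>_. 0) E x \<and> x (0, 0) \<in> K \<longrightarrow>
               exp_bound c1 c2 A \<nu> E x) \<and>
           (\<forall>E x. H_maximal_solution \<phi> \<kappa> k Tmin Tmax a \<epsilon> E x \<and> x (0, 0) \<in> K \<longrightarrow>
               complete_domain E))))"

definition structurally_robust ::
  "(real^'n \<Rightarrow> real) \<Rightarrow> ('n \<Rightarrow> real) \<Rightarrow> real \<Rightarrow> real \<Rightarrow> real \<Rightarrow> ('n::finite) hstate set
     \<Rightarrow> real \<Rightarrow> real \<Rightarrow> bool" where
  "structurally_robust \<phi> \<kappa> k Tmin Tmax A c1 c2 \<longleftrightarrow>
     (\<forall>K \<nu>. compact K \<and> \<nu> > 0 \<longrightarrow>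
       (\<exists>as > 0. \<forall>a. 0 < a \<and> a < as \<longrightarrow>
         (\<exists>es > 0. \<forall>\<epsilon>. 0 < \<epsilon> \<and> \<epsilon> < es \<longrightarrow>
           (\<exists>ebs > 0. \<forall>ebar. 0 < ebar \<and> ebar < ebs \<longrightarrow>
             (\<forall>e E x. e \<in> borel_measurable lebesgue \<and> (\<forall>t. norm (e t) \<le> ebar) \<and>
                 H_solution \<phi> \<kappa> k Tmin Tmax a \<epsilon> e E x \<and> x (0, 0) \<in> K \<longrightarrow>
                 exp_bound c1 c2 A \<nu> E x)))))"

end

theory Submission
  imports Defs
begin

text \<open>With \<open>V = |x\<^sub>2 - x\<^sub>1|\<^sup>2/4 + |x\<^sub>2 - z\<^sup>*|\<^sup>2/4 + k \<tau>\<^sup>2 (\<phi>(x\<^sub>1) - \<phi>\<^sup>*)\<close> the averaged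
  system \<open>x\<^sub>1' = (2/\<tau>)(x\<^sub>2 - x\<^sub>1)\<close>, \<open>x\<^sub>2' = -2 k \<tau> \<nabla>\<phi>(x\<^sub>1)\<close>, \<open>\<tau>' = 1/2\<close> satisfies \<open>V' \<le> - c V\<close>, and the
  condition on \<open>T\<^sub>m\<^sub>a\<^sub>x\<close>, \<open>T\<^sub>m\<^sub>i\<^sub>n\<close> says exactly that a reset multiplies \<open>V\<close> by a factor of at most \<open>1\<close>.
  Averaging is explicit: since the \<open>\<mu>\<close> are rotations with distinct frequencies, \<open>\<phi>(x\<^sub>1) \<mu>\<close> and
  the products \<open>\<mu>\<^sub>l \<mu>\<^sub>m\<close> have elementary antiderivatives of size \<open>\<epsilon>\<close>, so that a shifted
  coordinate \<open>y = x\<^sub>2 + O(\<epsilon>/a)\<close> follows the averaged flow up to \<open>O(a + \<epsilon>/a)\<close> on compact sets. A measurable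
  perturbation \<open>e\<close> is removed by subtracting the integral of its effect, which leaves a continuously
  differentiable curve to which \<open>V\<close> applies. A first-exit argument makes the estimate
  semiglobal, and the errors add up to a geometric series because resets are separated by a dwell time.
  Completeness follows since a bounded maximal solution can always be continued by a jump, by a
  limit, or by the Picard theorem.\<close>

section \<open>Strong convexity and the Lyapunov function\<close>

text \<open>A reset need not decrease \<open>V\<close> strictly, since \<open>gam\<close> may equal
  1. The contraction of the accumulated error is therefore taken from the flow alone, and errors
  stay summable only because consecutive resets are at least \<open>dwell\<close> apart. The first
  reset is exempt, as the timer may start at \<open>Tmax\<close>; this is the origin of
  \<open>real j - 1\<close>. The order of the quantifiers follows from the residual a +
  \<epsilon>/a: the Taylor remainder of \<phi> at the dithered point costs order a, the slow drift
  of the coefficients in the change of coordinates costs order \<epsilon>/a. Hence \<epsilon> is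
  chosen after a. The size of the perturbation comes last, because the moduli of continuity of the
  flow map depend on both. Under a perturbation only x + e is constrained, so x is merely close to
  the flow set. All estimates are therefore made on a wider region, with the timer in
  [Tmin/2, 2 Tmax] and \<mu> near the torus. The distance between x and its differentiable
  substitute grows with time; it stays small because the timer bounds the length of every flow
  interval.\<close>

lemma exp_decay_comparison:
  fixes v v' :: "real \<Rightarrow> real"
  assumes "s \<le> t" "c > 0" "\<beta> \<ge> 0"
    and der: "\<And>r. r \<in> {s..t} \<Longrightarrow> (v has_real_derivative v' r) (at r within {s..t})"
    and bound: "\<And>r. r \<in> {s..t} \<Longrightarrow> v' r \<le> - c * v r + \<beta>"
  shows "v t \<le> exp (- c * (t - s)) * v s + \<beta> / c"
proof -
  define u where "u r = exp (c * (r - s)) * (v r - \<beta> / c)" for r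
  have du: "(u has_real_derivative exp (c * (r - s)) * (c * v r - \<beta> + v' r)) (at r within {s..t})"
    if "r \<in> {s..t}" for r
    unfolding u_def using der[OF that] \<open>c > 0\<close>
    by (auto intro!: derivative_eq_intros simp: algebra_simps)
  have "u t \<le> u s"
  proof (rule DERIV_nonpos_imp_decreasing_open[OF \<open>s \<le> t\<close>])
    show "continuous_on {s..t} u"
      by (rule DERIV_continuous_on[OF du])
    fix r assume r: "s < r" "r < t"
    then have "(u has_real_derivative exp (c * (r - s)) * (c * v r - \<beta> + v' r)) (at r)"
      using du[of r] by (simp add: at_within_Icc_at)
    moreover have "exp (c * (r - s)) * (c * v r - \<beta> + v' r) \<le> 0"
      using bound[of r] r by (intro mult_nonneg_nonpos) auto
    ultimately show "\<exists>y. (u has_real_derivative y) (at r) \<and> y \<le> 0" by blast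
  qed
  then have "exp (- (c * (t - s))) * (exp (c * (t - s)) * (v t - \<beta> / c))
      \<le> exp (- (c * (t - s))) * (v s - \<beta> / c)"
    by (intro mult_left_mono) (auto simp: u_def)
  then have "v t - \<beta> / c \<le> exp (- (c * (t - s))) * (v s - \<beta> / c)"
    by (simp add: mult.assoc[symmetric] exp_add[symmetric])
  moreover have "0 \<le> exp (- (c * (t - s))) * (\<beta> / c)"
    using \<open>\<beta> \<ge> 0\<close> \<open>c > 0\<close> by simp
  ultimately show ?thesis
    by (simp add: right_diff_distrib)
qed

section \<open>Consequences of strong convexity and of a Lipschitz gradient\<close>

locale hybrid_momentum =
  fixes \<phi> :: "real^'n \<Rightarrow> real" and grad :: "real^'n \<Rightarrow> real^'n"
    and Hess :: "real^'n \<Rightarrow> real^'n^'n"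
    and \<theta> L k Tmin Tmax :: real and zs :: "real^'n" and \<kappa> :: "'n \<Rightarrow> real"
  assumes grad: "\<And>z. (\<phi> has_derivative (\<lambda>h. grad z \<bullet> h)) (at z)"
    and hess: "\<And>z. (grad has_derivative (\<lambda>h. Hess z *v h)) (at z)"
    and \<theta>_pos: "\<theta> > 0" and L_pos: "L > 0"
    and lip: "\<And>z1 z2. norm (grad z1 - grad z2) \<le> L * norm (z1 - z2)"
    and strmon: "\<And>z1 z2. (grad z1 - grad z2) \<bullet> (z1 - z2) \<ge> \<theta> * (norm (z1 - z2))^2"
    and zs_min: "\<And>z. \<phi> zs \<le> \<phi> z"
    and \<kappa>_pos: "\<And>l. \<kappa> l > 0" and \<kappa>_inj: "inj \<kappa>"
    and k_pos: "k > 0"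
    and Tmin_pos: "0 < Tmin" and Tmin_less: "Tmin < Tmax"
    and Tcond: "Tmax^2 - Tmin^2 \<ge> 1 / (2 * \<theta> * k)"
begin

lemma Tmax_pos: "Tmax > 0"
  using Tmin_pos Tmin_less by simp

lemma grad_zs: "grad zs = 0"
proof -
  have "(\<lambda>h. grad zs \<bullet> h) = (\<lambda>h. 0)"
    by (rule differential_zero_maxmin[of zs UNIV \<phi>]) (auto simp: grad zs_min)
  then have "grad zs \<bullet> grad zs = 0" by metis
  then show ?thesis by simp
qed

lemma norm_grad_le: "norm (grad x) \<le> L * norm (x - zs)"
  using lip[of x zs] by (simp add: grad_zs)

lemma has_derivative_line:
  "((\<lambda>t. \<phi> (x + t *\<^sub>R u)) has_real_derivative grad (x + t *\<^sub>R u) \<bullet> u) (at t)"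
proof -
  have "((\<lambda>t. \<phi> (x + t *\<^sub>R u)) has_derivative (\<lambda>h. grad (x + t *\<^sub>R u) \<bullet> (h *\<^sub>R u))) (at t)"
    by (rule has_derivative_compose[OF _ grad, where f = "\<lambda>t. x + t *\<^sub>R u" and f' = "\<lambda>h. h *\<^sub>R u" and s = UNIV])
      (auto intro!: derivative_eq_intros)
  then show ?thesis
    by (simp add: has_field_derivative_def mult.commute[of _ "_ \<bullet> _"] )
qed

text \<open>Strong monotonicity of the gradient, integrated along the segment from x to y: the
  auxiliary function \<open>h\<close> has a nonnegative derivative.\<close>

lemma strong_convexity: "\<phi> y \<ge> \<phi> x + grad x \<bullet> (y - x) + \<theta> / 2 * (norm (y - x))\<^sup>2"
proof -
  define u where "u = y - x"
  define h where "h t = \<phi> (x + t *\<^sub>R u) - t * (grad x \<bullet> u) - \<theta> / 2 * t\<^sup>2 * (norm u)\<^sup>2" for t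
  have "h 0 \<le> h 1"
  proof (rule DERIV_nonneg_imp_nondecreasing, simp)
    fix t :: real assume t: "0 \<le> t" "t \<le> 1"
    have "(h has_real_derivative (grad (x + t *\<^sub>R u) \<bullet> u - grad x \<bullet> u - \<theta> * t * (norm u)\<^sup>2)) (at t)"
      unfolding h_def by (auto intro!: derivative_eq_intros has_derivative_line)
    moreover have "grad (x + t *\<^sub>R u) \<bullet> u - grad x \<bullet> u - \<theta> * t * (norm u)\<^sup>2 \<ge> 0"
    proof (cases "t = 0")
      case False
      then have "t > 0" using t by simp
      have "t * (grad (x + t *\<^sub>R u) \<bullet> u - grad x \<bullet> u - \<theta> * t * (norm u)\<^sup>2) \<ge> 0"
        using strmon[of "x + t *\<^sub>R u" x]
        by (simp add: algebra_simps inner_diff_left power_mult_distrib power2_eq_square)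
      then show ?thesis using \<open>t > 0\<close> by (simp add: zero_le_mult_iff)
    qed simp
    ultimately show "\<exists>d. (h has_real_derivative d) (at t) \<and> d \<ge> 0" by blast
  qed
  then show ?thesis by (simp add: h_def u_def algebra_simps)
qed

text \<open>Mean value theorem plus the Lipschitz gradient. The constant L instead of L/2 is
  harmless, as only the order of the error matters later.\<close>

lemma first_order_error: "\<bar>\<phi> (x + u) - \<phi> x - grad x \<bullet> u\<bar> \<le> L * (norm u)\<^sup>2"
proof -
  have "\<exists>t. 0 < t \<and> t < 1 \<and> \<phi> (x + 1 *\<^sub>R u) - \<phi> (x + 0 *\<^sub>R u) = (1 - 0) * (grad (x + t *\<^sub>R u) \<bullet> u)"
    by (rule MVT2) (auto intro: has_derivative_line)
  then obtain t where t: "0 < t" "t < 1" and eq: "\<phi> (x + u) - \<phi> x = grad (x + t *\<^sub>R u) \<bullet> u"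
    by auto
  have "\<bar>\<phi> (x + u) - \<phi> x - grad x \<bullet> u\<bar> = \<bar>(grad (x + t *\<^sub>R u) - grad x) \<bullet> u\<bar>"
    by (simp add: eq inner_diff_left)
  also have "\<dots> \<le> norm (grad (x + t *\<^sub>R u) - grad x) * norm u"
    by (rule Cauchy_Schwarz_ineq2)
  also have "\<dots> \<le> (L * (t * norm u)) * norm u"
    using lip[of "x + t *\<^sub>R u" x] t by (intro mult_right_mono) auto
  also have "\<dots> \<le> (L * (1 * norm u)) * norm u"
    using t L_pos by (intro mult_right_mono mult_left_mono) auto
  finally show ?thesis by (simp add: power2_eq_square)
qed

lemma gap_upper: "\<phi> x - \<phi> zs \<le> L * (norm (x - zs))\<^sup>2"
  using first_order_error[of zs "x - zs"] by (simp add: grad_zs)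

lemma gap_lower: "\<phi> x - \<phi> zs \<ge> \<theta> / 2 * (norm (x - zs))\<^sup>2"
  using strong_convexity[of zs x] by (simp add: grad_zs)

text \<open>Strong convexity expanded at x and evaluated at the minimizer; in this form it makes the
  term \<open>gap - g \<bullet> Z\<close> in the derivative of \<open>V\<close> negative.\<close>

lemma gap_grad: "\<phi> x - \<phi> zs \<le> grad x \<bullet> (x - zs) - \<theta> / 2 * (norm (x - zs))\<^sup>2"
  using strong_convexity[of x zs] by (simp add: inner_diff_right norm_minus_commute)

lemma continuous_on_phi [continuous_intros]:
  "continuous_on S f \<Longrightarrow> continuous_on S (\<lambda>x. \<phi> (f x))"
proof -
  have "continuous_on UNIV \<phi>"
    using grad has_derivative_continuous by (metis continuous_at_imp_continuous_on)
  then show "continuous_on S f \<Longrightarrow> continuous_on S (\<lambda>x. \<phi> (f x))"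
    by (rule continuous_on_compose2) auto
qed

section \<open>The Lyapunov function and its comparison constants\<close>

definition V :: "(real^'n) \<times> (real^'n) \<times> real \<Rightarrow> real" where
  "V = (\<lambda>(x1, x2, \<tau>). (norm (x2 - x1))\<^sup>2 / 4 + (norm (x2 - zs))\<^sup>2 / 4 + k * \<tau>\<^sup>2 * (\<phi> x1 - \<phi> zs))"

text \<open>\<open>c_lo\<close> and \<open>c_hi\<close> compare \<open>V\<close> with |x1 - zs|^2 +
  |x2 - zs|^2. They are computed for the wide timer range, hence (Tmin/2)^2 in the former and (2
  Tmax)^2 in the latter.\<close>

definition c_lo :: real where "c_lo = min (1/4) (k * \<theta> * Tmin\<^sup>2 / 8)"
definition c_hi :: real where "c_hi = 1 + 4 * k * Tmax\<^sup>2 * L"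
text \<open>The averaged flow dissipates at least twice the minimum times |x2 - x1|^2 + |x1 - zs|^2,
  and \<open>V\<close> is at most \<open>3 * c_hi\<close> times that sum.\<close>

definition rate :: real where "rate = min (1 / (4 * Tmax)) (k * Tmin * \<theta> / 8) / (3 * c_hi)"
text \<open>The contraction factor of the theorem: \<open>V\<close> is at most 1/(2\<theta>) + k
  Tmin^2 times the gap after a reset and at least k Tmax^2 times the gap before it.\<close>

definition gam :: real where "gam = (1 / (k * Tmax\<^sup>2)) * (1 / (2 * \<theta>) + k * Tmin\<^sup>2)"

lemma c_lo_pos: "c_lo > 0" and c_hi_pos: "c_hi > 0" and rate_pos: "rate > 0"
proof -
  show "c_lo > 0" using k_pos \<theta>_pos Tmin_pos by (simp add: c_lo_def)
  show "c_hi > 0" using k_pos L_pos Tmax_pos by (simp add: c_hi_def add_pos_nonneg)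
  then show "rate > 0" using k_pos \<theta>_pos Tmin_pos Tmax_pos by (simp add: rate_def)
qed

lemma gam_pos: "gam > 0"
  using k_pos \<theta>_pos Tmin_pos Tmax_pos by (simp add: gam_def add_pos_pos)

lemma gam_le_1: "gam \<le> 1"
proof -
  have "1 / (2 * \<theta>) + k * Tmin\<^sup>2 = k * (1 / (2 * \<theta> * k) + Tmin\<^sup>2)"
    using k_pos by (simp add: field_simps)
  also have "\<dots> \<le> k * Tmax\<^sup>2"
    using Tcond k_pos by (intro mult_left_mono) auto
  finally show ?thesis
    using k_pos Tmax_pos by (simp add: gam_def divide_le_eq)
qed

lemma continuous_on_V: "continuous_on S V"
  unfolding V_def case_prod_unfold by (intro continuous_intros) auto

lemma gap_nonneg: "\<phi> x - \<phi> zs \<ge> 0"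
  using zs_min[of x] by simp

lemma V_nonneg: "V p \<ge> 0"
  using gap_nonneg k_pos by (auto simp: V_def split: prod.split)

lemma V_lower:
  assumes "Tmin / 2 \<le> \<tau>"
  shows "c_lo * ((norm (x1 - zs))\<^sup>2 + (norm (x2 - zs))\<^sup>2) \<le> V (x1, x2, \<tau>)"
proof -
  have "c_lo * (norm (x2 - zs))\<^sup>2 \<le> 1/4 * (norm (x2 - zs))\<^sup>2"
    by (intro mult_right_mono) (auto simp: c_lo_def)
  moreover have "c_lo * (norm (x1 - zs))\<^sup>2 \<le> (k * \<theta> * Tmin\<^sup>2 / 8) * (norm (x1 - zs))\<^sup>2"
    by (intro mult_right_mono) (auto simp: c_lo_def)
  moreover have "(k * \<theta> * Tmin\<^sup>2 / 8) * (norm (x1 - zs))\<^sup>2 = (k * (Tmin / 2)\<^sup>2) * (\<theta> / 2 * (norm (x1 - zs))\<^sup>2)"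
    by (simp add: power_divide)
  moreover have "\<dots> \<le> (k * \<tau>\<^sup>2) * (\<phi> x1 - \<phi> zs)"
    using assms k_pos \<theta>_pos Tmin_pos
    by (intro mult_mono mult_left_mono power_mono gap_lower mult_nonneg_nonneg) auto
  moreover have "0 \<le> (norm (x2 - x1))\<^sup>2" by simp
  ultimately show ?thesis
    unfolding V_def case_prod_conv distrib_left by linarith
qed

lemma norm_diff_sq_le: "(norm (u - v))\<^sup>2 \<le> 2 * (norm u)\<^sup>2 + 2 * (norm v)\<^sup>2" for u v :: "'a::real_inner"
proof -
  have "0 \<le> (norm (u + v))\<^sup>2" by simp
  then show ?thesis
    by (simp add: power2_norm_eq_inner inner_add_left inner_add_right inner_diff_left inner_diff_right inner_commute)
qed

lemma V_upper:
  assumes "0 \<le> \<tau>" "\<tau> \<le> 2 * Tmax"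
  shows "V (x1, x2, \<tau>) \<le> c_hi * ((norm (x1 - zs))\<^sup>2 + (norm (x2 - zs))\<^sup>2)"
proof -
  have "(norm (x2 - x1))\<^sup>2 \<le> 2 * (norm (x2 - zs))\<^sup>2 + 2 * (norm (x1 - zs))\<^sup>2"
    using norm_diff_sq_le[of "x2 - zs" "x1 - zs"] by simp
  moreover have "(k * \<tau>\<^sup>2) * (\<phi> x1 - \<phi> zs) \<le> (k * (2 * Tmax)\<^sup>2) * (L * (norm (x1 - zs))\<^sup>2)"
    using assms k_pos gap_nonneg by (intro mult_mono mult_left_mono power_mono gap_upper) auto
  moreover have "(k * (2 * Tmax)\<^sup>2) * (L * (norm (x1 - zs))\<^sup>2) = 4 * k * Tmax\<^sup>2 * L * (norm (x1 - zs))\<^sup>2"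
    by (simp add: power_mult_distrib)
  moreover have "0 \<le> 4 * k * Tmax\<^sup>2 * L * (norm (x2 - zs))\<^sup>2"
    using k_pos L_pos by simp
  moreover have "c_hi * ((norm (x1 - zs))\<^sup>2 + (norm (x2 - zs))\<^sup>2) = (norm (x1 - zs))\<^sup>2 + (norm (x2 - zs))\<^sup>2
      + 4 * k * Tmax\<^sup>2 * L * (norm (x1 - zs))\<^sup>2 + 4 * k * Tmax\<^sup>2 * L * (norm (x2 - zs))\<^sup>2"
    by (simp add: c_hi_def algebra_simps)
  moreover have "0 \<le> (norm (x1 - zs))\<^sup>2" "0 \<le> (norm (x2 - zs))\<^sup>2" by simp_all
  ultimately show ?thesis
    unfolding V_def case_prod_conv by linarith
qed

text \<open>After a reset both positions coincide, and strong convexity converts |x1 - zs|^2 / 4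
  into a multiple of the gap. \<open>V_start\<close> retains the gap itself because the cost bound
  is relative to the initial cost.\<close>

lemma V_jump: "V (x1, x1, Tmin) \<le> gam * V (x1, x2, Tmax)"
  and V_start: "V (x1, x1, Tmin) \<le> gam * (k * Tmax\<^sup>2) * (\<phi> x1 - \<phi> zs)"
proof -
  have "(norm (x1 - zs))\<^sup>2 / 4 \<le> 1 / (2 * \<theta>) * (\<phi> x1 - \<phi> zs)"
    using gap_lower[of x1] \<theta>_pos by (simp add: field_simps)
  then have "V (x1, x1, Tmin) \<le> (1 / (2 * \<theta>) + k * Tmin\<^sup>2) * (\<phi> x1 - \<phi> zs)"
    by (simp add: V_def distrib_right)
  also have "\<dots> = gam * (k * Tmax\<^sup>2) * (\<phi> x1 - \<phi> zs)"
    using k_pos Tmax_pos by (simp add: gam_def)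
  finally show *: "V (x1, x1, Tmin) \<le> gam * (k * Tmax\<^sup>2) * (\<phi> x1 - \<phi> zs)" .
  have "k * Tmax\<^sup>2 * (\<phi> x1 - \<phi> zs) \<le> V (x1, x2, Tmax)"
    by (simp add: V_def)
  then have "gam * (k * Tmax\<^sup>2 * (\<phi> x1 - \<phi> zs)) \<le> gam * V (x1, x2, Tmax)"
    using gam_pos by (intro mult_left_mono) auto
  then show "V (x1, x1, Tmin) \<le> gam * V (x1, x2, Tmax)"
    using * by (simp add: mult.assoc)
qed

end

section \<open>Decrease along the averaged flow\<close>

lemma has_vector_derivative_cart:
  assumes "\<And>l. ((\<lambda>t. f t $ l) has_real_derivative f' $ l) (at t within S)"
  shows "(f has_vector_derivative (f' :: real^'n)) (at t within S)"
  unfolding has_vector_derivative_def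
proof (subst has_derivative_componentwise_within, rule ballI)
  fix i :: "real^'n" assume "i \<in> Basis"
  then obtain l where i: "i = axis l 1" by (auto simp: Basis_vec_def)
  show "((\<lambda>x. f x \<bullet> i) has_derivative (\<lambda>x. x *\<^sub>R f' \<bullet> i)) (at t within S)"
    using assms[of l]
    by (simp add: i inner_axis has_real_derivative_iff_has_vector_derivative has_vector_derivative_def)
qed

lemma has_real_derivative_vec_nth:
  assumes "(f has_vector_derivative f') (at t within S)"
  shows "((\<lambda>t. f t $ l) has_real_derivative f' $ l) (at t within S)"
  using bounded_linear.has_vector_derivative[OF bounded_linear_vec_nth assms]
  by (simp add: has_real_derivative_iff_has_vector_derivative)

lemma has_real_derivative_norm_sq:
  fixes f :: "real \<Rightarrow> 'a::real_inner"
  assumes "(f has_vector_derivative f') (at t within S)"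
  shows "((\<lambda>t. (norm (f t))\<^sup>2) has_real_derivative 2 * (f t \<bullet> f')) (at t within S)"
  using bounded_bilinear.has_vector_derivative[OF bounded_bilinear_inner assms assms]
  by (simp add: has_real_derivative_iff_has_vector_derivative power2_norm_eq_inner inner_commute)

context hybrid_momentum
begin

lemma phi_chain:
  assumes "(w has_vector_derivative w') (at t within S)"
  shows "((\<lambda>t. \<phi> (w t)) has_real_derivative grad (w t) \<bullet> w') (at t within S)"
  using has_derivative_compose[OF assms[unfolded has_vector_derivative_def] grad]
  by (simp add: has_field_derivative_def mult.commute[of _ "_ \<bullet> _"])

lemma grad_chain:
  assumes "(w has_vector_derivative w') (at t within S)"
  shows "((\<lambda>t. grad (w t)) has_vector_derivative (Hess (w t) *v w')) (at t within S)"
  using has_derivative_compose[OF assms[unfolded has_vector_derivative_def] hess]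
  by (simp add: has_vector_derivative_def matrix_vector_mult_scaleR scaleR_matrix_vector_assoc)

text \<open>Difference quotients of the gradient have norm at most L |h|. Testing them against their
  own limit u makes the limit of the inner products equal to |u|^2.\<close>

lemma norm_Hess_le: "norm (Hess z *v h) \<le> L * norm h"
proof -
  define u where "u = Hess z *v h"
  have "((\<lambda>t. grad (z + t *\<^sub>R h)) has_vector_derivative (Hess (z + 0 *\<^sub>R h) *v h)) (at 0)"
    by (rule grad_chain) (auto intro!: derivative_eq_intros)
  then have "((\<lambda>t. grad (z + t *\<^sub>R h) \<bullet> u) has_real_derivative u \<bullet> u) (at 0)"
    using bounded_linear.has_vector_derivative[OF bounded_linear_inner_left]
    by (fastforce simp: has_real_derivative_iff_has_vector_derivative u_def)
  then have lim: "((\<lambda>t. (grad (z + t *\<^sub>R h) \<bullet> u - grad z \<bullet> u) / t) \<longlongrightarrow> u \<bullet> u) (at 0)"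
    by (simp add: DERIV_def)
  have "norm (u \<bullet> u) \<le> L * norm h * norm u"
  proof (rule Lim_norm_ubound[OF _ lim])
    show "\<forall>\<^sub>F t in at 0. norm ((grad (z + t *\<^sub>R h) \<bullet> u - grad z \<bullet> u) / t) \<le> L * norm h * norm u"
    proof (rule eventually_at_filter[THEN iffD2], rule always_eventually, intro allI impI)
      fix t :: real assume "t \<noteq> 0"
      have "\<bar>(grad (z + t *\<^sub>R h) - grad z) \<bullet> u\<bar> \<le> norm (grad (z + t *\<^sub>R h) - grad z) * norm u"
        by (rule Cauchy_Schwarz_ineq2)
      also have "\<dots> \<le> (L * (\<bar>t\<bar> * norm h)) * norm u"
        using lip[of "z + t *\<^sub>R h" z] by (intro mult_right_mono) auto
      finally show "norm ((grad (z + t *\<^sub>R h) \<bullet> u - grad z \<bullet> u) / t) \<le> L * norm h * norm u"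
        using \<open>t \<noteq> 0\<close> by (simp add: inner_diff_left divide_le_eq mult_ac)
    qed
  qed simp
  then have "norm u * norm u \<le> (L * norm h) * norm u"
    by (simp add: power2_norm_eq_inner[symmetric] power2_eq_square)
  then show ?thesis
    using L_pos by (cases "u = 0") (auto simp: u_def[symmetric])
qed

text \<open>The weights of \<^term>\<open>V\<close> are such that the cross terms \<open>grad w\<^sub>1 \<bullet> (y - w\<^sub>1)\<close> cancel along the flow.\<close>

lemma V_flow_derivative:
  assumes w1: "(w1 has_vector_derivative (2 / \<tau> t) *\<^sub>R (y t - w1 t) + r1) (at t within S)"
    and y: "(y has_vector_derivative (- 2 * k * \<tau> t) *\<^sub>R grad (w1 t) + r2) (at t within S)"
    and \<tau>: "(\<tau> has_real_derivative 1 / 2 + r3) (at t within S)"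
    and bounds: "Tmin / 2 \<le> \<tau> t" "\<tau> t \<le> 2 * Tmax" "norm (w1 t - zs) \<le> R" "norm (y t - zs) \<le> R"
    and small: "norm r1 \<le> \<rho>" "norm r2 \<le> \<rho>" "\<bar>r3\<bar> \<le> \<rho>"
  shows "\<exists>D. ((\<lambda>t. V (w1 t, y t, \<tau> t)) has_real_derivative D) (at t within S) \<and>
    D \<le> - rate * V (w1 t, y t, \<tau> t) + (5 / 2 * R + 4 * k * Tmax * L * R\<^sup>2 + 4 * k * Tmax\<^sup>2 * L * R) * \<rho>"
proof -
  define A where "A = y t - w1 t"
  define Z where "Z = w1 t - zs"
  define g where "g = grad (w1 t)"
  define T where "T = \<tau> t"
  define gap where "gap = \<phi> (w1 t) - \<phi> zs"
  have yz: "y t - zs = A + Z" by (simp add: A_def Z_def)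
  have T: "T > 0" "Tmin / 2 \<le> T" "T \<le> 2 * Tmax" using bounds Tmin_pos by (auto simp: T_def)
  have R: "R \<ge> 0" "\<rho> \<ge> 0" using bounds small norm_ge_zero order_trans by blast+
  have A: "norm A \<le> 2 * R"
    using bounds norm_triangle_ineq4[of "y t - zs" "w1 t - zs"] by (simp add: A_def)
  define w1' where "w1' = (2 / T) *\<^sub>R A + r1"
  define y' where "y' = (- 2 * k * T) *\<^sub>R g + r2"
  have d1: "((\<lambda>t. (norm (y t - w1 t))\<^sup>2) has_real_derivative 2 * (A \<bullet> (y' - w1'))) (at t within S)"
    using has_real_derivative_norm_sq[OF has_vector_derivative_diff[OF y w1]]
    by (simp add: A_def y'_def w1'_def T_def g_def)
  have d2: "((\<lambda>t. (norm (y t - zs))\<^sup>2) has_real_derivative 2 * ((A + Z) \<bullet> y')) (at t within S)"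
    using has_real_derivative_norm_sq[OF has_vector_derivative_diff[OF y has_vector_derivative_const]]
    by (simp add: A_def Z_def y'_def T_def g_def)
  have d3: "((\<lambda>t. \<phi> (w1 t)) has_real_derivative g \<bullet> w1') (at t within S)"
    using phi_chain[OF w1] by (simp add: g_def w1'_def A_def T_def)
  define D where "D = A \<bullet> (y' - w1') / 2 + (A + Z) \<bullet> y' / 2
     + 2 * k * T * (1 / 2 + r3) * gap + k * T\<^sup>2 * (g \<bullet> w1')"
  have "((\<lambda>t. V (w1 t, y t, \<tau> t)) has_real_derivative D) (at t within S)"
    unfolding V_def D_def case_prod_conv
    by (rule derivative_eq_intros d1 d2 d3 \<tau> refl | simp)+
       (simp add: T_def gap_def field_simps power2_eq_square)
  \<comment> \<open>The term k T gap comes from the growing weight k \<tau>^2; the pull of the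
    gradient on x2 contributes - k T (g \<bullet> Z), which outweighs it by \<open>gap_grad\<close>.
    The bracket collects the residuals r1, r2, r3.\<close>
  moreover have "D = - (1 / T) * (A \<bullet> A) + k * T * (gap - g \<bullet> Z)
      + (A \<bullet> (r2 - r1) / 2 + (A + Z) \<bullet> r2 / 2 + 2 * k * T * r3 * gap + k * T\<^sup>2 * (g \<bullet> r1))"
    using T unfolding D_def y'_def w1'_def
    by (simp add: inner_diff_right inner_diff_left inner_add_left inner_add_right inner_commute field_simps power2_eq_square)
  moreover have "- (1 / T) * (A \<bullet> A) \<le> - (1 / (2 * Tmax)) * (norm A)\<^sup>2"
    using T Tmax_pos by (simp add: power2_norm_eq_inner[symmetric] frac_le)
  moreover have "k * T * (gap - g \<bullet> Z) \<le> - (k * Tmin * \<theta> / 4) * (norm Z)\<^sup>2"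
  proof -
    have "k * T * (gap - g \<bullet> Z) \<le> k * T * (- (\<theta> / 2 * (norm Z)\<^sup>2))"
      using gap_grad[of "w1 t"] T k_pos by (intro mult_left_mono) (auto simp: gap_def g_def Z_def)
    also have "\<dots> \<le> k * (Tmin / 2) * (- (\<theta> / 2 * (norm Z)\<^sup>2))"
      using T k_pos \<theta>_pos by (intro mult_right_mono_neg mult_left_mono) auto
    finally show ?thesis by simp
  qed
  moreover have "A \<bullet> (r2 - r1) / 2 \<le> 2 * R * \<rho>"
  proof -
    have "A \<bullet> (r2 - r1) \<le> norm A * norm (r2 - r1)" by (rule norm_cauchy_schwarz)
    also have "\<dots> \<le> (2 * R) * (2 * \<rho>)"
      using A R small norm_triangle_ineq4[of r2 r1] by (intro mult_mono) auto
    finally show ?thesis by simp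
  qed
  moreover have "(A + Z) \<bullet> r2 / 2 \<le> R * \<rho> / 2"
  proof -
    have "(A + Z) \<bullet> r2 \<le> norm (A + Z) * norm r2" by (rule norm_cauchy_schwarz)
    also have "\<dots> \<le> R * \<rho>"
      using bounds R small yz by (intro mult_mono) auto
    finally show ?thesis by simp
  qed
  moreover have "2 * k * T * r3 * gap \<le> 4 * k * Tmax * L * R\<^sup>2 * \<rho>"
  proof -
    have "gap \<le> L * R\<^sup>2"
      using gap_upper[of "w1 t"] bounds L_pos unfolding gap_def
      by (smt (verit) mult_left_mono norm_ge_zero power_mono)
    moreover have "gap \<ge> 0" using gap_nonneg by (simp add: gap_def)
    moreover have "T * r3 \<le> 2 * Tmax * \<rho>"
      using T small R Tmax_pos mult_left_mono[of r3 \<rho> T] mult_right_mono[of T "2 * Tmax" \<rho>] by linarith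
    ultimately have "(T * r3) * gap \<le> (2 * Tmax * \<rho>) * gap" "(2 * Tmax * \<rho>) * gap \<le> (2 * Tmax * \<rho>) * (L * R\<^sup>2)"
      using R Tmax_pos by (auto intro!: mult_right_mono mult_left_mono)
    then have "(T * r3) * gap \<le> (2 * Tmax * \<rho>) * (L * R\<^sup>2)" by linarith
    then have "2 * k * ((T * r3) * gap) \<le> 2 * k * ((2 * Tmax * \<rho>) * (L * R\<^sup>2))"
      using k_pos by (intro mult_left_mono) auto
    then show ?thesis by (simp add: mult_ac)
  qed
  moreover have "k * T\<^sup>2 * (g \<bullet> r1) \<le> 4 * k * Tmax\<^sup>2 * L * R * \<rho>"
  proof -
    have "norm g \<le> L * R"
      using norm_grad_le[of "w1 t"] bounds L_pos unfolding g_def by (smt (verit) mult_left_mono)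
    then have "norm g * norm r1 \<le> (L * R) * \<rho>"
      using small R L_pos by (intro mult_mono) auto
    then have "g \<bullet> r1 \<le> L * R * \<rho>" using norm_cauchy_schwarz[of g r1] by simp
    moreover have "T\<^sup>2 \<le> (2 * Tmax)\<^sup>2" using T by (intro power_mono) auto
    ultimately have "(k * T\<^sup>2) * (g \<bullet> r1) \<le> (k * T\<^sup>2) * (L * R * \<rho>)"
        and "(k * T\<^sup>2) * (L * R * \<rho>) \<le> (k * (2 * Tmax)\<^sup>2) * (L * R * \<rho>)"
      subgoal using k_pos by (intro mult_left_mono) auto
      subgoal using k_pos L_pos R \<open>T\<^sup>2 \<le> (2 * Tmax)\<^sup>2\<close> by (intro mult_right_mono mult_left_mono) auto
      done
    then have "(k * T\<^sup>2) * (g \<bullet> r1) \<le> (k * (2 * Tmax)\<^sup>2) * (L * R * \<rho>)" by linarith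
    then show ?thesis by (simp add: power_mult_distrib mult_ac)
  qed
  moreover have "rate * V (w1 t, y t, \<tau> t) \<le> 1 / (2 * Tmax) * (norm A)\<^sup>2 + (k * Tmin * \<theta> / 4) * (norm Z)\<^sup>2"
  proof -
    define m where "m = min (1 / (4 * Tmax)) (k * Tmin * \<theta> / 8)"
    have m: "m > 0" using k_pos \<theta>_pos Tmin_pos Tmax_pos by (simp add: m_def)
    have "V (w1 t, y t, \<tau> t) \<le> c_hi * ((norm Z)\<^sup>2 + (norm (A + Z))\<^sup>2)"
      using V_upper[of "\<tau> t" "w1 t" "y t"] T by (simp add: Z_def[symmetric] yz T_def)
    also have "\<dots> \<le> c_hi * (3 * ((norm A)\<^sup>2 + (norm Z)\<^sup>2))"
    proof (rule mult_left_mono)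
      have "(norm (A + Z))\<^sup>2 \<le> 2 * (norm A)\<^sup>2 + 2 * (norm Z)\<^sup>2" "0 \<le> (norm A)\<^sup>2"
        using norm_diff_sq_le[of A "- Z"] by auto
      then show "(norm Z)\<^sup>2 + (norm (A + Z))\<^sup>2 \<le> 3 * ((norm A)\<^sup>2 + (norm Z)\<^sup>2)"
        unfolding distrib_left by linarith
    qed (use c_hi_pos in auto)
    finally have "rate * V (w1 t, y t, \<tau> t) \<le> rate * (c_hi * (3 * ((norm A)\<^sup>2 + (norm Z)\<^sup>2)))"
      using rate_pos by simp
    also have "\<dots> = m * (norm A)\<^sup>2 + m * (norm Z)\<^sup>2"
      using c_hi_pos unfolding rate_def m_def[symmetric] by (simp add: field_simps)
    also have "\<dots> \<le> 1 / (2 * Tmax) * (norm A)\<^sup>2 + (k * Tmin * \<theta> / 4) * (norm Z)\<^sup>2"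
    proof -
      have "m \<le> 1 / (4 * Tmax)" "m \<le> k * Tmin * \<theta> / 8" by (auto simp: m_def)
      moreover have "1 / (4 * Tmax) \<le> 1 / (2 * Tmax)" using Tmax_pos by (simp add: frac_le)
      moreover have "k * Tmin * \<theta> > 0" using k_pos \<theta>_pos Tmin_pos by simp
      ultimately have "m \<le> 1 / (2 * Tmax)" "m \<le> k * Tmin * \<theta> / 4" by linarith+
      then show ?thesis by (intro add_mono mult_right_mono) auto
    qed
    finally show ?thesis .
  qed
  ultimately have "((\<lambda>t. V (w1 t, y t, \<tau> t)) has_real_derivative D) (at t within S)"
    "D \<le> - (rate * V (w1 t, y t, \<tau> t)) + (2 * R * \<rho> + R * \<rho> / 2 + 4 * k * Tmax * L * R\<^sup>2 * \<rho> + 4 * k * Tmax\<^sup>2 * L * R * \<rho>)"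
    by linarith+
  then show ?thesis
    by (intro exI[of _ D]) (simp add: algebra_simps)
qed

section \<open>Averaging by a near-identity change of coordinates\<close>

definition om :: "'n \<Rightarrow> real" where "om l = 2 * pi * \<kappa> l"

lemma om_pos: "om l > 0"
  using \<kappa>_pos by (simp add: om_def)

lemma om_sq_neq: "l \<noteq> m \<Longrightarrow> (om l)\<^sup>2 - (om m)\<^sup>2 \<noteq> 0"
  using om_pos[of l] om_pos[of m] \<kappa>_inj
  by (auto simp: om_def power2_eq_iff inj_eq)

text \<open>Along the unperturbed rotation, \<open>\<epsilon> pairQ\<close> is an antiderivative of the oscillating part
  \<open>mc\<^sub>l mc\<^sub>m - \<delta>\<^sub>l\<^sub>m / 2\<close> of the dither products; distinct frequencies make it well defined.\<close>

definition pairQ :: "real^'n \<Rightarrow> real^'n \<Rightarrow> 'n \<Rightarrow> 'n \<Rightarrow> real" where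
  "pairQ c s l m = (if l = m then - (c $ l * s $ l) / (2 * om l)
     else (om m * (c $ l * s $ m) - om l * (s $ l * c $ m)) / ((om l)\<^sup>2 - (om m)\<^sup>2))"

text \<open>The product rule applied to \<open>pairQ\<close>, with c' and s' left free so that it
  also serves curves that rotate only approximately.\<close>

definition pairQ' :: "real^'n \<Rightarrow> real^'n \<Rightarrow> real^'n \<Rightarrow> real^'n \<Rightarrow> 'n \<Rightarrow> 'n \<Rightarrow> real" where
  "pairQ' c s c' s' l m = (if l = m then - (c' $ l * s $ l + c $ l * s' $ l) / (2 * om l)
     else (om m * (c' $ l * s $ m + c $ l * s' $ m) - om l * (s' $ l * c $ m + s $ l * c' $ m)) / ((om l)\<^sup>2 - (om m)\<^sup>2))"

text \<open>The first term cancels the oscillation -(4k/a) \<tau> \<phi>(w) c of order 1/a. The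
  second removes the oscillating part of -4 k \<tau> (grad w \<bullet> c) c, leaving its mean -2 k
  \<tau> grad w.\<close>

definition corr :: "real \<Rightarrow> real^'n \<Rightarrow> real \<Rightarrow> real^'n \<Rightarrow> real^'n \<Rightarrow> real^'n" where
  "corr a w \<tau> c s = (\<chi> l. - (4 * k / a) * (\<tau> * \<phi> w * (s $ l / om l)) + 4 * k * (\<Sum>m\<in>UNIV. \<tau> * grad w $ m * pairQ c s l m))"

definition corr' :: "real \<Rightarrow> real^'n \<Rightarrow> real \<Rightarrow> real^'n \<Rightarrow> real^'n \<Rightarrow> real^'n \<Rightarrow> real \<Rightarrow> real^'n \<Rightarrow> real^'n \<Rightarrow> real^'n" where
  "corr' a w \<tau> c s w' \<tau>' c' s' = (\<chi> l.
     - (4 * k / a) * ((\<tau>' * \<phi> w + \<tau> * (grad w \<bullet> w')) * (s $ l / om l) + \<tau> * \<phi> w * (s' $ l / om l))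
     + 4 * k * (\<Sum>m\<in>UNIV. (\<tau>' * grad w $ m + \<tau> * (Hess w *v w') $ m) * pairQ c s l m
         + \<tau> * grad w $ m * pairQ' c s c' s' l m))"

lemma corr_has_derivative:
  assumes w: "(w has_vector_derivative w') (at t within S)"
    and \<tau>: "(\<tau> has_real_derivative \<tau>') (at t within S)"
    and c: "(c has_vector_derivative c') (at t within S)"
    and s: "(s has_vector_derivative s') (at t within S)"
  shows "((\<lambda>t. corr a (w t) (\<tau> t) (c t) (s t)) has_vector_derivative
    corr' a (w t) (\<tau> t) (c t) (s t) w' \<tau>' c' s') (at t within S)"
proof (rule has_vector_derivative_cart)
  fix l
  note cl = has_real_derivative_vec_nth[OF c] and sl = has_real_derivative_vec_nth[OF s]
  note gl = has_real_derivative_vec_nth[OF grad_chain[OF w]]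
  have pq: "((\<lambda>t. pairQ (c t) (s t) l m) has_real_derivative pairQ' (c t) (s t) c' s' l m) (at t within S)" for m
  proof (cases "l = m")
    case True
    have "((\<lambda>t. - (c t $ l * s t $ l) / (2 * om l)) has_real_derivative
       - (c' $ l * s t $ l + c t $ l * s' $ l) / (2 * om l)) (at t within S)"
      by (intro DERIV_cdivide) (auto intro!: derivative_eq_intros cl sl simp: mult_ac)
    then show ?thesis by (simp add: pairQ_def pairQ'_def True)
  next
    case False
    have "((\<lambda>t. (om m * (c t $ l * s t $ m) - om l * (s t $ l * c t $ m)) / ((om l)\<^sup>2 - (om m)\<^sup>2)) has_real_derivative
       (om m * (c' $ l * s t $ m + c t $ l * s' $ m) - om l * (s' $ l * c t $ m + s t $ l * c' $ m)) / ((om l)\<^sup>2 - (om m)\<^sup>2)) (at t within S)"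
      by (intro DERIV_cdivide) (auto intro!: derivative_eq_intros cl sl simp: algebra_simps)
    then show ?thesis by (simp add: pairQ_def pairQ'_def False)
  qed
  have 1: "((\<lambda>t. \<tau> t * \<phi> (w t) * (s t $ l / om l)) has_real_derivative
     (\<tau>' * \<phi> (w t) + \<tau> t * (grad (w t) \<bullet> w')) * (s t $ l / om l) + \<tau> t * \<phi> (w t) * (s' $ l / om l)) (at t within S)"
    by (rule DERIV_cong[OF DERIV_mult[OF DERIV_mult[OF \<tau> phi_chain[OF w]] DERIV_cdivide[OF sl, of l "om l"]]])
      (simp add: algebra_simps)
  have 2: "((\<lambda>t. \<tau> t * grad (w t) $ m * pairQ (c t) (s t) l m) has_real_derivative
      (\<tau>' * grad (w t) $ m + \<tau> t * (Hess (w t) *v w') $ m) * pairQ (c t) (s t) l m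
         + \<tau> t * grad (w t) $ m * pairQ' (c t) (s t) c' s' l m) (at t within S)" for m
    by (rule derivative_eq_intros \<tau> gl pq refl)+ (simp add: algebra_simps)
  show "((\<lambda>t. corr a (w t) (\<tau> t) (c t) (s t) $ l) has_real_derivative
    corr' a (w t) (\<tau> t) (c t) (s t) w' \<tau>' c' s' $ l) (at t within S)"
    unfolding corr_def corr'_def vec_lambda_beta
    by (intro DERIV_add DERIV_cmult 1 DERIV_sum 2)
qed

text \<open>Only finitely many frequencies occur, so one maximum covers them, their reciprocals and
  the small divisors.\<close>

lemma frequency_bound: "\<exists>M\<ge>1. (\<forall>l. om l \<le> M \<and> 1 / om l \<le> M) \<and> (\<forall>l m. l \<noteq> m \<longrightarrow> 1 / \<bar>(om l)\<^sup>2 - (om m)\<^sup>2\<bar> \<le> M)"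
proof -
  define S where "S = {1} \<union> range om \<union> range (\<lambda>l. 1 / om l) \<union> range (\<lambda>(l, m). 1 / \<bar>(om l)\<^sup>2 - (om m)\<^sup>2\<bar>)"
  have fin: "finite S" by (simp add: S_def)
  have "x \<le> Max S" if "x \<in> S" for x using fin that by simp
  then show ?thesis
    by (intro exI[of _ "Max S"]) (auto simp: S_def)
qed

lemma pairQ_bound:
  assumes M: "M \<ge> 1" "\<And>l. om l \<le> M \<and> 1 / om l \<le> M" "\<And>l m. l \<noteq> m \<Longrightarrow> 1 / \<bar>(om l)\<^sup>2 - (om m)\<^sup>2\<bar> \<le> M"
    and cs: "\<And>l. \<bar>c $ l\<bar> \<le> 2" "\<And>l. \<bar>s $ l\<bar> \<le> 2"
  shows "\<bar>pairQ c s l m\<bar> \<le> 8 * M\<^sup>2"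
proof -
  have prod: "\<bar>c $ i * s $ j\<bar> \<le> 4" for i j
    unfolding abs_mult using mult_mono[OF cs(1)[of i] cs(2)[of j]] by simp
  show ?thesis
  proof (cases "l = m")
    case True
    have "\<bar>pairQ c s l m\<bar> = \<bar>c $ l * s $ l\<bar> / 2 * (1 / om l)"
      using om_pos[of l] by (simp add: pairQ_def True abs_mult)
    also have "\<dots> \<le> 2 * M"
      using prod[of l l] M(1) M(2)[of l] om_pos[of l] by (intro mult_mono) auto
    also have "\<dots> \<le> 8 * M\<^sup>2" using M(1) by (simp add: power2_eq_square)
    finally show ?thesis .
  next
    case False
    have t: "\<bar>om i * (c $ p * s $ q)\<bar> \<le> M * 4" for i p q
      unfolding abs_mult[of "om i"] using M(1) M(2)[of i] om_pos[of i] prod[of p q] by (intro mult_mono) auto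
    have "\<bar>om m * (c $ l * s $ m) - om l * (s $ l * c $ m)\<bar> \<le> 8 * M"
      using t[of m l m] t[of l m l] abs_triangle_ineq4[of "om m * (c $ l * s $ m)" "om l * (s $ l * c $ m)"]
      by (simp add: mult.commute[of "s $ l"])
    then have "\<bar>om m * (c $ l * s $ m) - om l * (s $ l * c $ m)\<bar> * (1 / \<bar>(om l)\<^sup>2 - (om m)\<^sup>2\<bar>) \<le> (8 * M) * M"
      using M(1) M(3)[OF False] by (intro mult_mono) auto
    then show ?thesis by (simp add: pairQ_def False power2_eq_square)
  qed
qed

text \<open>On an exact rotation of unit circles the expression in the absolute value vanishes.
  Defects of size \<eta> in the circle equation and in the derivatives enter linearly, with bounded
  coefficients.\<close>

lemma pairQ'_approx:
  assumes M: "M \<ge> 1" "\<And>l. om l \<le> M \<and> 1 / om l \<le> M" "\<And>l m. l \<noteq> m \<Longrightarrow> 1 / \<bar>(om l)\<^sup>2 - (om m)\<^sup>2\<bar> \<le> M"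
    and cs: "\<And>l. \<bar>c $ l\<bar> \<le> 2" "\<And>l. \<bar>s $ l\<bar> \<le> 2"
    and circle: "\<And>l. \<bar>(c $ l)\<^sup>2 + (s $ l)\<^sup>2 - 1\<bar> \<le> \<eta>"
    and c': "\<And>l. c' $ l = (1 / \<epsilon>) * om l * s $ l + d $ l"
    and s': "\<And>l. s' $ l = - (1 / \<epsilon>) * om l * c $ l + f $ l"
    and d: "\<And>l. \<bar>d $ l\<bar> \<le> \<eta>" "\<And>l. \<bar>f $ l\<bar> \<le> \<eta>" and \<epsilon>: "0 < \<epsilon>" "\<epsilon> \<le> 1"
  shows "\<bar>\<epsilon> * pairQ' c s c' s' l m - c $ l * c $ m + (if l = m then 1 / 2 else 0)\<bar> \<le> 9 * M\<^sup>2 * \<eta>"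
proof -
  have \<eta>: "\<eta> \<ge> 0" using d(1)[of l] by linarith
  have ec: "\<epsilon> * c' $ i = om i * s $ i + \<epsilon> * d $ i" and es: "\<epsilon> * s' $ i = - (om i * c $ i) + \<epsilon> * f $ i" for i
    using \<epsilon> by (auto simp: c' s' field_simps)
  have ed: "\<bar>\<epsilon> * d $ i\<bar> \<le> \<eta>" "\<bar>\<epsilon> * f $ i\<bar> \<le> \<eta>" for i
    unfolding abs_mult using mult_mono[of "\<bar>\<epsilon>\<bar>" 1 "\<bar>d $ i\<bar>" \<eta>] mult_mono[of "\<bar>\<epsilon>\<bar>" 1 "\<bar>f $ i\<bar>" \<eta>] \<epsilon> d[of i] by auto
  have p1: "\<bar>(\<epsilon> * d $ i) * s $ j\<bar> \<le> 2 * \<eta>" for i j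
    unfolding abs_mult[of "\<epsilon> * d $ i"] using mult_mono[OF ed(1)[of i] cs(2)[of j]] \<eta> by simp
  have p2: "\<bar>c $ j * (\<epsilon> * f $ i)\<bar> \<le> 2 * \<eta>" for i j
    unfolding abs_mult[of "c $ j"] using mult_mono[OF cs(1)[of j] ed(2)[of i]] \<eta> by simp
  have om: "om i > 0" for i by (rule om_pos)
  have M2: "M \<le> M\<^sup>2" "1 \<le> M\<^sup>2" using M(1) by (simp_all add: power2_eq_square one_le_power mult_ge1_I)
  show ?thesis
  proof (cases "l = m")
    case True
    define E where "E = (\<epsilon> * d $ l) * s $ l + c $ l * (\<epsilon> * f $ l)"
    have "\<epsilon> * pairQ' c s c' s' l m = - ((\<epsilon> * c' $ l) * s $ l + c $ l * (\<epsilon> * s' $ l)) / (2 * om l)"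
      by (simp add: pairQ'_def True algebra_simps)
    also have "\<dots> = - (om l * ((s $ l)\<^sup>2 - (c $ l)\<^sup>2) + E) / (2 * om l)"
      unfolding ec es E_def by (simp add: algebra_simps power2_eq_square)
    also have "\<dots> = (c $ l)\<^sup>2 - 1 / 2 - ((c $ l)\<^sup>2 + (s $ l)\<^sup>2 - 1) / 2 - E / 2 * (1 / om l)"
      using om[of l] by (simp add: field_simps)
    finally have "\<epsilon> * pairQ' c s c' s' l m - (c $ l)\<^sup>2 + 1 / 2
       = - ((c $ l)\<^sup>2 + (s $ l)\<^sup>2 - 1) / 2 - E / 2 * (1 / om l)"
      by linarith
    then have eq: "\<epsilon> * pairQ' c s c' s' l m - c $ l * c $ m + (if l = m then 1 / 2 else 0)
       = - ((c $ l)\<^sup>2 + (s $ l)\<^sup>2 - 1) / 2 - E / 2 * (1 / om l)"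
      using True by (simp only: power2_eq_square if_True simp_thms)
    have "\<bar>E\<bar> \<le> 4 * \<eta>"
      using p1[of l l] p2[of l l] unfolding E_def by linarith
    then have "\<bar>E / 2\<bar> * (1 / om l) \<le> (2 * \<eta>) * M"
      using M(2)[of l] om[of l] \<eta> by (intro mult_mono) auto
    moreover have "\<bar>E / 2 * (1 / om l)\<bar> = \<bar>E / 2\<bar> * (1 / om l)" using om[of l] by (simp add: abs_mult)
    moreover have "(2 * \<eta>) * M \<le> (2 * \<eta>) * M\<^sup>2" "\<eta> * 1 \<le> \<eta> * M\<^sup>2"
      using M2 \<eta> by (intro mult_left_mono; simp)+
    ultimately show ?thesis
      unfolding eq using circle[of l] \<eta> by argo
  next
    case False
    define q where "q = (om l)\<^sup>2 - (om m)\<^sup>2"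
    have q: "q \<noteq> 0" using om_sq_neq[OF False] by (simp add: q_def)
    define E where "E = om m * ((\<epsilon> * d $ l) * s $ m + c $ l * (\<epsilon> * f $ m)) - om l * (c $ m * (\<epsilon> * f $ l) + (\<epsilon> * d $ m) * s $ l)"
    have "\<epsilon> * pairQ' c s c' s' l m = (om m * ((\<epsilon> * c' $ l) * s $ m + c $ l * (\<epsilon> * s' $ m))
         - om l * ((\<epsilon> * s' $ l) * c $ m + s $ l * (\<epsilon> * c' $ m))) / q"
      by (simp add: pairQ'_def False q_def algebra_simps)
    \<comment> \<open>The products of two sine components cancel, and \<open>c $ l * c $ m\<close>
      is left with the coefficient \<open>q\<close>; this is what fixes the weights in
      \<open>pairQ\<close>.\<close>
    also have "\<dots> = (q * (c $ l * c $ m) + E) / q"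
      unfolding ec es E_def q_def by (simp add: algebra_simps power2_eq_square)
    also have "\<dots> = c $ l * c $ m + E * (1 / q)" using q by (simp add: field_simps)
    finally have eq: "\<epsilon> * pairQ' c s c' s' l m - c $ l * c $ m + (if l = m then 1 / 2 else 0) = E * (1 / q)"
      by (simp add: False)
    have e1: "\<bar>om m * ((\<epsilon> * d $ l) * s $ m + c $ l * (\<epsilon> * f $ m))\<bar> \<le> M * (4 * \<eta>)"
      unfolding abs_mult[of "om m"] using M(1) M(2)[of m] om[of m] p1[of l m] p2[of l m]
      by (intro mult_mono) auto
    have e2: "\<bar>om l * (c $ m * (\<epsilon> * f $ l) + (\<epsilon> * d $ m) * s $ l)\<bar> \<le> M * (4 * \<eta>)"
      unfolding abs_mult[of "om l"] using M(1) M(2)[of l] om[of l] p1[of m l] p2[of m l]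
      by (intro mult_mono) auto
    have "\<bar>E\<bar> \<le> 8 * M * \<eta>" using e1 e2 unfolding E_def by linarith
    then have "\<bar>E\<bar> * (1 / \<bar>q\<bar>) \<le> (8 * M * \<eta>) * M"
      using M(1) M(3)[OF False] \<eta> unfolding q_def by (intro mult_mono) auto
    also have "\<dots> \<le> 9 * M\<^sup>2 * \<eta>" using M(1) \<eta> by (simp add: power2_eq_square)
    finally show ?thesis unfolding eq by (simp add: abs_mult)
  qed
qed

text \<open>The defect \<eta> admits curves that solve the differential equation only approximately
  and leave the torus slightly. It is needed because the smoothed curve has the flow map at the
  perturbed solution, not at itself, as derivative.\<close>

definition near_flow :: "real \<Rightarrow> real \<Rightarrow> real \<Rightarrow> real \<Rightarrow> 'n hstate \<Rightarrow> 'n hstate \<Rightarrow> bool" where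
  "near_flow R a \<epsilon> \<eta> p p' \<longleftrightarrow> (case p of (w1, w2, \<tau>, c, s) \<Rightarrow>
     norm (w1 - zs) \<le> R \<and> norm (w2 - zs) \<le> R \<and> Tmin / 2 \<le> \<tau> \<and> \<tau> \<le> 2 * Tmax \<and>
     (\<forall>l. \<bar>(c $ l)\<^sup>2 + (s $ l)\<^sup>2 - 1\<bar> \<le> \<eta>)) \<and> norm (p' - flow_map \<phi> \<kappa> k a \<epsilon> p) \<le> \<eta>"

lemma near_flowD:
  assumes "near_flow R a \<epsilon> \<eta> (w1, w2, \<tau>, c, s) (w1', w2', \<tau>', c', s')"
  shows "norm (w1 - zs) \<le> R" "norm (w2 - zs) \<le> R" "Tmin / 2 \<le> \<tau>" "\<tau> \<le> 2 * Tmax"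
    and "\<bar>(c $ l)\<^sup>2 + (s $ l)\<^sup>2 - 1\<bar> \<le> \<eta>"
    and "norm (w1' - (2 / \<tau>) *\<^sub>R (w2 - w1)) \<le> \<eta>"
    and "norm (w2' - (- (4 / a) * k * \<tau> * \<phi> (w1 + a *\<^sub>R c)) *\<^sub>R c) \<le> \<eta>"
    and "\<bar>\<tau>' - 1 / 2\<bar> \<le> \<eta>"
    and "\<bar>c' $ l - (1 / \<epsilon>) * om l * s $ l\<bar> \<le> \<eta>"
    and "\<bar>s' $ l - (- (1 / \<epsilon>) * om l * c $ l)\<bar> \<le> \<eta>"
proof -
  define d where "d = (w1', w2', \<tau>', c', s') - flow_map \<phi> \<kappa> k a \<epsilon> (w1, w2, \<tau>, c, s)"
  have d: "norm d \<le> \<eta>" using assms by (simp add: near_flow_def d_def)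
  have n: "norm (fst p) \<le> norm p" "norm (snd p) \<le> norm p" for p :: "'x::real_normed_vector \<times> 'y::real_normed_vector"
    using norm_fst_le[of "fst p" "snd p"] norm_snd_le[of "snd p" "fst p"] by simp_all
  have s1: "norm (fst d) \<le> \<eta>" "norm (snd d) \<le> \<eta>" using n[of d] d by auto
  have s2: "norm (fst (snd d)) \<le> \<eta>" "norm (snd (snd d)) \<le> \<eta>" using n[of "snd d"] s1 by auto
  have s3: "norm (fst (snd (snd d))) \<le> \<eta>" "norm (snd (snd (snd d))) \<le> \<eta>" using n[of "snd (snd d)"] s2 by auto
  have s4: "norm (fst (snd (snd (snd d)))) \<le> \<eta>" "norm (snd (snd (snd (snd d)))) \<le> \<eta>"
    using n[of "snd (snd (snd d))"] s3 by auto
  have s5: "\<bar>fst (snd (snd (snd d))) $ l\<bar> \<le> \<eta>" "\<bar>snd (snd (snd (snd d))) $ l\<bar> \<le> \<eta>"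
    using s4 component_le_norm_cart order_trans by blast+
  show "norm (w1 - zs) \<le> R" "norm (w2 - zs) \<le> R" "Tmin / 2 \<le> \<tau>" "\<tau> \<le> 2 * Tmax"
    "\<bar>(c $ l)\<^sup>2 + (s $ l)\<^sup>2 - 1\<bar> \<le> \<eta>"
    using assms by (simp_all add: near_flow_def)
  show "norm (w1' - (2 / \<tau>) *\<^sub>R (w2 - w1)) \<le> \<eta>"
    "norm (w2' - (- (4 / a) * k * \<tau> * \<phi> (w1 + a *\<^sub>R c)) *\<^sub>R c) \<le> \<eta>"
    "\<bar>\<tau>' - 1 / 2\<bar> \<le> \<eta>"
    "\<bar>c' $ l - (1 / \<epsilon>) * om l * s $ l\<bar> \<le> \<eta>"
    "\<bar>s' $ l - (- (1 / \<epsilon>) * om l * c $ l)\<bar> \<le> \<eta>"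
    using s1(1) s2(1) s3(1) s5 by (simp_all add: d_def flow_map_def om_def mult.assoc)
qed

lemma circle_component_le:
  assumes "\<bar>x\<^sup>2 + y\<^sup>2 - 1\<bar> \<le> \<eta>" "\<eta> \<le> 1"
  shows "\<bar>x :: real\<bar> \<le> 2" "\<bar>y\<bar> \<le> 2"
proof -
  have "0 \<le> x\<^sup>2" "0 \<le> y\<^sup>2" by simp_all
  then have "x\<^sup>2 \<le> 4" "y\<^sup>2 \<le> 4" using assms by linarith+
  then show "\<bar>x\<bar> \<le> 2" "\<bar>y\<bar> \<le> 2" using abs_le_square_iff[of x 2] abs_le_square_iff[of y 2] by auto
qed

text \<open>After multiplication by \<epsilon> the fast derivatives cancel the terms of order 1/a
  and 1. There remain the Taylor remainder (order a), the slow derivatives together with the defect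
  of the leading correction (order \<epsilon>/a), and the other defects (order \<eta>). With plain
  numbers below a single M this is pure arithmetic.\<close>

lemma residual_component:
  fixes g c q B err :: "'n \<Rightarrow> real" and M :: real
  assumes a: "0 < a" "a \<le> 1" and e: "0 < \<epsilon>" "\<epsilon> \<le> 1" and \<eta>: "0 \<le> \<eta>" and M: "M \<ge> 1"
    and kM: "0 \<le> k" "k \<le> M" and \<tau>: "0 \<le> \<tau>" "\<tau> \<le> M" and F: "\<bar>F\<bar> \<le> M" and p: "\<bar>p\<bar> \<le> M"
    and g: "\<And>m. \<bar>g m\<bar> \<le> M" and q: "\<And>m. \<bar>q m\<bar> \<le> M" and B: "\<And>m. \<bar>B m\<bar> \<le> M"
    and err: "\<And>m. \<bar>err m\<bar> \<le> M * \<eta>" and c: "\<bar>c l\<bar> \<le> M" and s: "\<bar>s\<bar> \<le> M"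
    and s5: "\<bar>s5\<bar> \<le> M * \<epsilon>" and Ty: "\<bar>Ty\<bar> \<le> M * a\<^sup>2" and d2: "\<bar>d2\<bar> \<le> \<eta>"
    and B': "\<And>m. \<epsilon> * B' m = err m + c l * c m - (if l = m then 1 / 2 else 0)"
    and s': "\<epsilon> * s' = s5 - c l"
  shows "\<bar>(- (4 / a) * k * \<tau> * (F + a * (\<Sum>m\<in>UNIV. g m * c m) + Ty) * c l + d2)
     + \<epsilon> * (- (4 * k / a) * (p * s + \<tau> * F * s') + 4 * k * (\<Sum>m\<in>UNIV. q m * B m + \<tau> * g m * B' m))
     + 2 * k * \<tau> * g l\<bar> \<le> 13 * real CARD('n) * M ^ 4 * (a + \<epsilon> / a + \<eta>)" (is "\<bar>?lhs\<bar> \<le> _")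
proof -
  have sum1: "(\<Sum>m\<in>UNIV. g m * (\<epsilon> * B' m)) = (\<Sum>m\<in>UNIV. g m * err m) + c l * (\<Sum>m\<in>UNIV. g m * c m) - g l / 2"
  proof -
    have "(\<Sum>m\<in>UNIV. g m * (\<epsilon> * B' m)) = (\<Sum>m\<in>UNIV. g m * err m + c l * (g m * c m) - (if l = m then g m / 2 else 0))"
      by (intro sum.cong refl) (simp add: B' algebra_simps)
    then show ?thesis by (simp add: sum.distrib sum_subtractf sum_distrib_left)
  qed
  have sum2: "\<epsilon> * (\<Sum>m\<in>UNIV. q m * B m + \<tau> * g m * B' m)
      = \<epsilon> * (\<Sum>m\<in>UNIV. q m * B m) + \<tau> * (\<Sum>m\<in>UNIV. g m * (\<epsilon> * B' m))"
    by (simp add: sum.distrib sum_distrib_left algebra_simps)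
  define S1 where "S1 = (\<Sum>m\<in>UNIV. g m * err m)"
  define S2 where "S2 = (\<Sum>m\<in>UNIV. q m * B m)"
  define S3 where "S3 = (\<Sum>m\<in>UNIV. g m * c m)"
  have "?lhs = (- (4 / a) * k * \<tau> * (F + a * S3 + Ty) * c l + d2)
     + (- (4 * k / a) * (\<epsilon> * p * s + \<tau> * F * (s5 - c l)) + 4 * k * (\<epsilon> * S2 + \<tau> * (S1 + c l * S3 - g l / 2)))
     + 2 * k * \<tau> * g l"
    unfolding S1_def S2_def S3_def sum1[symmetric] sum2[symmetric] s'[symmetric] by (simp add: algebra_simps)
  \<comment> \<open>The terms with \<open>F * c l\<close> and with \<open>c l * S3\<close> cancel in
    pairs, and the mean \<open>g l / 2\<close> cancels against the added drift
    \<open>2 * k * \<tau> * g l\<close>.\<close>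
  also have "\<dots> = d2 - (4 / a) * (k * \<tau> * Ty * c l) - (4 / a) * (k * \<epsilon> * p * s) - (4 / a) * (k * \<tau> * F * s5)
      + 4 * (k * \<epsilon> * S2) + 4 * (k * \<tau> * S1)"
    using a by (simp add: field_simps)
  finally have eq: "?lhs = \<dots>" .
  define N where "N = real CARD('n)"
  have N: "N \<ge> 1" by (simp add: N_def Suc_leI)
  have pm: "\<bar>u * v\<bar> \<le> x * y" if "\<bar>u\<bar> \<le> x" "\<bar>v\<bar> \<le> y" for u v x y :: real
    using that unfolding abs_mult by (intro mult_mono) auto
  have k': "\<bar>k\<bar> \<le> M" and \<tau>': "\<bar>\<tau>\<bar> \<le> M" and e': "\<bar>\<epsilon>\<bar> \<le> \<epsilon>" using kM \<tau> e by auto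
  have S2: "\<bar>S2\<bar> \<le> N * (M * M)"
    unfolding S2_def N_def by (rule sum_bounded_above[THEN order_trans[OF sum_abs]]) (rule pm[OF q B])
  have S1: "\<bar>S1\<bar> \<le> N * (M * (M * \<eta>))"
    unfolding S1_def N_def by (rule sum_bounded_above[THEN order_trans[OF sum_abs]]) (rule pm[OF g err])
  have P: "M ^ n \<ge> 1" for n using M by simp
  have t1: "\<bar>(4 / a) * (k * \<tau> * Ty * c l)\<bar> \<le> (4 / a) * (M * M * (M * a\<^sup>2) * M)"
    using a by (intro pm[OF _ pm[OF pm[OF pm[OF k' \<tau>'] Ty] c]]) auto
  have t2: "\<bar>(4 / a) * (k * \<epsilon> * p * s)\<bar> \<le> (4 / a) * (M * \<epsilon> * M * M)"
    using a by (intro pm[OF _ pm[OF pm[OF pm[OF k' e'] p] s]]) auto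
  have t3: "\<bar>(4 / a) * (k * \<tau> * F * s5)\<bar> \<le> (4 / a) * (M * M * M * (M * \<epsilon>))"
    using a by (intro pm[OF _ pm[OF pm[OF pm[OF k' \<tau>'] F] s5]]) auto
  have t4: "\<bar>4 * (k * \<epsilon> * S2)\<bar> \<le> 4 * (M * \<epsilon> * (N * (M * M)))"
    by (intro pm[OF _ pm[OF pm[OF k' e'] S2]]) auto
  have t5: "\<bar>4 * (k * \<tau> * S1)\<bar> \<le> 4 * (M * M * (N * (M * (M * \<eta>))))"
    by (intro pm[OF _ pm[OF pm[OF k' \<tau>'] S1]]) auto
  define U where "U = N * M ^ 4"
  have M34: "M ^ 3 \<le> M ^ 4" using M by (intro power_increasing) auto
  have U4: "M ^ 4 \<le> U" unfolding U_def using N P[of 4] mult_right_mono[of 1 N "M ^ 4"] by simp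
  have U1: "1 \<le> U" using U4 P[of 4] by linarith
  have ea: "\<epsilon> / a \<ge> 0" "\<epsilon> \<le> \<epsilon> / a" using a e by (auto simp: field_simps mult_left_le)
  have b1: "(4 / a) * (M * M * (M * a\<^sup>2) * M) \<le> 4 * (U * a)"
  proof -
    have "(4 / a) * (M * M * (M * a\<^sup>2) * M) = 4 * (M ^ 4 * a)"
      using a by (simp add: power2_eq_square eval_nat_numeral)
    then show ?thesis using mult_right_mono[OF U4, of a] a by linarith
  qed
  have b2: "(4 / a) * (M * \<epsilon> * M * M) \<le> 4 * (U * (\<epsilon> / a))"
  proof -
    have "(4 / a) * (M * \<epsilon> * M * M) = 4 * (M ^ 3 * (\<epsilon> / a))"
      by (simp add: eval_nat_numeral)
    then show ?thesis using mult_right_mono[OF order_trans[OF M34 U4], of "\<epsilon> / a"] ea by linarith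
  qed
  have b3: "(4 / a) * (M * M * M * (M * \<epsilon>)) \<le> 4 * (U * (\<epsilon> / a))"
  proof -
    have "(4 / a) * (M * M * M * (M * \<epsilon>)) = 4 * (M ^ 4 * (\<epsilon> / a))"
      by (simp add: eval_nat_numeral)
    then show ?thesis using mult_right_mono[OF U4, of "\<epsilon> / a"] ea by linarith
  qed
  have b4: "4 * (M * \<epsilon> * (N * (M * M))) \<le> 4 * (U * (\<epsilon> / a))"
  proof -
    have "N * M ^ 3 \<le> U" unfolding U_def using N M34 by (intro mult_left_mono) auto
    then have "(N * M ^ 3) * \<epsilon> \<le> U * (\<epsilon> / a)" using ea e N U1 by (intro mult_mono) auto
    moreover have "4 * (M * \<epsilon> * (N * (M * M))) = 4 * ((N * M ^ 3) * \<epsilon>)" by (simp add: eval_nat_numeral)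
    ultimately show ?thesis by linarith
  qed
  have b5: "4 * (M * M * (N * (M * (M * \<eta>)))) = 4 * (U * \<eta>)"
    by (simp add: U_def eval_nat_numeral)
  have b6: "\<eta> \<le> U * \<eta>" using mult_right_mono[OF U1 \<eta>] by simp
  have nn: "0 \<le> U * a" "0 \<le> U * \<eta>" "0 \<le> U * (\<epsilon> / a)"
    using U1 a \<eta> ea(1) by (auto simp del: times_divide_eq_right)
  have "\<bar>?lhs\<bar> \<le> 13 * (U * a) + 13 * (U * (\<epsilon> / a)) + 13 * (U * \<eta>)"
  proof -
    have combine: "\<bar>d2 - x1 - x2 - x3 + x4 + x5\<bar> \<le> 13 * A + 13 * B + 13 * D"
      if "\<bar>x1\<bar> \<le> 4 * A" "\<bar>x2\<bar> \<le> 4 * B" "\<bar>x3\<bar> \<le> 4 * B" "\<bar>x4\<bar> \<le> 4 * B" "\<bar>x5\<bar> \<le> 4 * D"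
        "\<bar>d2\<bar> \<le> D" "0 \<le> A" "0 \<le> B" "0 \<le> D" for x1 x2 x3 x4 x5 A B D :: real
      using that by linarith
    show ?thesis
      unfolding eq by (rule combine[OF order_trans[OF t1 b1] order_trans[OF t2 b2] order_trans[OF t3 b3]
            order_trans[OF t4 b4] order_trans[OF t5 eq_refl[OF b5]] order_trans[OF d2 b6] nn(1) nn(3) nn(2)])
  qed
  then show ?thesis by (simp add: U_def N_def algebra_simps)
qed

text \<open>The point is uniformity: C depends on R but not on a, \<epsilon> or \<eta>, which can
  thus be fixed afterwards. Since \<open>corr\<close> is of order 1/a, the shift by \<epsilon>
  \<open>corr\<close> is small only if \<epsilon> is small compared with a.\<close>

lemma corr_residual:
  "\<exists>C\<ge>1. \<forall>a \<epsilon> \<eta> w1 w2 \<tau> c s w1' w2' \<tau>' c' s'. 0 < a \<longrightarrow> a \<le> 1 \<longrightarrow> 0 < \<epsilon> \<longrightarrow> \<epsilon> \<le> 1 \<longrightarrow> \<eta> \<le> 1 \<longrightarrow>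
     near_flow R a \<epsilon> \<eta> (w1, w2, \<tau>, c, s) (w1', w2', \<tau>', c', s') \<longrightarrow>
     norm (corr a w1 \<tau> c s) \<le> C / a \<and>
     norm (w2' + \<epsilon> *\<^sub>R corr' a w1 \<tau> c s w1' \<tau>' c' s' + (2 * k * \<tau>) *\<^sub>R grad w1) \<le> C * (a + \<epsilon> / a + \<eta>)"
proof (cases "R \<ge> 0")
  case False
  then have "\<not> near_flow R a \<epsilon> \<eta> (w1, w2, \<tau>, c, s) p'" for a \<epsilon> \<eta> w1 w2 \<tau> c s p'
    by (auto simp: near_flow_def) (smt (verit) norm_ge_zero)
  then show ?thesis by (intro exI[of _ 1]) auto
next
  case R: True
  obtain M0 where M0: "M0 \<ge> 1" "\<And>l. om l \<le> M0 \<and> 1 / om l \<le> M0"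
    "\<And>l m. l \<noteq> m \<Longrightarrow> 1 / \<bar>(om l)\<^sup>2 - (om m)\<^sup>2\<bar> \<le> M0"
    using frequency_bound by blast
  define N where "N = real CARD('n)"
  have N: "N \<ge> 1" by (simp add: N_def Suc_leI)
  \<comment> \<open>\<open>W\<close> bounds the velocity of w1 and \<open>Fb\<close> the values of
    \<phi> on the ball; \<open>M\<close> dominates every factor that enters the residual.\<close>
  define W where "W = 4 / Tmin * (2 * R) + 1"
  define Fb where "Fb = \<bar>\<phi> zs\<bar> + L * R\<^sup>2"
  define M where "M = 2 * M0 + 9 * M0\<^sup>2 + k + 2 * Tmax + L * (2 * N)\<^sup>2 + L * R
      + (2 * Fb + 2 * Tmax * (L * R * W)) * M0 + 2 * (L * R) + 2 * Tmax * (L * W) + Fb"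
  have W: "W \<ge> 1" using R Tmin_pos by (simp add: W_def)
  have Fb: "Fb \<ge> 0" using L_pos by (simp add: Fb_def)
  have parts: "0 \<le> L * (2 * N)\<^sup>2" "0 \<le> L * R" "0 \<le> (2 * Fb + 2 * Tmax * (L * R * W)) * M0"
    "0 \<le> 2 * Tmax * (L * W)" "0 \<le> 9 * M0\<^sup>2"
    using L_pos R M0(1) W Tmax_pos Fb by auto
  have M: "M \<ge> 1" "2 \<le> M" "9 * M0\<^sup>2 \<le> M" "k \<le> M" "2 * Tmax \<le> M" "L * (2 * N)\<^sup>2 \<le> M" "L * R \<le> M"
    "(2 * Fb + 2 * Tmax * (L * R * W)) * M0 \<le> M" "2 * (L * R) + 2 * Tmax * (L * W) \<le> M" "Fb \<le> M" "M0 \<le> M"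
    using parts M0(1) k_pos Tmax_pos Fb unfolding M_def by linarith+
  define C where "C = N * (13 * N * M ^ 4) + N * (4 * M ^ 4 + 4 * (N * M ^ 4))"
  have P: "M ^ n \<ge> 1" for n using M by simp
  have C: "C \<ge> 1" "N * (13 * N * M ^ 4) \<le> C" "N * (4 * M ^ 4 + 4 * (N * M ^ 4)) \<le> C"
  proof -
    have "1 \<le> N * M ^ 4" using N P[of 4] mult_mono[of 1 N 1 "M ^ 4"] by simp
    then have "1 * 1 \<le> N * (13 * N * M ^ 4)" using N by (intro mult_mono) auto
    moreover have "0 \<le> N * (4 * M ^ 4 + 4 * (N * M ^ 4))" using N P[of 4] by simp
    ultimately show "C \<ge> 1" "N * (13 * N * M ^ 4) \<le> C" "N * (4 * M ^ 4 + 4 * (N * M ^ 4)) \<le> C"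
      unfolding C_def by linarith+
  qed
  show ?thesis
  proof (intro exI[of _ C] conjI C(1) allI impI)
    fix a \<epsilon> \<eta> \<tau> \<tau>' :: real and w1 w2 c s w1' w2' c' s' :: "real^'n"
    assume a: "0 < a" "a \<le> 1" and e: "0 < \<epsilon>" "\<epsilon> \<le> 1" and \<eta>1: "\<eta> \<le> 1"
      and nf: "near_flow R a \<epsilon> \<eta> (w1, w2, \<tau>, c, s) (w1', w2', \<tau>', c', s')"
    note D = near_flowD[OF nf]
    have \<eta>: "\<eta> \<ge> 0" using D(8) by linarith
    have cs: "\<bar>c $ l\<bar> \<le> 2" "\<bar>s $ l\<bar> \<le> 2" for l using circle_component_le[OF D(5) \<eta>1] by blast+
    have pm: "\<bar>u * v\<bar> \<le> x * y" if "\<bar>u\<bar> \<le> x" "\<bar>v\<bar> \<le> y" for u v x y :: real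
      using that unfolding abs_mult by (intro mult_mono) auto
    have \<tau>: "0 < \<tau>" "\<tau> \<le> 2 * Tmax" "\<bar>\<tau>\<bar> \<le> 2 * Tmax" using D(3,4) Tmin_pos by auto
    have \<tau>': "\<bar>\<tau>'\<bar> \<le> 2" using D(8) \<eta>1 by linarith
    have nw1': "norm w1' \<le> W"
    proof -
      have "norm (w2 - w1) \<le> 2 * R" using norm_triangle_ineq4[of "w2 - zs" "w1 - zs"] D(1,2) by simp
      moreover have "2 / \<tau> \<le> 4 / Tmin" using D(3) \<tau> Tmin_pos by (simp add: field_simps)
      ultimately have "norm ((2 / \<tau>) *\<^sub>R (w2 - w1)) \<le> 4 / Tmin * (2 * R)"
        unfolding norm_scaleR using \<tau> Tmin_pos by (intro mult_mono) auto
      then show ?thesis using D(6) \<eta>1 norm_triangle_sub[of w1' "(2 / \<tau>) *\<^sub>R (w2 - w1)"] unfolding W_def by linarith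
    qed
    have ng: "norm (grad w1) \<le> L * R"
      using norm_grad_le[of w1] mult_left_mono[OF D(1), of L] L_pos by linarith
    have F: "\<bar>\<phi> w1\<bar> \<le> Fb"
    proof -
      have "L * (norm (w1 - zs))\<^sup>2 \<le> L * R\<^sup>2" using D(1) L_pos by (intro mult_left_mono power_mono) auto
      then show ?thesis using gap_upper[of w1] gap_nonneg[of w1] unfolding Fb_def by linarith
    qed
    have gw: "\<bar>grad w1 \<bullet> w1'\<bar> \<le> L * R * W"
      using Cauchy_Schwarz_ineq2[of "grad w1" w1'] mult_mono[OF ng nw1'] L_pos R by (smt (verit) norm_ge_zero mult_nonneg_nonneg)
    have g: "\<bar>grad w1 $ m\<bar> \<le> L * R" for m using component_le_norm_cart[of "grad w1" m] ng by linarith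
    have Hw: "\<bar>(Hess w1 *v w1') $ m\<bar> \<le> L * W" for m
      using component_le_norm_cart[of "Hess w1 *v w1'" m] norm_Hess_le[of w1 w1'] mult_left_mono[OF nw1', of L] L_pos by linarith
    have B: "\<bar>pairQ c s l m\<bar> \<le> M" for l m using pairQ_bound[OF M0 cs, of l m] M(3) zero_le_power2[of M0] by linarith
    have io: "\<bar>1 / om l\<bar> \<le> M0" for l using M0(2)[of l] om_pos[of l] by simp
    have so: "\<bar>s $ l / om l\<bar> \<le> 2 * M0" for l using pm[OF cs(2) io, of l l] by simp
    define err where "err l m = \<epsilon> * pairQ' c s c' s' l m - c $ l * c $ m + (if l = m then 1 / 2 else 0)" for l m
    have err: "\<bar>err l m\<bar> \<le> M * \<eta>" for l m
    proof -
      have "\<bar>err l m\<bar> \<le> 9 * M0\<^sup>2 * \<eta>" unfolding err_def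
        by (rule pairQ'_approx[where d = "\<chi> l. c' $ l - (1 / \<epsilon>) * om l * s $ l" and f = "\<chi> l. s' $ l - (- (1 / \<epsilon>) * om l * c $ l)"])
          (use M0 cs D(5,9,10) e in auto)
      then show ?thesis using mult_right_mono[OF M(3) \<eta>] by linarith
    qed
    \<comment> \<open>The defect of s' relative to the rotation, scaled by \<epsilon> /
      \<open>om l\<close>. It is of order \<epsilon>, so it remains of order \<epsilon>/a after
      division by a.\<close>
    define s5 where "s5 l = \<epsilon> * (s' $ l / om l) + c $ l" for l
    have s5: "\<bar>s5 l\<bar> \<le> M * \<epsilon>" for l
    proof -
      have "s5 l = (\<epsilon> * (s' $ l - (- (1 / \<epsilon>) * om l * c $ l))) * (1 / om l)"
        using e om_pos[of l] by (simp add: s5_def field_simps)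
      also have "\<bar>\<dots>\<bar> \<le> (\<epsilon> * 1) * M0"
        using D(10)[of l] \<eta>1 e by (intro pm io) auto
      finally have "\<bar>s5 l\<bar> \<le> M0 * \<epsilon>" by (simp add: mult.commute)
      also have "\<dots> \<le> M * \<epsilon>" using M(11) e by (intro mult_right_mono) auto
      finally show ?thesis .
    qed
    define Ty where "Ty = \<phi> (w1 + a *\<^sub>R c) - \<phi> w1 - a * (grad w1 \<bullet> c)"
    have Ty: "\<bar>Ty\<bar> \<le> M * a\<^sup>2"
    proof -
      have "norm c \<le> (\<Sum>l\<in>UNIV. \<bar>c $ l\<bar>)" by (rule norm_le_l1_cart)
      also have "\<dots> \<le> 2 * N" using sum_bounded_above[of UNIV "\<lambda>l. \<bar>c $ l\<bar>" 2] cs by (simp add: N_def)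
      finally have "L * (norm c)\<^sup>2 \<le> L * (2 * N)\<^sup>2" using L_pos by (intro mult_left_mono power_mono) auto
      then have "L * (norm c)\<^sup>2 * a\<^sup>2 \<le> M * a\<^sup>2" using M(6) by (intro mult_right_mono) auto
      moreover have "\<bar>Ty\<bar> \<le> L * (norm c)\<^sup>2 * a\<^sup>2"
        using first_order_error[of w1 "a *\<^sub>R c"] by (simp add: Ty_def power_mult_distrib mult_ac)
      ultimately show ?thesis by linarith
    qed
    define d2 where "d2 = w2' - (- (4 / a) * k * \<tau> * \<phi> (w1 + a *\<^sub>R c)) *\<^sub>R c"
    have d2: "\<bar>d2 $ l\<bar> \<le> \<eta>" for l using D(7) component_le_norm_cart[of d2 l] by (simp add: d2_def)
    have Fl: "\<phi> (w1 + a *\<^sub>R c) = \<phi> w1 + a * (\<Sum>m\<in>UNIV. grad w1 $ m * c $ m) + Ty"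
      by (simp add: Ty_def inner_vec_def)
    define p where "p = \<tau>' * \<phi> w1 + \<tau> * (grad w1 \<bullet> w1')"
    define q where "q m = \<tau>' * grad w1 $ m + \<tau> * (Hess w1 *v w1') $ m" for m
    have p0: "\<bar>p\<bar> \<le> 2 * Fb + 2 * Tmax * (L * R * W)"
      unfolding p_def using pm[OF \<tau>' F] pm[OF \<tau>(3) gw] by linarith
    have q: "\<bar>q m\<bar> \<le> M" for m
      unfolding q_def using pm[OF \<tau>' g[of m]] pm[OF \<tau>(3) Hw[of m]] M(9) by linarith
    have p: "\<bar>p\<bar> \<le> M"
      using p0 M(8) mult_left_mono[OF M0(1), of "2 * Fb + 2 * Tmax * (L * R * W)"] parts(2) Fb W Tmax_pos L_pos R
      by (smt (verit) mult_nonneg_nonneg)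
    have so': "\<bar>s $ l / om l\<bar> \<le> M" for l
      using so[of l] parts k_pos Tmax_pos Fb unfolding M_def by linarith
    have comp: "\<bar>(w2' + \<epsilon> *\<^sub>R corr' a w1 \<tau> c s w1' \<tau>' c' s' + (2 * k * \<tau>) *\<^sub>R grad w1) $ l\<bar>
        \<le> 13 * N * M ^ 4 * (a + \<epsilon> / a + \<eta>)" for l
    proof -
      have "\<bar>(- (4 / a) * k * \<tau> * (\<phi> w1 + a * (\<Sum>m\<in>UNIV. grad w1 $ m * c $ m) + Ty) * c $ l + d2 $ l)
       + \<epsilon> * (- (4 * k / a) * (p * (s $ l / om l) + \<tau> * \<phi> w1 * (s' $ l / om l))
          + 4 * k * (\<Sum>m\<in>UNIV. q m * pairQ c s l m + \<tau> * grad w1 $ m * pairQ' c s c' s' l m))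
       + 2 * k * \<tau> * grad w1 $ l\<bar> \<le> 13 * real CARD('n) * M ^ 4 * (a + \<epsilon> / a + \<eta>)"
        by (rule residual_component[OF a e \<eta> M(1), where c = "\<lambda>m. c $ m" and err = "err l" and ?s5.0 = "s5 l"])
          (use k_pos M \<tau> F p g q B err order_trans[OF cs(1) M(2)] so' s5 Ty d2 in \<open>auto simp: err_def s5_def intro: order_trans\<close>)
      moreover have "w2' $ l = - (4 / a) * k * \<tau> * (\<phi> w1 + a * (\<Sum>m\<in>UNIV. grad w1 $ m * c $ m) + Ty) * c $ l + d2 $ l"
        unfolding Fl[symmetric] by (simp add: d2_def)
      ultimately show ?thesis
        by (simp only: vector_add_component vector_scaleR_component corr'_def vec_lambda_beta p_def q_def N_def real_scaleR_def)
    qed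
    show "norm (w2' + \<epsilon> *\<^sub>R corr' a w1 \<tau> c s w1' \<tau>' c' s' + (2 * k * \<tau>) *\<^sub>R grad w1) \<le> C * (a + \<epsilon> / a + \<eta>)"
    proof -
      have "norm (w2' + \<epsilon> *\<^sub>R corr' a w1 \<tau> c s w1' \<tau>' c' s' + (2 * k * \<tau>) *\<^sub>R grad w1)
         \<le> real CARD('n) * (13 * N * M ^ 4 * (a + \<epsilon> / a + \<eta>))"
        by (rule order_trans[OF norm_le_l1_cart sum_bounded_above]) (use comp in simp)
      also have "\<dots> = N * (13 * N * M ^ 4) * (a + \<epsilon> / a + \<eta>)" by (simp add: N_def)
      also have "\<dots> \<le> C * (a + \<epsilon> / a + \<eta>)" using C a e \<eta> by (intro mult_right_mono) auto
      finally show ?thesis .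
    qed
    have compQ: "\<bar>corr a w1 \<tau> c s $ l\<bar> \<le> (4 * M ^ 4 + 4 * (N * M ^ 4)) / a" for l
    proof -
      have k': "\<bar>k\<bar> \<le> M" and \<tau>M: "\<bar>\<tau>\<bar> \<le> M" and gM: "\<bar>grad w1 $ m\<bar> \<le> M" and FM: "\<bar>\<phi> w1\<bar> \<le> M" for m
        using k_pos M \<tau> g[of m] F by auto
      have "\<bar>(4 / a) * (k * (\<tau> * \<phi> w1 * (s $ l / om l)))\<bar> \<le> (4 / a) * (M * (M * M * M))"
        using a by (intro pm k' \<tau>M FM so') auto
      moreover have "\<bar>4 * (k * (\<Sum>m\<in>UNIV. \<tau> * grad w1 $ m * pairQ c s l m))\<bar> \<le> 4 * (M * (N * (M * M * M)))"
        unfolding N_def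
        by (intro pm k' sum_bounded_above[THEN order_trans[OF sum_abs]] \<tau>M gM B) auto
      moreover have "4 * (M * (N * (M * M * M))) \<le> 4 * (N * M ^ 4) / a"
      proof -
        have "0 \<le> 4 * (N * M ^ 4)" using N P[of 4] by simp
        then have "4 * (N * M ^ 4) * 1 \<le> 4 * (N * M ^ 4) * (1 / a)" using a by (intro mult_left_mono) auto
        then show ?thesis by (simp add: eval_nat_numeral mult_ac)
      qed
      moreover have "(4 / a) * (M * (M * M * M)) = 4 * M ^ 4 / a" by (simp add: eval_nat_numeral)
      moreover have "corr a w1 \<tau> c s $ l = - ((4 / a) * (k * (\<tau> * \<phi> w1 * (s $ l / om l)))) + 4 * (k * (\<Sum>m\<in>UNIV. \<tau> * grad w1 $ m * pairQ c s l m))"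
        by (simp add: corr_def)
      ultimately show ?thesis unfolding add_divide_distrib by linarith
    qed
    show "norm (corr a w1 \<tau> c s) \<le> C / a"
    proof -
      have "norm (corr a w1 \<tau> c s) \<le> real CARD('n) * ((4 * M ^ 4 + 4 * (N * M ^ 4)) / a)"
        by (rule order_trans[OF norm_le_l1_cart sum_bounded_above]) (use compQ in simp)
      also have "\<dots> = N * (4 * M ^ 4 + 4 * (N * M ^ 4)) / a" by (simp add: N_def)
      also have "\<dots> \<le> C / a" using C a by (intro divide_right_mono) auto
      finally show ?thesis .
    qed
  qed
qed

end

section \<open>Flow estimate for perturbed solutions\<close>

lemma hstate_component_norms:
  fixes p :: "'n::finite hstate"
  shows "norm (fst p) \<le> norm p" "norm (fst (snd p)) \<le> norm p" "\<bar>fst (snd (snd p))\<bar> \<le> norm p"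
    "norm (fst (snd (snd (snd p)))) \<le> norm p" "norm (snd (snd (snd (snd p)))) \<le> norm p"
proof -
  have n: "norm (fst p) \<le> norm p" "norm (snd p) \<le> norm p" for p :: "'x::real_normed_vector \<times> 'y::real_normed_vector"
    using norm_fst_le[of "fst p" "snd p"] norm_snd_le[of "snd p" "fst p"] by simp_all
  note m = n[of p] n[of "snd p"] n[of "snd (snd p)"] n[of "snd (snd (snd p))"]
  show "norm (fst p) \<le> norm p" "norm (fst (snd p)) \<le> norm p" "\<bar>fst (snd (snd p))\<bar> \<le> norm p"
    "norm (fst (snd (snd (snd p)))) \<le> norm p" "norm (snd (snd (snd (snd p)))) \<le> norm p"
    using m unfolding real_norm_def by linarith+
qed

lemma unit_circle_component:
  assumes "x\<^sup>2 + y\<^sup>2 = (1::real)"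
  shows "\<bar>x\<bar> \<le> 1" "\<bar>y\<bar> \<le> 1"
proof -
  have "x\<^sup>2 \<le> 1" "y\<^sup>2 \<le> 1" using assms zero_le_power2[of x] zero_le_power2[of y] by linarith+
  then show "\<bar>x\<bar> \<le> 1" "\<bar>y\<bar> \<le> 1" by (simp_all add: abs_square_le_1)
qed

text \<open>Differences of squares are factored; the sums c + c0 and s + s0 are at most 3 per
  component because \<eta> \<le> 1.\<close>

lemma near_torus:
  fixes c s c0 s0 :: "real^'n"
  assumes "(c0, s0) \<in> torus" "norm (c - c0) \<le> \<eta>" "norm (s - s0) \<le> \<eta>" "\<eta> \<le> 1"
  shows "\<bar>(c $ l)\<^sup>2 + (s $ l)\<^sup>2 - 1\<bar> \<le> 6 * \<eta>"
proof -
  have circ: "(c0 $ l)\<^sup>2 + (s0 $ l)\<^sup>2 = 1" using assms(1) by (simp add: torus_def)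
  note c0 = unit_circle_component[OF circ]
  have d: "\<bar>c $ l - c0 $ l\<bar> \<le> \<eta>" "\<bar>s $ l - s0 $ l\<bar> \<le> \<eta>"
    using assms component_le_norm_cart[of "c - c0" l] component_le_norm_cart[of "s - s0" l] by auto
  have "\<bar>(c $ l - c0 $ l) * (c $ l + c0 $ l)\<bar> \<le> \<eta> * 3" "\<bar>(s $ l - s0 $ l) * (s $ l + s0 $ l)\<bar> \<le> \<eta> * 3"
    unfolding abs_mult using d c0 assms(4) by (intro mult_mono; linarith)+
  moreover have "(c $ l)\<^sup>2 + (s $ l)\<^sup>2 - 1 = (c $ l - c0 $ l) * (c $ l + c0 $ l) + (s $ l - s0 $ l) * (s $ l + s0 $ l)"
    using circ by (simp add: algebra_simps power2_eq_square)
  ultimately show ?thesis by linarith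
qed

lemma torus_norm_le:
  assumes "(c, s) \<in> (torus :: ((real^'n) \<times> (real^'n)) set)"
  shows "norm c \<le> CARD('n)" "norm s \<le> CARD('n)"
proof -
  have circ: "(c $ l)\<^sup>2 + (s $ l)\<^sup>2 = 1" for l using assms by (simp add: torus_def)
  note unit_circle_component[OF circ]
  then show "norm c \<le> CARD('n)" "norm s \<le> CARD('n)"
    using order_trans[OF norm_le_l1_cart sum_bounded_above[of UNIV "\<lambda>l. \<bar>c $ l\<bar>" 1]]
      order_trans[OF norm_le_l1_cart sum_bounded_above[of UNIV "\<lambda>l. \<bar>s $ l\<bar>" 1]] by auto
qed

text \<open>The quantifier prefix for (a, \<epsilon>) tending to 0 with \<epsilon> chosen after a,
  isolated so that consequences can be drawn pointwise in (a, \<epsilon>).\<close>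

definition semiglobal :: "(real \<Rightarrow> real \<Rightarrow> bool) \<Rightarrow> bool" where
  "semiglobal P \<longleftrightarrow> (\<exists>as>0. \<forall>a. 0 < a \<and> a < as \<longrightarrow> (\<exists>es>0. \<forall>\<epsilon>. 0 < \<epsilon> \<and> \<epsilon> < es \<longrightarrow> P a \<epsilon>))"

lemma semiglobal_mono:
  assumes "semiglobal P" "\<And>a \<epsilon>. 0 < a \<Longrightarrow> 0 < \<epsilon> \<Longrightarrow> P a \<epsilon> \<Longrightarrow> Q a \<epsilon>"
  shows "semiglobal Q"
proof -
  obtain as where as: "as > 0" "\<And>a. 0 < a \<Longrightarrow> a < as \<Longrightarrow> \<exists>es>0. \<forall>\<epsilon>. 0 < \<epsilon> \<and> \<epsilon> < es \<longrightarrow> P a \<epsilon>"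
    using assms(1) unfolding semiglobal_def by blast
  have "\<exists>es>0. \<forall>\<epsilon>. 0 < \<epsilon> \<and> \<epsilon> < es \<longrightarrow> Q a \<epsilon>" if a: "0 < a" "a < as" for a
    using as(2)[OF a] assms(2)[OF a(1)] by blast
  then show ?thesis unfolding semiglobal_def using as(1) by blast
qed

context hybrid_momentum
begin

section \<open>Compact boxes and moduli of continuity\<close>

abbreviation VV :: "'n hstate \<Rightarrow> real" where
  "VV p \<equiv> V (fst p, fst (snd p), fst (snd (snd p)))"

text \<open>The torus components have norm at most \<open>CARD('n)\<close>; twice this bound and the
  wide timer range leave room for points that are only near the flow set. Compactness yields uniform
  continuity of the flow map.\<close>

definition sbox :: "real \<Rightarrow> 'n hstate set" where
  "sbox R = cball zs R \<times> cball zs R \<times> {Tmin / 2..2 * Tmax} \<times> cball 0 (2 * CARD('n)) \<times> cball 0 (2 * CARD('n))"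

lemma compact_sbox: "compact (sbox R)"
  unfolding sbox_def by (intro compact_Times compact_cball compact_Icc)

lemma continuous_on_flow_map:
  assumes "\<And>p. p \<in> S \<Longrightarrow> fst (snd (snd p)) \<noteq> 0"
  shows "continuous_on S (flow_map \<phi> \<kappa> k a \<epsilon>)"
  unfolding flow_map_def case_prod_unfold using assms by (intro continuous_intros) auto

lemma continuous_on_flow_map_sbox: "continuous_on (sbox R) (flow_map \<phi> \<kappa> k a \<epsilon>)"
  using Tmin_pos by (intro continuous_on_flow_map) (auto simp: sbox_def)

lemma near_flow_set_in_sbox:
  assumes p: "p \<in> flow_set Tmin Tmax" and d: "norm (x - p) \<le> r" "r \<le> 1" "r \<le> Tmin / 2"
    and R: "norm (fst x - zs) \<le> R" "norm (fst (snd x) - zs) \<le> R"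
  shows "x \<in> sbox R"
proof -
  obtain x1 x2 \<tau> c s where x: "x = (x1, x2, \<tau>, c, s)" by (cases x) auto
  obtain p1 p2 \<sigma> c0 s0 where p': "p = (p1, p2, \<sigma>, c0, s0)" by (cases p) auto
  have T: "Tmin \<le> \<sigma>" "\<sigma> \<le> Tmax" "(c0, s0) \<in> torus" using p by (auto simp: flow_set_def p')
  have "\<bar>\<tau> - \<sigma>\<bar> \<le> r" "norm (c - c0) \<le> r" "norm (s - s0) \<le> r"
    using hstate_component_norms[of "x - p"] d by (auto simp: x p')
  moreover have "norm c0 \<le> CARD('n)" "norm s0 \<le> CARD('n)" using torus_norm_le[OF T(3)] by auto
  moreover have "norm c \<le> norm c0 + norm (c - c0)" "norm s \<le> norm s0 + norm (s - s0)"
    by (metis norm_triangle_sub)+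
  moreover have "real CARD('n) \<ge> 1" by (simp add: Suc_leI)
  ultimately have "Tmin / 2 \<le> \<tau>" "\<tau> \<le> 2 * Tmax" "norm c \<le> 2 * CARD('n)" "norm s \<le> 2 * CARD('n)"
    using T d Tmin_pos Tmin_less by linarith+
  then show ?thesis using R by (simp add: sbox_def x dist_norm norm_minus_commute)
qed

text \<open>The modulus \<sigma> depends on a and \<epsilon>, which is why admissible perturbations
  are sized after both.\<close>

lemma flow_map_close:
  assumes "\<eta> > 0"
  shows "\<exists>\<sigma>>0. \<forall>p\<in>sbox R. \<forall>q\<in>sbox R. norm (p - q) \<le> \<sigma> \<longrightarrow>
     norm (flow_map \<phi> \<kappa> k a \<epsilon> p - flow_map \<phi> \<kappa> k a \<epsilon> q) \<le> \<eta>"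
proof -
  have "uniformly_continuous_on (sbox R) (flow_map \<phi> \<kappa> k a \<epsilon>)"
    by (rule compact_uniformly_continuous[OF continuous_on_flow_map_sbox compact_sbox])
  then obtain d where d: "d > 0" "\<And>p q. p \<in> sbox R \<Longrightarrow> q \<in> sbox R \<Longrightarrow> dist p q < d \<Longrightarrow>
      dist (flow_map \<phi> \<kappa> k a \<epsilon> p) (flow_map \<phi> \<kappa> k a \<epsilon> q) < \<eta>"
    unfolding uniformly_continuous_on_def using assms by (metis dist_commute)
  show ?thesis
    by (rule exI[of _ "d / 2"]) (use d in \<open>auto simp: dist_norm less_imp_le\<close>)
qed

definition xbox :: "real \<Rightarrow> ((real^'n) \<times> (real^'n) \<times> real) set" where
  "xbox R = cball zs R \<times> cball zs R \<times> {Tmin / 2..2 * Tmax}"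

lemma xbox_iff:
  "(x1, x2, \<tau>) \<in> xbox R \<longleftrightarrow> norm (x1 - zs) \<le> R \<and> norm (x2 - zs) \<le> R \<and> Tmin / 2 \<le> \<tau> \<and> \<tau> \<le> 2 * Tmax"
  by (auto simp: xbox_def dist_norm norm_minus_commute)

lemma V_close:
  assumes "\<eta> > 0"
  obtains \<sigma> where "\<sigma> > 0"
    "\<And>x1 x2 \<tau> y1 y2 \<tau>'. (x1, x2, \<tau>) \<in> xbox R \<Longrightarrow> (y1, y2, \<tau>') \<in> xbox R \<Longrightarrow>
      norm (x1 - y1) + norm (x2 - y2) + \<bar>\<tau> - \<tau>'\<bar> \<le> \<sigma> \<Longrightarrow> \<bar>V (x1, x2, \<tau>) - V (y1, y2, \<tau>')\<bar> \<le> \<eta>"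
proof -
  have "uniformly_continuous_on (xbox R) V"
    unfolding xbox_def by (intro compact_uniformly_continuous continuous_on_V compact_Times compact_cball compact_Icc)
  then obtain d where d: "d > 0" "\<And>p q. p \<in> xbox R \<Longrightarrow> q \<in> xbox R \<Longrightarrow> dist p q < d \<Longrightarrow> dist (V p) (V q) < \<eta>"
    unfolding uniformly_continuous_on_def using assms by (metis dist_commute)
  show ?thesis
  proof (rule that[of "d / 2"])
    fix x1 x2 y1 y2 :: "real^'n" and \<tau> \<tau>' :: real
    assume box: "(x1, x2, \<tau>) \<in> xbox R" "(y1, y2, \<tau>') \<in> xbox R"
      and le: "norm (x1 - y1) + norm (x2 - y2) + \<bar>\<tau> - \<tau>'\<bar> \<le> d / 2"
    have "dist (x1, x2, \<tau>) (y1, y2, \<tau>') \<le> norm (x1 - y1) + (norm (x2 - y2) + norm (\<tau> - \<tau>'))"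
      using norm_Pair_le[of "x1 - y1" "(x2 - y2, \<tau> - \<tau>')"] norm_Pair_le[of "x2 - y2" "\<tau> - \<tau>'"]
      by (simp add: dist_norm)
    then have "dist (x1, x2, \<tau>) (y1, y2, \<tau>') < d" using le d(1) by simp
    then show "\<bar>V (x1, x2, \<tau>) - V (y1, y2, \<tau>')\<bar> \<le> \<eta>"
      using d(2)[OF box] by (simp add: dist_real_def)
  qed (use d in simp)
qed

text \<open>The corrected coordinate \<open>y = w\<^sub>2 + \<epsilon> corr\<close> follows the averaged flow up to \<open>O(a + \<epsilon>/a + \<eta>)\<close>.\<close>

definition classical_contraction :: "real \<Rightarrow> real \<Rightarrow> real \<Rightarrow> real \<Rightarrow> real \<Rightarrow> bool" where
  "classical_contraction R \<delta> a \<epsilon> \<eta> \<longleftrightarrow> (\<forall>w w' s T. s \<le> T \<longrightarrow>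
     (\<forall>t\<in>{s..T}. (w has_vector_derivative w' t) (at t within {s..T}) \<and> near_flow R a \<epsilon> \<eta> (w t) (w' t)) \<longrightarrow>
     VV (w T) \<le> exp (- rate * (T - s)) * VV (w s) + \<delta>)"

text \<open>\<open>V\<close> is evaluated at (w1, y, \<tau>). Two thirds of \<delta> pay for
  exchanging w2 and y at the two ends, the last third for the residual \<rho> integrated against the
  exponential decay.\<close>

lemma classical_flow_estimate:
  assumes R: "R > 0" and \<delta>: "\<delta> > 0"
  shows "semiglobal (\<lambda>a \<epsilon>. \<exists>\<eta>>0. \<eta> \<le> 1 \<and> classical_contraction R \<delta> a \<epsilon> \<eta>)"
proof -
  \<comment> \<open>The constant of \<open>V_flow_derivative\<close> for the radius R + 1, since y
    can be up to \<open>m \<le> 1\<close> away from w2.\<close>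
  define C1 where "C1 = 5 / 2 * (R + 1) + 4 * k * Tmax * L * (R + 1)\<^sup>2 + 4 * k * Tmax\<^sup>2 * L * (R + 1)"
  have C1: "C1 > 0"
    unfolding C1_def using R k_pos L_pos Tmax_pos by (intro add_pos_pos mult_pos_pos) auto
  define \<rho> where "\<rho> = min 1 (rate * \<delta> / (3 * C1))"
  have \<rho>: "\<rho> > 0" using C1 \<delta> rate_pos by (simp add: \<rho>_def)
  have C1\<rho>: "C1 * \<rho> / rate \<le> \<delta> / 3"
  proof -
    have "C1 * \<rho> \<le> C1 * (rate * \<delta> / (3 * C1))" using C1 by (intro mult_left_mono) (auto simp: \<rho>_def)
    then show ?thesis using C1 rate_pos by (simp add: field_simps)
  qed
  obtain \<sigma> where \<sigma>: "\<sigma> > 0" "\<And>x1 x2 \<tau> y1 y2 \<tau>'. (x1, x2, \<tau>) \<in> xbox (R + 1) \<Longrightarrow> (y1, y2, \<tau>') \<in> xbox (R + 1) \<Longrightarrow>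
     norm (x1 - y1) + norm (x2 - y2) + \<bar>\<tau> - \<tau>'\<bar> \<le> \<sigma> \<Longrightarrow> \<bar>V (x1, x2, \<tau>) - V (y1, y2, \<tau>')\<bar> \<le> \<delta> / 3"
    by (rule V_close[of "\<delta> / 3" "R + 1"]) (use \<delta> that in auto)
  obtain C2 where C2: "C2 \<ge> 1" "\<And>a \<epsilon> \<eta> w1 w2 \<tau> c s w1' w2' \<tau>' c' s'. 0 < a \<Longrightarrow> a \<le> 1 \<Longrightarrow> 0 < \<epsilon> \<Longrightarrow> \<epsilon> \<le> 1 \<Longrightarrow> \<eta> \<le> 1 \<Longrightarrow>
     near_flow R a \<epsilon> \<eta> (w1, w2, \<tau>, c, s) (w1', w2', \<tau>', c', s') \<Longrightarrow>
     norm (corr a w1 \<tau> c s) \<le> C2 / a \<and>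
     norm (w2' + \<epsilon> *\<^sub>R corr' a w1 \<tau> c s w1' \<tau>' c' s' + (2 * k * \<tau>) *\<^sub>R grad w1) \<le> C2 * (a + \<epsilon> / a + \<eta>)"
    using corr_residual[of R] by blast
  \<comment> \<open>The coefficient 2/\<tau> is at most 4/Tmin, so a shift of at most \<rho>/K costs
    only \<rho>/3 in the equation for w1.\<close>
  define K where "K = 3 * (1 + 4 / Tmin)"
  have K: "K \<ge> 3" "4 / Tmin \<le> K / 3" using Tmin_pos by (auto simp: K_def)
  define m where "m = min (\<rho> / K) (min \<sigma> 1)"
  have m: "m > 0" using \<rho> K \<sigma> by (simp add: m_def)
  define \<eta> where "\<eta> = min 1 (\<rho> / (3 * C2))"
  have \<eta>: "\<eta> > 0" "\<eta> \<le> 1" "C2 * \<eta> \<le> \<rho> / 3" "\<eta> \<le> \<rho> / 3"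
  proof -
    show "\<eta> > 0" "\<eta> \<le> 1" using \<rho> C2(1) by (auto simp: \<eta>_def)
    have "\<eta> \<le> \<rho> / (3 * C2)" by (simp add: \<eta>_def)
    then show *: "C2 * \<eta> \<le> \<rho> / 3" using C2(1) by (simp add: field_simps)
    have "1 * \<eta> \<le> C2 * \<eta>" using C2(1) \<open>\<eta> > 0\<close> by (intro mult_right_mono) auto
    then show "\<eta> \<le> \<rho> / 3" using * by simp
  qed
  show ?thesis unfolding semiglobal_def
  proof (rule exI[of _ "min 1 (\<rho> / (3 * C2))"], intro conjI allI impI)
    fix a assume "0 < a \<and> a < min 1 (\<rho> / (3 * C2))"
    then have a: "0 < a" "a \<le> 1" "C2 * a \<le> \<rho> / 3" using C2(1) by (auto simp: field_simps)
    show "\<exists>es>0. \<forall>\<epsilon>. 0 < \<epsilon> \<and> \<epsilon> < es \<longrightarrow> (\<exists>\<eta>>0. \<eta> \<le> 1 \<and> classical_contraction R \<delta> a \<epsilon> \<eta>)"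
    \<comment> \<open>The shift is at most \<epsilon> C2 / a, so this bound on \<epsilon> keeps it
      below m.\<close>
    proof (rule exI[of _ "min 1 (m * a / C2)"], intro conjI allI impI)
      show "0 < min 1 (m * a / C2)" using m a C2(1) by simp
      fix \<epsilon> assume "0 < \<epsilon> \<and> \<epsilon> < min 1 (m * a / C2)"
      then have e: "0 < \<epsilon>" "\<epsilon> \<le> 1" "C2 * (\<epsilon> / a) \<le> m" using a C2(1) by (auto simp: field_simps)
      show "\<exists>\<eta>>0. \<eta> \<le> 1 \<and> classical_contraction R \<delta> a \<epsilon> \<eta>"
        unfolding classical_contraction_def
      proof (rule exI[of _ \<eta>], intro conjI \<eta> allI impI)
        fix w w' :: "real \<Rightarrow> 'n hstate" and s T :: real
        assume sT: "s \<le> T" and all: "\<forall>t\<in>{s..T}. (w has_vector_derivative w' t) (at t within {s..T}) \<and>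
          near_flow R a \<epsilon> \<eta> (w t) (w' t)"
        define w1 where "w1 t = fst (w t)" for t
        define w2 where "w2 t = fst (snd (w t))" for t
        define \<tau> where "\<tau> t = fst (snd (snd (w t)))" for t
        define c where "c t = fst (snd (snd (snd (w t))))" for t
        define d where "d t = snd (snd (snd (snd (w t))))" for t
        define w1' where "w1' t = fst (w' t)" for t
        define w2' where "w2' t = fst (snd (w' t))" for t
        define \<tau>' where "\<tau>' t = fst (snd (snd (w' t)))" for t
        define c' where "c' t = fst (snd (snd (snd (w' t))))" for t
        define d' where "d' t = snd (snd (snd (snd (w' t))))" for t
        note defs = w1_def w2_def \<tau>_def c_def d_def w1'_def w2'_def \<tau>'_def c'_def d'_def
        have wt: "w t = (w1 t, w2 t, \<tau> t, c t, d t)" "w' t = (w1' t, w2' t, \<tau>' t, c' t, d' t)" for t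
          by (simp_all add: defs)
        have nf: "near_flow R a \<epsilon> \<eta> (w1 t, w2 t, \<tau> t, c t, d t) (w1' t, w2' t, \<tau>' t, c' t, d' t)" if "t \<in> {s..T}" for t
          using all that wt by metis
        define y where "y t = w2 t + \<epsilon> *\<^sub>R corr a (w1 t) (\<tau> t) (c t) (d t)" for t
        define y' where "y' t = w2' t + \<epsilon> *\<^sub>R corr' a (w1 t) (\<tau> t) (c t) (d t) (w1' t) (\<tau>' t) (c' t) (d' t)" for t
        have yw: "norm (y t - w2 t) \<le> m" if "t \<in> {s..T}" for t
        proof -
          have "norm (y t - w2 t) = \<epsilon> * norm (corr a (w1 t) (\<tau> t) (c t) (d t))" using e by (simp add: y_def)
          also have "\<dots> \<le> \<epsilon> * (C2 / a)" using C2(2)[OF a(1,2) e(1,2) \<eta>(2) nf[OF that]] e by (intro mult_left_mono) auto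
          also have "\<dots> \<le> m" using e(3) by (simp add: mult.commute)
          finally show ?thesis .
        qed
        have yz: "norm (y t - zs) \<le> R + 1" if "t \<in> {s..T}" for t
        proof -
          have "norm (y t - zs) \<le> norm (w2 t - zs) + norm (y t - w2 t)"
            using norm_triangle_ineq[of "w2 t - zs" "y t - w2 t"] by simp
          then show ?thesis using near_flowD(2)[OF nf[OF that]] yw[OF that] by (simp add: m_def)
        qed
        have Vc: "\<bar>V (w1 t, y t, \<tau> t) - VV (w t)\<bar> \<le> \<delta> / 3" if "t \<in> {s..T}" for t
        proof -
          have "\<bar>V (w1 t, y t, \<tau> t) - V (w1 t, w2 t, \<tau> t)\<bar> \<le> \<delta> / 3"
            using near_flowD(1-4)[OF nf[OF that]] yz[OF that] yw[OF that]
            by (intro \<sigma>(2)) (auto simp: m_def xbox_iff)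
          then show ?thesis by (simp add: wt)
        qed
        have dv: "\<exists>D. ((\<lambda>t. V (w1 t, y t, \<tau> t)) has_real_derivative D) (at t within {s..T}) \<and>
           D \<le> - rate * V (w1 t, y t, \<tau> t) + C1 * \<rho>" if t: "t \<in> {s..T}" for t
        proof -
          note N = near_flowD[OF nf[OF t]]
          have hw: "(w has_vector_derivative w' t) (at t within {s..T})" using all t by blast
          note hs = bounded_linear.has_vector_derivative[OF bounded_linear_snd]
          note hf = bounded_linear.has_vector_derivative[OF bounded_linear_fst]
          have h1: "(w1 has_vector_derivative w1' t) (at t within {s..T})"
            using hf[OF hw] by (simp add: defs[abs_def])
          have h2: "(w2 has_vector_derivative w2' t) (at t within {s..T})"
            using hf[OF hs[OF hw]] by (simp add: defs[abs_def])
          have h3: "(\<tau> has_real_derivative \<tau>' t) (at t within {s..T})"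
            using hf[OF hs[OF hs[OF hw]]] by (simp add: defs[abs_def] has_real_derivative_iff_has_vector_derivative)
          have h4: "(c has_vector_derivative c' t) (at t within {s..T})"
            using hf[OF hs[OF hs[OF hs[OF hw]]]] by (simp add: defs[abs_def])
          have h5: "(d has_vector_derivative d' t) (at t within {s..T})"
            using hs[OF hs[OF hs[OF hs[OF hw]]]] by (simp add: defs[abs_def])
          have hy: "(y has_vector_derivative y' t) (at t within {s..T})"
            unfolding y_def[abs_def] y'_def
            by (intro has_vector_derivative_add h2 bounded_linear.has_vector_derivative[OF bounded_linear_scaleR_right]
                corr_has_derivative h1 h3 h4 h5)
          define r1 where "r1 = w1' t - (2 / \<tau> t) *\<^sub>R (y t - w1 t)"
          define r2 where "r2 = y' t + (2 * k * \<tau> t) *\<^sub>R grad (w1 t)"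
          have r1: "norm r1 \<le> \<rho>"
          proof -
            have "r1 = (w1' t - (2 / \<tau> t) *\<^sub>R (w2 t - w1 t)) - (2 / \<tau> t) *\<^sub>R (y t - w2 t)"
              by (simp add: r1_def algebra_simps)
            then have "norm r1 \<le> norm (w1' t - (2 / \<tau> t) *\<^sub>R (w2 t - w1 t)) + norm ((2 / \<tau> t) *\<^sub>R (y t - w2 t))"
              using norm_triangle_ineq4 by metis
            moreover have "norm ((2 / \<tau> t) *\<^sub>R (y t - w2 t)) \<le> (K / 3) * (\<rho> / K)"
            proof -
              have "2 / \<tau> t \<le> 4 / Tmin" using N(3) Tmin_pos by (simp add: field_simps)
              then show ?thesis unfolding norm_scaleR
                using K N(3) Tmin_pos yw[OF t] by (intro mult_mono) (auto simp: m_def)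
            qed
            moreover have "(K / 3) * (\<rho> / K) = \<rho> / 3" using K by simp
            ultimately show ?thesis using N(6) \<eta>(4) \<rho> by linarith
          qed
          have r2: "norm r2 \<le> \<rho>"
          proof -
            have "norm r2 \<le> C2 * (a + \<epsilon> / a + \<eta>)"
              using C2(2)[OF a(1,2) e(1,2) \<eta>(2) nf[OF t]] by (simp add: r2_def y'_def)
            also have "\<dots> = C2 * a + C2 * (\<epsilon> / a) + C2 * \<eta>" by (simp add: distrib_left)
            also have "C2 * (\<epsilon> / a) \<le> \<rho> / 3"
            proof -
              have "m \<le> \<rho> / K" by (simp add: m_def)
              also have "\<dots> \<le> \<rho> / 3" using K \<rho> by (intro divide_left_mono) auto
              finally show ?thesis using e(3) by linarith
            qed
            finally show ?thesis using a(3) \<eta>(3) by linarith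
          qed
          show ?thesis unfolding C1_def
          proof (rule V_flow_derivative[where ?r1.0 = r1 and ?r2.0 = r2 and ?r3.0 = "\<tau>' t - 1 / 2"])
            show "(w1 has_vector_derivative (2 / \<tau> t) *\<^sub>R (y t - w1 t) + r1) (at t within {s..T})"
              using h1 by (simp add: r1_def)
            show "(y has_vector_derivative (- 2 * k * \<tau> t) *\<^sub>R grad (w1 t) + r2) (at t within {s..T})"
              using hy by (simp add: r2_def)
            show "(\<tau> has_real_derivative 1 / 2 + (\<tau>' t - 1 / 2)) (at t within {s..T})" using h3 by simp
            show "norm (w1 t - zs) \<le> R + 1" using N(1) by simp
            show "\<bar>\<tau>' t - 1 / 2\<bar> \<le> \<rho>" using N(8) \<eta>(4) \<rho> by linarith
          qed (use N(3,4) yz[OF t] r1 r2 in auto)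
        qed
        have "\<forall>t\<in>{s..T}. \<exists>D. ((\<lambda>t. V (w1 t, y t, \<tau> t)) has_real_derivative D) (at t within {s..T}) \<and>
           D \<le> - rate * V (w1 t, y t, \<tau> t) + C1 * \<rho>"
          using dv by (intro ballI)
        from bchoice[OF this] obtain D where D: "\<forall>t\<in>{s..T}. ((\<lambda>t. V (w1 t, y t, \<tau> t)) has_real_derivative D t) (at t within {s..T}) \<and>
           D t \<le> - rate * V (w1 t, y t, \<tau> t) + C1 * \<rho>" ..
        have "V (w1 T, y T, \<tau> T) \<le> exp (- rate * (T - s)) * V (w1 s, y s, \<tau> s) + C1 * \<rho> / rate"
          by (rule exp_decay_comparison[OF sT rate_pos _ D[rule_format, THEN conjunct1] D[rule_format, THEN conjunct2]])
            (use C1 \<rho> in auto)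
        also have "\<dots> \<le> exp (- rate * (T - s)) * (VV (w s) + \<delta> / 3) + \<delta> / 3"
        proof (intro add_mono mult_left_mono C1\<rho>)
          have "\<bar>V (w1 s, y s, \<tau> s) - VV (w s)\<bar> \<le> \<delta> / 3" using sT by (intro Vc) auto
          then show "V (w1 s, y s, \<tau> s) \<le> VV (w s) + \<delta> / 3" by linarith
        qed simp
        also have "\<dots> \<le> exp (- rate * (T - s)) * VV (w s) + \<delta> / 3 + \<delta> / 3"
        proof -
          have "exp (- rate * (T - s)) * (\<delta> / 3) \<le> 1 * (\<delta> / 3)"
            using rate_pos sT \<delta> by (intro mult_right_mono) auto
          then show ?thesis by (simp add: distrib_left)
        qed
        finally show "VV (w T) \<le> exp (- rate * (T - s)) * VV (w s) + \<delta>"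
          using Vc[of T, unfolded atLeastAtMost_iff, OF conjI[OF sT order_refl]] by linarith
      qed
    qed
  qed (use \<rho> C2 in auto)
qed

text \<open>The perturbed solution is only absolutely continuous; subtracting the integral of the
  perturbation gives a continuously differentiable curve \<open>w\<close> nearby.\<close>

definition flow_contraction :: "real \<Rightarrow> real \<Rightarrow> real \<Rightarrow> real \<Rightarrow> real \<Rightarrow> bool" where
  "flow_contraction R \<delta> a \<epsilon> b \<longleftrightarrow> (\<forall>x e s T. s \<le> T \<longrightarrow>
     (\<forall>t\<in>{s..T}. norm (e t) \<le> b \<and> (\<exists>p\<in>flow_set Tmin Tmax. norm (x t - p) \<le> b) \<and>
       norm (fst (x t) - zs) \<le> R \<and> norm (fst (snd (x t)) - zs) \<le> R \<and>
       (\<lambda>r. flow_map \<phi> \<kappa> k a \<epsilon> (x r + e r) + e r) integrable_on {s..t} \<and>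
       x t - x s = integral {s..t} (\<lambda>r. flow_map \<phi> \<kappa> k a \<epsilon> (x r + e r) + e r)) \<longrightarrow>
     VV (x T) \<le> exp (- rate * (T - s)) * VV (x s) + \<delta>)"

text \<open>The integrand F(x + e) + e stays within h of the continuous function F(x). The curve w
  with derivative F(x) therefore stays within h (t - s) of x, and it satisfies
  \<open>near_flow\<close> with the tolerance of the classical estimate.\<close>

lemma flow_estimate:
  assumes R: "R > 0" and \<delta>: "\<delta> > 0"
  shows "semiglobal (\<lambda>a \<epsilon>. \<exists>b>0. flow_contraction R \<delta> a \<epsilon> b)"
proof -
  obtain \<sigma> where \<sigma>: "\<sigma> > 0" "\<And>x1 x2 \<tau> y1 y2 \<tau>'. (x1, x2, \<tau>) \<in> xbox (R + 1) \<Longrightarrow> (y1, y2, \<tau>') \<in> xbox (R + 1) \<Longrightarrow>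
     norm (x1 - y1) + norm (x2 - y2) + \<bar>\<tau> - \<tau>'\<bar> \<le> \<sigma> \<Longrightarrow> \<bar>V (x1, x2, \<tau>) - V (y1, y2, \<tau>')\<bar> \<le> \<delta> / 2"
    by (rule V_close[of "\<delta> / 2" "R + 1"]) (use \<delta> that in auto)
  have "semiglobal (\<lambda>a \<epsilon>. \<exists>\<eta>>0. \<eta> \<le> 1 \<and> classical_contraction (R + 1) (\<delta> / 2) a \<epsilon> \<eta>)"
    by (rule classical_flow_estimate) (use R \<delta> in auto)
  then show ?thesis
  proof (rule semiglobal_mono)
    fix a \<epsilon> assume "\<exists>\<eta>>0. \<eta> \<le> 1 \<and> classical_contraction (R + 1) (\<delta> / 2) a \<epsilon> \<eta>"
    then obtain \<eta> where \<eta>: "\<eta> > 0" "\<eta> \<le> 1" and cc: "classical_contraction (R + 1) (\<delta> / 2) a \<epsilon> \<eta>" by blast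
    let ?F = "flow_map \<phi> \<kappa> k a \<epsilon>"
    obtain \<sigma>2 where \<sigma>2: "\<sigma>2 > 0" "\<And>p q. p \<in> sbox (R + 1) \<Longrightarrow> q \<in> sbox (R + 1) \<Longrightarrow> norm (p - q) \<le> \<sigma>2 \<Longrightarrow> norm (?F p - ?F q) \<le> \<eta>"
      using flow_map_close[OF \<eta>(1), of "R + 1" a \<epsilon>] by auto
    \<comment> \<open>The tolerated distance between w and x, so that w is within 2 \<zeta> of the
      flow set: \<eta>/12 absorbs the factor 6 of \<open>near_torus\<close>, Tmin/4 keeps w in the
      box, and \<sigma>/3 is shared by the three arguments of \<open>V\<close>.\<close>
    define \<zeta> where "\<zeta> = min (min \<sigma>2 (\<eta> / 12)) (min (Tmin / 4) (\<sigma> / 3))"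
    have \<zeta>: "\<zeta> > 0" "\<zeta> \<le> \<sigma>2" "\<zeta> \<le> \<eta> / 12" "\<zeta> \<le> Tmin / 4" "\<zeta> \<le> \<sigma> / 3"
      using \<sigma>2 \<eta> Tmin_pos \<sigma> by (auto simp: \<zeta>_def)
    define h where "h = min (1 / 4) (\<zeta> / (8 * Tmax))"
    have h: "h > 0" "h \<le> 1 / 4" "h * (8 * Tmax) \<le> \<zeta>"
      using \<zeta> Tmax_pos by (auto simp: h_def min_def field_simps)
    obtain \<sigma>1 where \<sigma>1: "\<sigma>1 > 0" "\<And>p q. p \<in> sbox (R + 1) \<Longrightarrow> q \<in> sbox (R + 1) \<Longrightarrow> norm (p - q) \<le> \<sigma>1 \<Longrightarrow> norm (?F p - ?F q) \<le> h / 2"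
      using flow_map_close[of "h / 2" "R + 1" a \<epsilon>] h by auto
    define bs where "bs = min (min \<sigma>1 (h / 2)) (\<zeta> / 2)"
    have bs: "bs > 0" "bs \<le> \<sigma>1" "bs \<le> h / 2" "bs \<le> \<zeta> / 2" using \<sigma>1 h \<zeta> by (auto simp: bs_def)
    show "\<exists>b>0. flow_contraction R \<delta> a \<epsilon> b"
      unfolding flow_contraction_def
    proof (rule exI[of _ bs], intro conjI bs allI impI)
      fix x e :: "real \<Rightarrow> 'n hstate" and s T :: real
      let ?G = "\<lambda>r. ?F (x r + e r) + e r"
      assume sT: "s \<le> T" and "\<forall>t\<in>{s..T}. norm (e t) \<le> bs \<and> (\<exists>p\<in>flow_set Tmin Tmax. norm (x t - p) \<le> bs) \<and>
       norm (fst (x t) - zs) \<le> R \<and> norm (fst (snd (x t)) - zs) \<le> R \<and>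
       ?G integrable_on {s..t} \<and> x t - x s = integral {s..t} ?G"
      then have e: "\<And>t. t \<in> {s..T} \<Longrightarrow> norm (e t) \<le> bs"
        and nC: "\<And>t. t \<in> {s..T} \<Longrightarrow> \<exists>p\<in>flow_set Tmin Tmax. norm (x t - p) \<le> bs"
        and xR: "\<And>t. t \<in> {s..T} \<Longrightarrow> norm (fst (x t) - zs) \<le> R" "\<And>t. t \<in> {s..T} \<Longrightarrow> norm (fst (snd (x t)) - zs) \<le> R"
        and Gi: "\<And>t. t \<in> {s..T} \<Longrightarrow> ?G integrable_on {s..t}"
        and xG: "\<And>t. t \<in> {s..T} \<Longrightarrow> x t - x s = integral {s..t} ?G" by blast+
      have near: "p \<in> sbox (R + 1)" "\<exists>p0\<in>flow_set Tmin Tmax. norm (p - p0) \<le> 2 * \<zeta>"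
        "norm (fst p - zs) \<le> R + 1" "norm (fst (snd p) - zs) \<le> R + 1"
        if t: "t \<in> {s..T}" and d: "norm (p - x t) \<le> \<zeta>" for t p
      proof -
        obtain p0 where p0: "p0 \<in> flow_set Tmin Tmax" "norm (x t - p0) \<le> bs" using nC[OF t] by blast
        have *: "norm (p - p0) \<le> 2 * \<zeta>"
          using norm_triangle_ineq[of "p - x t" "x t - p0"] d p0(2) bs \<zeta> by simp
        then show "\<exists>p0\<in>flow_set Tmin Tmax. norm (p - p0) \<le> 2 * \<zeta>" using p0 by blast
        show 1: "norm (fst p - zs) \<le> R + 1"
          using norm_triangle_ineq[of "fst p - fst (x t)" "fst (x t) - zs"] xR(1)[OF t] d \<zeta> \<eta>
            hstate_component_norms(1)[of "p - x t"] by simp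
        show 2: "norm (fst (snd p) - zs) \<le> R + 1"
          using norm_triangle_ineq[of "fst (snd p) - fst (snd (x t))" "fst (snd (x t)) - zs"] xR(2)[OF t] d \<zeta> \<eta>
            hstate_component_norms(2)[of "p - x t"] by simp
        show "p \<in> sbox (R + 1)"
          by (rule near_flow_set_in_sbox[OF p0(1) *]) (use \<zeta> \<eta> 1 2 in auto)
      qed
      have x_in: "x t \<in> sbox (R + 1)" if "t \<in> {s..T}" for t
        using near(1)[OF that, of "x t"] \<zeta> by simp
      have "continuous_on {s..T} (\<lambda>t. x s + integral {s..t} ?G)"
        using Gi[of T] sT by (intro continuous_intros indefinite_integral_continuous_1) auto
      then have x_cont: "continuous_on {s..T} x"
        by (rule continuous_on_eq) (simp flip: xG)
      have Fx_cont: "continuous_on {s..T} (\<lambda>t. ?F (x t))"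
        by (rule continuous_on_compose2[OF continuous_on_flow_map_sbox[where R = "R + 1"] x_cont]) (use x_in in auto)
      define w where "w t = x s + integral {s..t} (\<lambda>r. ?F (x r))" for t
      have w': "(w has_vector_derivative ?F (x t)) (at t within {s..T})" if "t \<in> {s..T}" for t
        unfolding w_def
        using has_vector_derivative_add[OF has_vector_derivative_const integral_has_vector_derivative[OF Fx_cont that]] by simp
      have diff: "norm (x t - w t) \<le> h * (t - s)" if t: "t \<in> {s..T}" for t
      proof -
        have Fi: "(\<lambda>r. ?F (x r)) integrable_on {s..t}"
          using t by (intro integrable_continuous_real continuous_on_subset[OF Fx_cont]) auto
        have "x t - w t = integral {s..t} ?G - integral {s..t} (\<lambda>r. ?F (x r))"
          using xG[OF t] by (simp add: w_def algebra_simps)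
        also have "\<dots> = integral {s..t} (\<lambda>r. ?G r - ?F (x r))"
          by (rule integral_diff[symmetric, OF Gi[OF t] Fi])
        also have "norm \<dots> \<le> integral {s..t} (\<lambda>r. h)"
        proof (rule integral_norm_bound_integral)
          fix r assume "r \<in> {s..t}"
          then have r: "r \<in> {s..T}" using t by auto
          have "norm (?F (x r + e r) - ?F (x r)) \<le> h / 2"
            using e[OF r] bs \<zeta> by (intro \<sigma>1(2) x_in[OF r] near(1)[OF r]) auto
          then have "norm (?F (x r + e r) - ?F (x r) + e r) \<le> h / 2 + h / 2"
            using e[OF r] bs by (intro norm_triangle_le add_mono) auto
          then show "norm (?G r - ?F (x r)) \<le> h" by (simp add: algebra_simps)
        qed (use Gi[OF t] Fi in \<open>auto intro: integrable_diff\<close>)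
        also have "\<dots> = h * (t - s)" using t by simp
        finally show ?thesis .
      qed
      define \<tau>w where "\<tau>w t = fst (snd (snd (w t)))" for t
      have \<tau>w: "\<tau>w T - \<tau>w s = 1 / 2 * (T - s)"
      proof -
        have "(\<tau>w has_real_derivative 1 / 2) (at t within {s..T})" if t: "t \<in> {s..T}" for t
        proof -
          have "((\<lambda>t. fst (snd (snd (w t)))) has_vector_derivative fst (snd (snd (?F (x t))))) (at t within {s..T})"
            using w'[OF t] by (intro bounded_linear.has_vector_derivative[OF bounded_linear_fst]
              bounded_linear.has_vector_derivative[OF bounded_linear_snd])
          then show ?thesis
            by (simp add: flow_map_def case_prod_unfold \<tau>w_def[abs_def] has_real_derivative_iff_has_vector_derivative)
        qed
        then have "((\<lambda>t. \<tau>w t - 1 / 2 * t) has_real_derivative 0) (at t within {s..T})" if "t \<in> {s..T}" for t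
          using that by (auto intro!: derivative_eq_intros)
        then have "\<exists>c. \<forall>t\<in>{s..T}. \<tau>w t - 1 / 2 * t = c"
          by (intro has_field_derivative_zero_constant) auto
        then obtain c where c: "\<And>t. t \<in> {s..T} \<Longrightarrow> \<tau>w t - 1 / 2 * t = c" by blast
        show ?thesis using c[of s] c[of T] sT by (simp add: field_simps)
      qed
      \<comment> \<open>The timer of w advances at speed exactly 1/2, that of x stays below 2 Tmax,
        and the two separate at speed at most 1/4; this bounds the length of the interval.\<close>
      have len: "T - s \<le> 8 * Tmax"
      proof -
        have "\<bar>fst (snd (snd (x T))) - \<tau>w T\<bar> \<le> h * (T - s)"
          using diff[of T] hstate_component_norms(3)[of "x T - w T"] sT by (simp add: \<tau>w_def)
        moreover have "h * (T - s) \<le> 1 / 4 * (T - s)" using h sT by (intro mult_right_mono) auto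
        moreover have "\<tau>w s = fst (snd (snd (x s)))" by (simp add: \<tau>w_def w_def)
        moreover have "fst (snd (snd (x T))) \<le> 2 * Tmax" "fst (snd (snd (x s))) \<ge> 0"
          using x_in[of T] x_in[of s] sT Tmin_pos by (auto simp: sbox_def)
        ultimately have "\<tau>w T - 2 * Tmax \<le> 1 / 4 * (T - s)" "\<tau>w T \<ge> 1 / 2 * (T - s)"
          using \<tau>w by (simp_all only: abs_le_iff; linarith)+
        then show ?thesis by argo
      qed
      have diff': "norm (w t - x t) \<le> \<zeta>" if t: "t \<in> {s..T}" for t
      proof -
        have "h * (t - s) \<le> h * (8 * Tmax)" using len t h by (intro mult_left_mono) auto
        then show ?thesis using diff[OF t] h(3) by (simp add: norm_minus_commute)
      qed
      have nf: "near_flow (R + 1) a \<epsilon> \<eta> (w t) (?F (x t))" if t: "t \<in> {s..T}" for t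
      proof -
        have wb: "w t \<in> sbox (R + 1)" by (rule near(1)[OF t diff'[OF t]])
        obtain p0 where p0: "p0 \<in> flow_set Tmin Tmax" "norm (w t - p0) \<le> 2 * \<zeta>"
          using near(2)[OF t diff'[OF t]] by blast
        have tor: "(fst (snd (snd (snd p0))), snd (snd (snd (snd p0)))) \<in> torus"
          using p0(1) by (auto simp: flow_set_def)
        have circ0: "\<bar>(fst (snd (snd (snd (w t)))) $ l)\<^sup>2 + (snd (snd (snd (snd (w t)))) $ l)\<^sup>2 - 1\<bar> \<le> 6 * (2 * \<zeta>)" for l
          by (rule near_torus[OF tor])
            (use hstate_component_norms(4,5)[of "w t - p0"] p0(2) \<zeta> \<eta> in auto)
        have circ: "\<bar>(fst (snd (snd (snd (w t)))) $ l)\<^sup>2 + (snd (snd (snd (snd (w t)))) $ l)\<^sup>2 - 1\<bar> \<le> \<eta>" for l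
          by (rule order_trans[OF circ0]) (use \<zeta>(3) in simp)
        have "norm (?F (x t) - ?F (w t)) \<le> \<eta>"
          using \<sigma>2(2)[OF x_in[OF t] wb] diff'[OF t] \<zeta>(2) by (simp add: norm_minus_commute)
        then show ?thesis
          using near(3,4)[OF t diff'[OF t]] wb circ by (auto simp: near_flow_def sbox_def case_prod_unfold)
      qed
      have "VV (w T) \<le> exp (- rate * (T - s)) * VV (w s) + \<delta> / 2"
        by (rule cc[unfolded classical_contraction_def, rule_format, OF sT]) (use w' nf in blast)
      moreover have "w s = x s" by (simp add: w_def)
      moreover have "\<bar>VV (w T) - VV (x T)\<bar> \<le> \<delta> / 2"
      proof (rule \<sigma>(2))
        have T: "T \<in> {s..T}" using sT by simp
        show "(fst (w T), fst (snd (w T)), fst (snd (snd (w T)))) \<in> xbox (R + 1)"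
          "(fst (x T), fst (snd (x T)), fst (snd (snd (x T)))) \<in> xbox (R + 1)"
          using near(1)[OF T diff'[OF T]] x_in[OF T] by (auto simp: sbox_def xbox_def)
        show "norm (fst (w T) - fst (x T)) + norm (fst (snd (w T)) - fst (snd (x T)))
            + \<bar>fst (snd (snd (w T))) - fst (snd (snd (x T)))\<bar> \<le> \<sigma>"
          using hstate_component_norms(1-3)[of "w T - x T"] diff'[OF T] \<zeta>(5) by simp
      qed
      ultimately show "VV (x T) \<le> exp (- rate * (T - s)) * VV (x s) + \<delta>"
        by (simp only: abs_le_iff) linarith
    qed
  qed
qed

end

section \<open>Hybrid estimate\<close>

text \<open>First-exit argument: at the infimum of the times with n = R the bound n \<le> R holds on
  the whole past, so the step hypothesis rules this time out.\<close>

lemma continuous_barrier: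
  fixes n :: "real \<Rightarrow> real"
  assumes cont: "continuous_on {s..T} n" and start: "n s < R"
    and step: "\<And>r. r \<in> {s..T} \<Longrightarrow> (\<And>u. u \<in> {s..r} \<Longrightarrow> n u \<le> R) \<Longrightarrow> n r < R"
    and r: "r \<in> {s..T}"
  shows "n r < R"
proof (rule ccontr)
  assume "\<not> n r < R"
  then have nr: "n r \<ge> R" by simp
  define Z where "Z = {s..T} \<inter> n -` {R}"
  have hit: "\<exists>v\<in>Z. v \<le> u" if u: "u \<in> {s..T}" "n u \<ge> R" for u
  proof -
    have "\<exists>v\<ge>s. v \<le> u \<and> n v = R"
      by (rule IVT') (use u start in \<open>auto intro: continuous_on_subset[OF cont]\<close>)
    then show ?thesis using u by (auto simp: Z_def)
  qed
  have Z: "Z \<noteq> {}" "bdd_below Z" using hit[OF r nr] by (auto simp: Z_def bdd_below_def)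
  have "closed Z" unfolding Z_def by (rule continuous_closed_preimage[OF cont]) auto
  then have u0: "Inf Z \<in> Z" using Z closed_contains_Inf by blast
  have "n u \<le> R" if u: "u \<in> {s..Inf Z}" for u
  proof (rule ccontr)
    assume a: "\<not> n u \<le> R"
    then obtain v where v: "v \<in> Z" "v \<le> u" using hit[of u] u u0 by (auto simp: Z_def)
    then have "Inf Z \<le> v" using Z by (intro cInf_lower) auto
    then have "u = Inf Z" using u v by auto
    then show False using a u0 by (auto simp: Z_def)
  qed
  then have "n (Inf Z) < R" using u0 by (intro step) (auto simp: Z_def)
  then show False using u0 by (auto simp: Z_def)
qed

text \<open>A hybrid time domain in the sense of \<^const>\<open>htd\<close> may branch, so the jump times are
  attached to a point \<open>(t, j)\<close> of the domain and not to the domain itself.\<close>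

lemma htd_history:
  assumes E: "htd E" and tj: "(t, j) \<in> E"
  obtains ts :: "nat \<Rightarrow> real" where "ts 0 = 0" "ts (Suc j) = t" "\<And>i. i \<le> j \<Longrightarrow> ts i \<le> ts (Suc i)"
    "\<And>i r. i \<le> j \<Longrightarrow> r \<in> {ts i..ts (Suc i)} \<Longrightarrow> (r, i) \<in> E"
    "\<And>i r. i \<le> j \<Longrightarrow> r \<le> t \<Longrightarrow> (r, i) \<in> E \<Longrightarrow> r \<in> {ts i..ts (Suc i)}"
proof -
  have t0: "t \<ge> 0" and pos: "\<And>r i. (r, i) \<in> E \<Longrightarrow> r \<ge> 0" using E tj by (auto simp: htd_def)
  have "compact_htd (E \<inter> ({0..t} \<times> {0..j}))" using E tj by (auto simp: htd_def)
  then obtain J ts where ts0: "ts 0 = 0" and mono: "\<And>i. i < J \<Longrightarrow> ts i \<le> ts (Suc i)"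
    and eq: "E \<inter> ({0..t} \<times> {0..j}) = {(s, i). i < J \<and> ts i \<le> s \<and> s \<le> ts (Suc i)}"
    unfolding compact_htd_def by blast
  have mem: "(r, i) \<in> E \<and> 0 \<le> r \<and> r \<le> t \<and> i \<le> j \<longleftrightarrow> i < J \<and> ts i \<le> r \<and> r \<le> ts (Suc i)" for r i
    using eq by (auto simp: set_eq_iff)
  have "j < J" "t \<le> ts (Suc j)" using mem[of t j] tj t0 by auto
  moreover have "ts (Suc j) \<le> t" using mem[of "ts (Suc j)" j] mono[of j] \<open>j < J\<close> by auto
  ultimately have L1: "ts (Suc j) = t" by simp
  show ?thesis
  proof (rule that[OF ts0 L1])
    show "ts i \<le> ts (Suc i)" if "i \<le> j" for i using mono that \<open>j < J\<close> by simp
    show "(r, i) \<in> E" if "i \<le> j" "r \<in> {ts i..ts (Suc i)}" for i r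
      using mem[of r i] that \<open>j < J\<close> by auto
    show "r \<in> {ts i..ts (Suc i)}" if "i \<le> j" "r \<le> t" "(r, i) \<in> E" for i r
      using mem[of r i] that pos by auto
  qed
qed

lemma solution_integral:
  assumes sol: "is_solution C F D G e E x" and "(s, j) \<in> E" "(t, j) \<in> E" "s \<le> t"
  shows "(\<lambda>r. F (x (r, j) + e r) + e r) integrable_on {s..t}"
    and "x (t, j) - x (s, j) = integral {s..t} (\<lambda>r. F (x (r, j) + e r) + e r)"
proof -
  have *: "(\<lambda>r. F (x (r, j) + e r) + e r) absolutely_integrable_on {s..t} \<and>
     x (t, j) - x (s, j) = integral {s..t} (\<lambda>r. F (x (r, j) + e r) + e r)"
    using assms unfolding is_solution_def by blast
  then show "(\<lambda>r. F (x (r, j) + e r) + e r) integrable_on {s..t}"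
    using set_lebesgue_integral_eq_integral(1) by blast
  show "x (t, j) - x (s, j) = integral {s..t} (\<lambda>r. F (x (r, j) + e r) + e r)"
    using * by blast
qed

lemma solution_continuous_on:
  assumes sol: "is_solution C F D G e E x" and sub: "\<And>r. r \<in> {s..t} \<Longrightarrow> (r, j) \<in> E"
  shows "continuous_on {s..t} (\<lambda>r. x (r, j))"
proof (cases "s \<le> t")
  case True
  let ?f = "\<lambda>r. F (x (r, j) + e r) + e r"
  have "?f integrable_on {s..t}" and eq: "\<And>r. r \<in> {s..t} \<Longrightarrow> x (r, j) - x (s, j) = integral {s..r} ?f"
    using solution_integral[OF sol] sub True by auto
  then have "continuous_on {s..t} (\<lambda>r. x (s, j) + integral {s..r} ?f)"
    by (intro continuous_intros indefinite_integral_continuous_1)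
  then show ?thesis
    by (rule continuous_on_eq) (simp flip: eq)
qed simp

lemma closed_torus: "closed (torus :: ((real^'n) \<times> (real^'n)) set)"
proof -
  have eq: "torus = (\<Inter>l. {p :: (real^'n) \<times> (real^'n). (fst p $ l)\<^sup>2 + (snd p $ l)\<^sup>2 = 1})"
    by (auto simp: torus_def)
  show ?thesis unfolding eq by (intro closed_INT ballI closed_Collect_eq continuous_intros)
qed

lemma closed_flow_set: "closed (flow_set Tmin Tmax :: 'n::finite hstate set)"
proof -
  have "flow_set Tmin Tmax = (UNIV :: (real^'n) set) \<times> ((UNIV :: (real^'n) set) \<times> ({Tmin..Tmax} \<times> torus))"
    by (auto simp: flow_set_def)
  then show ?thesis by (auto intro!: closed_Times closed_torus)
qed

text \<open>In the interior of a flow interval x + e lies in the flow set. A degenerate interval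
  either is initial or follows a jump, and then x is an image under the jump map, which sends the
  jump set into the flow set, displaced by e.\<close>

lemma solution_near_flow_set:
  fixes x :: "real \<times> nat \<Rightarrow> 'n::finite hstate"
  assumes sol: "H_solution \<phi> \<kappa> k Tmin Tmax a \<epsilon> e E x" and e: "\<And>t. norm (e t) \<le> b"
    and T: "Tmin < Tmax" and tj: "(t, j) \<in> E"
  shows "\<exists>p\<in>flow_set Tmin Tmax. norm (x (t, j) - p) \<le> b"
proof -
  note S = sol[unfolded H_solution_def]
  note S' = S[unfolded is_solution_def]
  have E: "htd E" using S' by blast
  obtain ts where ts: "ts 0 = 0" "ts (Suc j) = t" "\<And>i. i \<le> j \<Longrightarrow> ts i \<le> ts (Suc i)"
    "\<And>i r. i \<le> j \<Longrightarrow> r \<in> {ts i..ts (Suc i)} \<Longrightarrow> (r, i) \<in> E"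
    using htd_history[OF E tj] by metis
  have DC: "jump_set Tmax \<subseteq> (flow_set Tmin Tmax :: 'n hstate set)" using T by (auto simp: jump_set_def flow_set_def)
  show ?thesis
  proof (cases "ts j < t")
    case True
    have near: "infdist (x (r, j)) (flow_set Tmin Tmax) \<le> b" if r: "r \<in> {ts j<..<t}" for r
    proof -
      have "{ts j<..<t} \<subseteq> {s. (s, j) \<in> E}" using ts(2) ts(4)[of j] by auto
      then have "r \<in> interior {s. (s, j) \<in> E}" using r interior_maximal[OF _ open_greaterThanLessThan] by blast
      then have "x (r, j) + e r \<in> flow_set Tmin Tmax" using S' by blast
      then have "infdist (x (r, j)) (flow_set Tmin Tmax) \<le> dist (x (r, j)) (x (r, j) + e r)" by (rule infdist_le)
      then show ?thesis using e[of r] by (simp add: dist_norm)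
    qed
    \<comment> \<open>The flow condition concerns only interior times; continuity of the distance
      carries the bound to the endpoint t.\<close>
    have cont: "continuous_on {ts j..t} (\<lambda>r. infdist (x (r, j)) (flow_set Tmin Tmax))"
      by (intro continuous_on_infdist solution_continuous_on[OF S]) (use ts(2) ts(4)[of j] in auto)
    have "infdist (x (t, j)) (flow_set Tmin Tmax) \<le> b"
    proof (rule continuous_le_on_closure[OF _ _ near])
      show "continuous_on (closure {ts j<..<t}) (\<lambda>r. infdist (x (r, j)) (flow_set Tmin Tmax))"
        using cont True by (simp add: closure_greaterThanLessThan)
      show "t \<in> closure {ts j<..<t}" using True by (simp add: closure_greaterThanLessThan)
    qed
    moreover have "flow_set Tmin Tmax \<noteq> ({} :: 'n hstate set)"
    proof -
      have "(0, 0, Tmin, \<chi> l. 1, 0) \<in> (flow_set Tmin Tmax :: 'n hstate set)" using T by (simp add: flow_set_def torus_def)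
      then show ?thesis by blast
    qed
    then obtain p where "p \<in> flow_set Tmin Tmax" "infdist (x (t, j)) (flow_set Tmin Tmax) = dist (x (t, j)) p"
      using infdist_attains_inf[OF closed_flow_set] by metis
    ultimately show ?thesis by (auto simp: dist_norm)
  next
    case False
    then have tt: "ts j = t" using ts(2) ts(3)[of j] by simp
    show ?thesis
    proof (cases j)
      case 0
      then have "x (t, j) + e t \<in> closure (flow_set Tmin Tmax) \<union> jump_set Tmax"
        using S' tt ts(1) by auto
      then have "x (t, j) + e t \<in> flow_set Tmin Tmax"
        using DC by (auto simp: closure_closed[OF closed_flow_set])
      then show ?thesis using e[of t] by (intro bexI[of _ "x (t, j) + e t"]) auto
    next
      case (Suc i)
      have "(t, i) \<in> E" using ts(4)[of i t] ts(3)[of i] tt Suc by auto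
      then have "x (t, i) + e t \<in> jump_set Tmax" "x (t, j) = jump_map Tmin (x (t, i) + e t) + e t"
        using S' tj Suc by auto
      moreover from this(1) have "jump_map Tmin (x (t, i) + e t) \<in> flow_set Tmin Tmax"
        using T by (auto simp: jump_set_def flow_set_def jump_map_def)
      ultimately show ?thesis using e[of t] by (intro bexI[of _ "jump_map Tmin (x (t, i) + e t)"]) auto
    qed
  qed
qed

context hybrid_momentum
begin

text \<open>The perturbation acts before and after the jump map, moving each position by up to 2 b
  and the timer by b, which explains \<sigma>/5. Here b is independent of a and \<epsilon>.\<close>

lemma jump_estimate:
  assumes \<delta>: "\<delta> > 0"
  shows "\<exists>b>0. \<forall>x e :: 'n hstate. norm (fst x - zs) \<le> R \<longrightarrow> norm (fst (snd x) - zs) \<le> R \<longrightarrow> norm e \<le> b \<longrightarrow>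
    x + e \<in> jump_set Tmax \<longrightarrow> VV (jump_map Tmin (x + e) + e) \<le> gam * VV x + \<delta>"
proof -
  obtain \<sigma> where \<sigma>: "\<sigma> > 0" "\<And>x1 x2 \<tau> y1 y2 \<tau>'. (x1, x2, \<tau>) \<in> xbox (R + 1) \<Longrightarrow> (y1, y2, \<tau>') \<in> xbox (R + 1) \<Longrightarrow>
     norm (x1 - y1) + norm (x2 - y2) + \<bar>\<tau> - \<tau>'\<bar> \<le> \<sigma> \<Longrightarrow> \<bar>V (x1, x2, \<tau>) - V (y1, y2, \<tau>')\<bar> \<le> \<delta> / 2"
    by (rule V_close[of "\<delta> / 2" "R + 1"]) (use \<delta> that in auto)
  define b where "b = min (\<sigma> / 5) (min (Tmin / 2) (1 / 2))"
  have b: "b > 0" "b \<le> \<sigma> / 5" "b \<le> Tmin / 2" "b \<le> 1 / 2" using \<sigma> Tmin_pos by (auto simp: b_def)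
  show ?thesis
  proof (rule exI[of _ b], intro conjI b allI impI)
    fix x e :: "'n hstate"
    assume R: "norm (fst x - zs) \<le> R" "norm (fst (snd x) - zs) \<le> R" and e: "norm e \<le> b" and D: "x + e \<in> jump_set Tmax"
    obtain x1 x2 \<tau> c s where x: "x = (x1, x2, \<tau>, c, s)" by (cases x) auto
    obtain e1 e2 e3 e4 e5 where e': "e = (e1, e2, e3, e4, e5)" by (cases e) auto
    have en: "norm e1 \<le> b" "norm e2 \<le> b" "\<bar>e3\<bar> \<le> b"
      using hstate_component_norms(1-3)[of e] e by (auto simp: e')
    have \<tau>: "\<tau> + e3 = Tmax" using D by (auto simp: jump_set_def x e')
    have x12: "norm (x1 - zs) \<le> R" "norm (x2 - zs) \<le> R" using R by (auto simp: x)
    have n1: "norm (e1 + e1) \<le> 2 * b" "norm (e1 + e2) \<le> 2 * b"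
      using norm_triangle_ineq[of e1 e1] norm_triangle_ineq[of e1 e2] en by linarith+
    have jm: "jump_map Tmin (x + e) + e = (x1 + (e1 + e1), x1 + (e1 + e2), Tmin + e3, (c + e4) + e4, (s + e5) + e5)"
      by (simp add: jump_map_def x e' add.assoc)
    have "\<bar>V (x1 + (e1 + e1), x1 + (e1 + e2), Tmin + e3) - V (x1, x1, Tmin)\<bar> \<le> \<delta> / 2"
    proof (rule \<sigma>(2))
      have "norm (x1 + (e1 + e1) - zs) \<le> R + 1" "norm (x1 + (e1 + e2) - zs) \<le> R + 1"
        using norm_triangle_ineq[of "x1 - zs" "e1 + e1"] norm_triangle_ineq[of "x1 - zs" "e1 + e2"] n1 x12 b
        by (simp_all add: algebra_simps)
      then show "(x1 + (e1 + e1), x1 + (e1 + e2), Tmin + e3) \<in> xbox (R + 1)"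
        using en b Tmin_pos Tmin_less by (auto simp: xbox_iff)
      show "norm (x1 + (e1 + e1) - x1) + norm (x1 + (e1 + e2) - x1) + \<bar>Tmin + e3 - Tmin\<bar> \<le> \<sigma>"
        using n1 en b by simp
    qed (use x12 Tmin_pos Tmin_less in \<open>auto simp: xbox_iff\<close>)
    moreover have "\<bar>V (x1, x2, Tmax) - V (x1, x2, \<tau>)\<bar> \<le> \<delta> / 2"
      by (rule \<sigma>(2)) (use x12 en b \<tau> \<sigma>(1) Tmin_pos Tmin_less in \<open>auto simp: xbox_iff\<close>)
    moreover have "V (x1, x1, Tmin) \<le> gam * V (x1, x2, Tmax)" by (rule V_jump)
    moreover have "gam * V (x1, x2, Tmax) \<le> gam * V (x1, x2, \<tau>) + \<delta> / 2"
    proof -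
      have "V (x1, x2, Tmax) \<le> V (x1, x2, \<tau>) + \<delta> / 2"
        using \<open>\<bar>V (x1, x2, Tmax) - V (x1, x2, \<tau>)\<bar> \<le> \<delta> / 2\<close> by linarith
      then have "gam * V (x1, x2, Tmax) \<le> gam * (V (x1, x2, \<tau>) + \<delta> / 2)" using gam_pos by simp
      moreover have "gam * (\<delta> / 2) \<le> 1 * (\<delta> / 2)" using gam_le_1 \<delta> by (intro mult_right_mono) auto
      ultimately show ?thesis unfolding distrib_left by linarith
    qed
    ultimately have "V (x1 + (e1 + e1), x1 + (e1 + e2), Tmin + e3) \<le> gam * V (x1, x2, \<tau>) + \<delta>"
      by linarith
    then show "VV (jump_map Tmin (x + e) + e) \<le> gam * VV x + \<delta>"
      unfolding jm by (simp add: x)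
  qed
qed

text \<open>Radius of a ball containing the sublevel set of \<open>V\<close> at height B, enlarged
  by 1 to give the strict inequality that the barrier argument needs.\<close>

definition rad :: "real \<Rightarrow> real" where "rad B = sqrt (B / c_lo) + 1"

lemma V_le_imp_bounded:
  assumes "Tmin / 2 \<le> fst (snd (snd p))" "VV p \<le> B"
  shows "norm (fst p - zs) < rad B" "norm (fst (snd p) - zs) < rad B"
proof -
  have "c_lo * ((norm (fst p - zs))\<^sup>2 + (norm (fst (snd p) - zs))\<^sup>2) \<le> B"
    using V_lower[OF assms(1), of "fst p" "fst (snd p)"] assms(2) by linarith
  then have *: "(norm (fst p - zs))\<^sup>2 + (norm (fst (snd p) - zs))\<^sup>2 \<le> B / c_lo"
    using c_lo_pos by (simp add: field_simps)
  have "0 \<le> (norm (fst p - zs))\<^sup>2" "0 \<le> (norm (fst (snd p) - zs))\<^sup>2" by auto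
  then have "(norm (fst p - zs))\<^sup>2 \<le> B / c_lo" "(norm (fst (snd p) - zs))\<^sup>2 \<le> B / c_lo" using * by linarith+
  then show "norm (fst p - zs) < rad B" "norm (fst (snd p) - zs) < rad B"
    unfolding rad_def using real_le_rsqrt by (smt (verit))+
qed

text \<open>Nominal speed 1/2 plus at most 1/2 from the perturbation. It yields the lower bound on
  the time between resets.\<close>

lemma timer_speed:
  fixes x e :: "real \<Rightarrow> 'n hstate"
  assumes st: "s \<le> t" and e: "\<And>t. norm (e t) \<le> 1 / 2"
    and int: "(\<lambda>r. flow_map \<phi> \<kappa> k a \<epsilon> (x r + e r) + e r) integrable_on {s..t}"
    and eq: "x t - x s = integral {s..t} (\<lambda>r. flow_map \<phi> \<kappa> k a \<epsilon> (x r + e r) + e r)"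
  shows "fst (snd (snd (x t))) - fst (snd (snd (x s))) \<le> t - s"
proof -
  let ?f = "\<lambda>r. flow_map \<phi> \<kappa> k a \<epsilon> (x r + e r) + e r"
  define h :: "'n hstate \<Rightarrow> real" where "h p = fst (snd (snd p))" for p
  have h: "bounded_linear h"
    unfolding h_def[abs_def]
    by (intro bounded_linear_fst_comp bounded_linear_snd_comp bounded_linear_ident)
  have "h (x t) - h (x s) = h (integral {s..t} ?f)"
    unfolding eq[symmetric] by (simp add: h_def)
  also have "\<dots> = integral {s..t} (h \<circ> ?f)" by (rule integral_linear[OF int h, symmetric])
  also have "\<dots> \<le> norm (integral {s..t} (h \<circ> ?f))" by simp
  also have "\<dots> \<le> integral {s..t} (\<lambda>r. 1)"
  proof (rule integral_norm_bound_integral)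
    show "(h \<circ> ?f) integrable_on {s..t}" by (rule integrable_linear[OF int h])
    fix r
    have "h (?f r) = 1 / 2 + h (e r)" by (simp add: h_def flow_map_def case_prod_unfold)
    moreover have "\<bar>h (e r)\<bar> \<le> 1 / 2" using hstate_component_norms(3)[of "e r"] e[of r] by (simp add: h_def)
    ultimately show "norm ((h \<circ> ?f) r) \<le> 1" by simp
  qed (rule integrable_continuous_real, simp)
  also have "\<dots> = t - s" using st by simp
  finally show ?thesis by (simp add: h_def)
qed

text \<open>Between resets the timer climbs from at most Tmin + b to at least Tmax - b at speed at
  most 1. With 2 b at most half of Tmax - Tmin, the other half remains.\<close>

definition dwell :: real where "dwell = (Tmax - Tmin) / 2"

lemma dwell_pos: "dwell > 0"
  using Tmin_less by (simp add: dwell_def)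

definition solution_estimate :: "real \<Rightarrow> real \<Rightarrow> real \<Rightarrow> real \<Rightarrow> real \<Rightarrow> bool" where
  "solution_estimate B \<delta> a \<epsilon> b \<longleftrightarrow> (\<forall>e E x. (\<forall>t. norm (e t) \<le> b) \<longrightarrow>
     H_solution \<phi> \<kappa> k Tmin Tmax a \<epsilon> e E x \<longrightarrow> VV (x (0, 0)) \<le> B \<longrightarrow>
     (\<forall>t j. (t, j) \<in> E \<longrightarrow> VV (x (t, j)) \<le> gam ^ j * exp (- rate * t) * VV (x (0, 0)) + \<delta> \<and>
         (real j - 1) * dwell \<le> t))"

text \<open>Induction along the jumps that precede (t, j). A period adds at most 2 \<delta>0, one
  for the flow and one for the jump, and multiplies the earlier error by at most q after the first
  period; M is the fixed point of the map taking m to q m + 2 \<delta>0.\<close>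

lemma core_estimate:
  assumes B: "B > 0" and \<delta>: "\<delta> > 0"
  shows "semiglobal (\<lambda>a \<epsilon>. \<exists>b>0. solution_estimate B \<delta> a \<epsilon> b)"
proof -
  define q where "q = exp (- rate * dwell)"
  have q: "0 < q" "q < 1" using rate_pos dwell_pos by (auto simp: q_def)
  \<comment> \<open>With this choice M is 2/3 and \<delta>0 at most 1/3 of
    \<open>min \<delta> 1\<close>, so the total error is below both \<delta> and 1.\<close>
  define \<delta>0 where "\<delta>0 = min \<delta> 1 * (1 - q) / 3"
  have \<delta>0: "\<delta>0 > 0" using \<delta> q by (simp add: \<delta>0_def)
  define M where "M = 2 * \<delta>0 / (1 - q)"
  have M: "q * M + 2 * \<delta>0 = M" "2 * \<delta>0 \<le> M" "M + \<delta>0 \<le> \<delta>" "M + \<delta>0 \<le> 1"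
  proof -
    show *: "q * M + 2 * \<delta>0 = M" using q by (simp add: M_def field_simps)
    have "M > 0" using \<delta>0 q by (simp add: M_def)
    then show "2 * \<delta>0 \<le> M" using * q by (smt (verit) mult_pos_pos)
    have "2 * (m * (1 - q) / 3) / (1 - q) = 2 / 3 * m" for m using q by (simp add: field_simps)
    then have "M = 2 / 3 * min \<delta> 1" unfolding M_def \<delta>0_def .
    moreover have "\<delta>0 \<le> min \<delta> 1 / 3"
      using mult_left_mono[of "1 - q" 1 "min \<delta> 1"] q \<delta> by (simp add: \<delta>0_def)
    ultimately show "M + \<delta>0 \<le> \<delta>" "M + \<delta>0 \<le> 1" by linarith+
  qed
  \<comment> \<open>\<open>V\<close> is at most B + 1 at the start of every flow interval and at
    most B + 2 along it.\<close>
  define R where "R = rad (B + 2)"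
  have R: "R > 0" using B c_lo_pos by (simp add: R_def rad_def add_nonneg_pos)
  obtain b1 where b1: "b1 > 0" "\<And>x e :: 'n hstate. norm (fst x - zs) \<le> R \<Longrightarrow> norm (fst (snd x) - zs) \<le> R \<Longrightarrow> norm e \<le> b1 \<Longrightarrow>
    x + e \<in> jump_set Tmax \<Longrightarrow> VV (jump_map Tmin (x + e) + e) \<le> gam * VV x + \<delta>0"
    using jump_estimate[OF \<delta>0, of R] by blast
  show ?thesis
  proof (rule semiglobal_mono[OF flow_estimate[OF R \<delta>0]])
    fix a \<epsilon> assume "\<exists>b>0. flow_contraction R \<delta>0 a \<epsilon> b"
    then obtain b0 where b0: "b0 > 0" and fe: "flow_contraction R \<delta>0 a \<epsilon> b0" by blast
    let ?F = "flow_map \<phi> \<kappa> k a \<epsilon>"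
    define bs where "bs = min (min b0 b1) (min (Tmin / 2) (min (dwell / 2) (1 / 2)))"
    have bs: "bs > 0" "bs \<le> b0" "bs \<le> b1" "bs \<le> Tmin / 2" "bs \<le> dwell / 2" "bs \<le> 1 / 2"
      using b0 b1 Tmin_pos dwell_pos by (auto simp: bs_def)
    show "\<exists>b>0. solution_estimate B \<delta> a \<epsilon> b"
      unfolding solution_estimate_def
    proof (rule exI[of _ bs], rule conjI[OF bs(1)], intro allI impI conjI)
      fix e E x and t :: real and j :: nat
      assume "\<forall>t. norm (e t) \<le> bs" and sol: "H_solution \<phi> \<kappa> k Tmin Tmax a \<epsilon> e E x"
        and V0: "VV (x (0, 0)) \<le> B" and tj: "(t, j) \<in> E"
      then have e: "\<And>t. norm (e t) \<le> bs" by blast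
      note S = sol[unfolded H_solution_def]
      note S' = S[unfolded is_solution_def]
      have E: "htd E" using S' by blast
      obtain ts where ts: "ts 0 = 0" "ts (Suc j) = t" "\<And>i. i \<le> j \<Longrightarrow> ts i \<le> ts (Suc i)"
        "\<And>i r. i \<le> j \<Longrightarrow> r \<in> {ts i..ts (Suc i)} \<Longrightarrow> (r, i) \<in> E"
        using htd_history[OF E tj] by metis
      have near: "\<exists>p\<in>flow_set Tmin Tmax. norm (x (r, i) - p) \<le> bs" if "(r, i) \<in> E" for r i
        by (rule solution_near_flow_set[OF sol e Tmin_less that])
      have tau: "Tmin / 2 \<le> fst (snd (snd (x (r, i))))" if rE: "(r, i) \<in> E" for r i
      proof -
        obtain p where p: "p \<in> flow_set Tmin Tmax" "norm (x (r, i) - p) \<le> bs" using near[OF rE] by blast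
        have "\<bar>fst (snd (snd (x (r, i)))) - fst (snd (snd p))\<bar> \<le> bs"
          using hstate_component_norms(3)[of "x (r, i) - p"] p(2) by simp
        moreover have "Tmin \<le> fst (snd (snd p))" using p(1) by (auto simp: flow_set_def)
        ultimately show ?thesis using bs by linarith
      qed
      have int: "(\<lambda>r. ?F (x (r, i) + e r) + e r) integrable_on {r1..r2}"
         "x (r2, i) - x (r1, i) = integral {r1..r2} (\<lambda>r. ?F (x (r, i) + e r) + e r)"
        if "(r1, i) \<in> E" "(r2, i) \<in> E" "r1 \<le> r2" for r1 r2 i
        using solution_integral[OF S that] by auto
      have flow: "norm (fst (x (r, i)) - zs) < R \<and> norm (fst (snd (x (r, i))) - zs) < R \<and>
          VV (x (r, i)) \<le> exp (- rate * (r - ts i)) * VV (x (ts i, i)) + \<delta>0"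
        if i: "i \<le> j" and r: "r \<in> {ts i..ts (Suc i)}" and start: "VV (x (ts i, i)) \<le> B + 1" for i r
      proof -
        have inE: "(u, i) \<in> E" if "u \<in> {ts i..ts (Suc i)}" for u using ts(4)[OF i that] .
        define n where "n u = max (norm (fst (x (u, i)) - zs)) (norm (fst (snd (x (u, i))) - zs))" for u
        have est: "VV (x (u, i)) \<le> exp (- rate * (u - ts i)) * VV (x (ts i, i)) + \<delta>0"
          if u: "u \<in> {ts i..ts (Suc i)}" and nR: "\<And>v. v \<in> {ts i..u} \<Longrightarrow> n v \<le> R" for u
        proof (rule fe[unfolded flow_contraction_def, rule_format, where x = "\<lambda>u. x (u, i)" and e = e])
          show "ts i \<le> u" using u by simp
          fix v assume v: "v \<in> {ts i..u}"
          then have v': "v \<in> {ts i..ts (Suc i)}" using u by auto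
          obtain p where "p \<in> flow_set Tmin Tmax" "norm (x (v, i) - p) \<le> bs" using near[OF inE[OF v']] by blast
          then have "\<exists>p\<in>flow_set Tmin Tmax. norm (x (v, i) - p) \<le> b0" using bs(2) by (auto intro: order_trans)
          then show "norm (e v) \<le> b0 \<and> (\<exists>p\<in>flow_set Tmin Tmax. norm (x (v, i) - p) \<le> b0) \<and>
             norm (fst (x (v, i)) - zs) \<le> R \<and> norm (fst (snd (x (v, i))) - zs) \<le> R \<and>
             (\<lambda>r. ?F (x (r, i) + e r) + e r) integrable_on {ts i..v} \<and>
             x (v, i) - x (ts i, i) = integral {ts i..v} (\<lambda>r. ?F (x (r, i) + e r) + e r)"
            using e[of v] bs(2) nR[OF v] int[of "ts i" i v] inE[OF v'] inE[of "ts i"] v' by (auto simp: n_def)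
        qed
        have bnd: "n u < R" if u: "u \<in> {ts i..ts (Suc i)}" and le: "VV (x (u, i)) \<le> B + 2" for u
          using V_le_imp_bounded[OF tau[OF inE[OF u]] le] by (simp add: n_def R_def)
        \<comment> \<open>As long as the solution is in the ball of radius R the flow estimate
          applies; it keeps \<open>V\<close> below B + 2 and hence \<open>n\<close> strictly below
          R, which closes the barrier argument.\<close>
        have nr: "n u < R" if "u \<in> {ts i..ts (Suc i)}" for u
        proof (rule continuous_barrier[OF _ _ _ that])
          have "continuous_on {ts i..ts (Suc i)} (\<lambda>r. x (r, i))"
            by (rule solution_continuous_on[OF S]) (use inE in auto)
          then show "continuous_on {ts i..ts (Suc i)} n"
            unfolding n_def by (intro continuous_intros)
          show "n (ts i) < R" using start r by (intro bnd) auto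
          fix u assume u: "u \<in> {ts i..ts (Suc i)}" and nu: "\<And>v. v \<in> {ts i..u} \<Longrightarrow> n v \<le> R"
          have "exp (- rate * (u - ts i)) * VV (x (ts i, i)) \<le> 1 * VV (x (ts i, i))"
            using u rate_pos V_nonneg by (intro mult_right_mono) auto
          then have "VV (x (u, i)) \<le> B + 2" using est[OF u nu] start M \<delta>0 by linarith
          then show "n u < R" by (rule bnd[OF u])
        qed
        then show ?thesis using est[OF r] nr[OF r] r by (force simp: n_def intro: less_imp_le)
      qed
      \<comment> \<open>At i = 0 no error has accumulated, so the additive term is 0, and the timer
        is not yet known to be close to Tmin; the bound Tmin + bs holds only after a jump and
        provides the dwell time of the next period.\<close>
      have main: "VV (x (ts i, i)) \<le> gam ^ i * exp (- rate * ts i) * VV (x (0, 0)) + (if i = 0 then 0 else M) \<and>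
          (real i - 1) * dwell \<le> ts i \<and> (i > 0 \<longrightarrow> fst (snd (snd (x (ts i, i)))) \<le> Tmin + bs)"
        if "i \<le> j" for i
        using that
      proof (induction i)
        case 0
        then show ?case using ts(1) dwell_pos by simp
      next
        case (Suc i)
        then have ij: "i \<le> j" "i < j" by auto
        note IH = Suc.IH[OF ij(1)]
        define \<Delta> where "\<Delta> = ts (Suc i) - ts i"
        have \<Delta>: "\<Delta> \<ge> 0" using ts(3)[OF ij(1)] by (simp add: \<Delta>_def)
        have inE: "(ts i, i) \<in> E" "(ts (Suc i), i) \<in> E" "(ts (Suc i), Suc i) \<in> E"
          using ts(3)[OF ij(1)] ts(3)[OF Suc.prems] ts(4)[OF ij(1)] ts(4)[OF Suc.prems] by auto
        have gexp: "gam ^ i * exp (- rate * ts i) * VV (x (0, 0)) \<le> 1 * B"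
        proof (intro mult_mono V0)
          have "exp (- rate * ts i) \<le> 1" using rate_pos IH inE(1) E by (auto simp: htd_def)
          then show "gam ^ i * exp (- rate * ts i) \<le> 1"
            using gam_pos gam_le_1 by (intro mult_le_one power_le_one) auto
        qed (use V_nonneg in auto)
        have start: "VV (x (ts i, i)) \<le> B + 1" using IH gexp M \<delta>0 by (auto split: if_splits)
        have fl: "norm (fst (x (ts (Suc i), i)) - zs) < R" "norm (fst (snd (x (ts (Suc i), i))) - zs) < R"
          "VV (x (ts (Suc i), i)) \<le> exp (- rate * \<Delta>) * VV (x (ts i, i)) + \<delta>0"
          using flow[OF ij(1) _ start, of "ts (Suc i)"] ts(3)[OF ij(1)] by (auto simp: \<Delta>_def)
        have jmp: "x (ts (Suc i), i) + e (ts (Suc i)) \<in> jump_set Tmax"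
          "x (ts (Suc i), Suc i) = jump_map Tmin (x (ts (Suc i), i) + e (ts (Suc i))) + e (ts (Suc i))"
          using S' inE by auto
        have e1: "norm (e (ts (Suc i))) \<le> b1" using e[of "ts (Suc i)"] bs by simp
        have et: "\<bar>fst (snd (snd (e (ts (Suc i)))))\<bar> \<le> bs"
          using hstate_component_norms(3)[of "e (ts (Suc i))"] e[of "ts (Suc i)"] by simp
        have timer: "fst (snd (snd (x (ts (Suc i), Suc i)))) \<le> Tmin + bs"
          using et unfolding jmp(2) by (simp add: jump_map_def case_prod_unfold)
        have long: "dwell \<le> \<Delta>" if "i > 0"
        proof -
          have "fst (snd (snd (x (ts (Suc i), i)))) + fst (snd (snd (e (ts (Suc i))))) = Tmax"
            using jmp(1) by (auto simp: jump_set_def case_prod_unfold)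
          moreover have "fst (snd (snd (x (ts i, i)))) \<le> Tmin + bs" using IH that by blast
          moreover have "fst (snd (snd (x (ts (Suc i), i)))) - fst (snd (snd (x (ts i, i)))) \<le> \<Delta>"
            unfolding \<Delta>_def
            by (rule timer_speed[where x = "\<lambda>r. x (r, i)" and e = e, OF _ _ int[OF inE(1,2)]])
              (use ts(3)[OF ij(1)] order_trans[OF e bs(6)] in auto)
          ultimately show ?thesis using et bs(5) Tmin_less by (simp add: dwell_def)
        qed
        define A where "A = gam ^ i * exp (- rate * ts i) * VV (x (0, 0))"
        define N where "N = (if i = 0 then 0 else M)"
        have N: "exp (- rate * \<Delta>) * N + 2 * \<delta>0 \<le> M"
        proof (cases "i = 0")
          case False
          then have "exp (- rate * \<Delta>) \<le> q" using long rate_pos by (simp add: q_def)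
          then have "exp (- rate * \<Delta>) * M \<le> q * M" using M \<delta>0 by (intro mult_right_mono) auto
          then show ?thesis using M(1) False by (simp add: N_def)
        qed (use M N_def in auto)
        have "VV (x (ts (Suc i), Suc i)) \<le> gam * VV (x (ts (Suc i), i)) + \<delta>0"
          unfolding jmp(2) by (rule b1(2)[OF _ _ e1 jmp(1)]) (use fl in auto)
        also have "\<dots> \<le> gam * (exp (- rate * \<Delta>) * (A + N) + \<delta>0) + \<delta>0"
        proof -
          have "exp (- rate * \<Delta>) * VV (x (ts i, i)) \<le> exp (- rate * \<Delta>) * (A + N)"
            using IH by (intro mult_left_mono) (auto simp: A_def N_def)
          then have "VV (x (ts (Suc i), i)) \<le> exp (- rate * \<Delta>) * (A + N) + \<delta>0" using fl(3) by linarith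
          then show ?thesis using gam_pos by (intro add_right_mono mult_left_mono) auto
        qed
        also have "\<dots> = gam * (exp (- rate * \<Delta>) * A) + gam * (exp (- rate * \<Delta>) * N + \<delta>0) + \<delta>0"
          by (simp add: algebra_simps)
        also have "\<dots> \<le> gam * (exp (- rate * \<Delta>) * A) + 1 * (exp (- rate * \<Delta>) * N + \<delta>0) + \<delta>0"
          using gam_le_1 M \<delta>0 by (intro add_right_mono add_left_mono mult_right_mono) (auto simp: N_def)
        also have "\<dots> \<le> gam * (exp (- rate * \<Delta>) * A) + M"
        proof -
          have "1 * (v + d) + d = v + 2 * d" for v d :: real by simp
          then show ?thesis using N unfolding add.assoc by (simp only: add_le_cancel_left)
        qed
        also have "gam * (exp (- rate * \<Delta>) * A) = gam ^ Suc i * exp (- rate * ts (Suc i)) * VV (x (0, 0))"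
        proof -
          have "exp (- rate * ts (Suc i)) = exp (- rate * \<Delta>) * exp (- rate * ts i)"
            unfolding exp_add[symmetric] by (simp add: \<Delta>_def algebra_simps)
          then show ?thesis by (simp add: A_def)
        qed
        finally have "VV (x (ts (Suc i), Suc i)) \<le> gam ^ Suc i * exp (- rate * ts (Suc i)) * VV (x (0, 0)) + M" .
        moreover have "(real (Suc i) - 1) * dwell \<le> ts (Suc i)"
        proof (cases "i = 0")
          case True
          then show ?thesis using \<Delta> ts(1) by (simp add: \<Delta>_def)
        next
          case False
          have "(real i - 1) * dwell \<le> ts i" using IH by blast
          then show ?thesis using long False by (simp add: \<Delta>_def algebra_simps)
        qed
        ultimately show ?case using timer by simp
      qed
      have tsj: "ts j \<le> t" using ts(2) ts(3)[of j] by simp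
      have tsj0: "0 \<le> ts j" using ts(4)[of j "ts j"] ts(3)[of j] E by (auto simp: htd_def)
      have mj: "VV (x (ts j, j)) \<le> gam ^ j * exp (- rate * ts j) * VV (x (0, 0)) + M"
        using main[of j] M \<delta>0 by (auto split: if_splits)
      have "gam ^ j * exp (- rate * ts j) * VV (x (0, 0)) \<le> 1 * B"
      proof (intro mult_mono V0)
        have "exp (- rate * ts j) \<le> 1" using rate_pos tsj0 by simp
        then show "gam ^ j * exp (- rate * ts j) \<le> 1"
          using gam_pos gam_le_1 by (intro mult_le_one power_le_one) auto
      qed (use V_nonneg in auto)
      then have "VV (x (ts j, j)) \<le> B + 1" using mj M \<delta>0 by linarith
      then have "VV (x (t, j)) \<le> exp (- rate * (t - ts j)) * VV (x (ts j, j)) + \<delta>0"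
        using flow[of j t] ts(2) tsj by auto
      also have "\<dots> \<le> exp (- rate * (t - ts j)) * (gam ^ j * exp (- rate * ts j) * VV (x (0, 0)) + M) + \<delta>0"
        using mj by (intro add_right_mono mult_left_mono) auto
      also have "\<dots> \<le> gam ^ j * exp (- rate * t) * VV (x (0, 0)) + M + \<delta>0"
      proof -
        have "exp (- rate * t) = exp (- rate * (t - ts j)) * exp (- rate * ts j)"
          unfolding exp_add[symmetric] by (simp add: algebra_simps)
        moreover have "exp (- rate * (t - ts j)) * M \<le> 1 * M"
          using rate_pos tsj M \<delta>0 by (intro mult_right_mono) auto
        ultimately show ?thesis by (simp add: distrib_left mult_ac)
      qed
      finally show "VV (x (t, j)) \<le> gam ^ j * exp (- rate * t) * VV (x (0, 0)) + \<delta>" using M by linarith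
      show "(real j - 1) * dwell \<le> t" using main[of j] tsj by linarith
    qed
  qed
qed

end

section \<open>Local existence of flows\<close>

text \<open>Banach's fixed point theorem in the space of bounded continuous functions on the whole
  line. The clamp \<open>cl\<close> freezes time outside [t0, t0 + h], so that the integral operator
  acts on this space.\<close>

lemma picard_local:
  fixes F :: "'s::euclidean_space \<Rightarrow> 's" and c t0 :: real
  assumes lip: "K-lipschitz_on (cball x0 r) F" and r: "r > 0" and c: "c > 0"
  obtains h x where "h > 0" "h \<le> c" "continuous_on {t0..t0 + h} x"
    "\<And>t. t \<in> {t0..t0 + h} \<Longrightarrow> x t \<in> cball x0 r \<and> x t = x0 + integral {t0..t} (\<lambda>s. F (x s))"
proof -
  have K: "K \<ge> 0" using lip by (rule lipschitz_on_nonneg)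
  define M where "M = norm (F x0) + K * r"
  have M: "M \<ge> 0" using K r by (simp add: M_def)
  have bound: "norm (F y) \<le> M" if "y \<in> cball x0 r" for y
  proof -
    have "dist (F y) (F x0) \<le> K * dist y x0" using lipschitz_onD[OF lip that, of x0] r by simp
    also have "\<dots> \<le> K * r" using that K by (intro mult_left_mono) (auto simp: dist_commute)
    finally have "norm (F y - F x0) \<le> K * r" by (simp add: dist_norm)
    then show ?thesis using norm_triangle_sub[of "F y" "F x0"] by (simp add: M_def)
  qed
  \<comment> \<open>The bound r / (M + 1) keeps the iterates in the ball, and 1 / (2 (K + 1)) makes
    the operator a contraction with factor 1/2.\<close>
  define h where "h = min c (min (r / (M + 1)) (1 / (2 * (K + 1))))"
  have h: "h > 0" "h \<le> c" "M * h \<le> r" "h * K \<le> 1 / 2"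
  proof -
    show h0: "h > 0" "h \<le> c" using r c M K by (auto simp: h_def)
    have "h \<le> r / (M + 1)" "h \<le> 1 / (2 * (K + 1))" by (auto simp: h_def)
    then have "h * (M + 1) \<le> r" "h * (2 * (K + 1)) \<le> 1" using M K by (simp_all add: field_simps)
    then show "M * h \<le> r" "h * K \<le> 1 / 2" using h0 by (simp_all add: algebra_simps)
  qed
  define cl where "cl t = max t0 (min (t0 + h) t)" for t :: real
  have cl: "cl t \<in> {t0..t0 + h}" for t using h by (auto simp: cl_def)
  define S where "S = PiC (UNIV :: real set) (\<lambda>_. cball x0 r)"
  have S: "f \<in> S \<longleftrightarrow> (\<forall>t. apply_bcontfun f t \<in> cball x0 r)" for f by (auto simp: S_def mem_PiC_iff)
  have Fcont: "continuous_on A (\<lambda>s. F (apply_bcontfun f s))" if "f \<in> S" for f A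
    by (rule continuous_on_compose2[OF lipschitz_on_continuous_on[OF lip]]) (use that S in auto)
  have Fint: "(\<lambda>s. F (apply_bcontfun f s)) integrable_on {a..b}" if "f \<in> S" for f a b
    by (rule integrable_continuous_real[OF Fcont[OF that]])
  define g where "g f t = x0 + integral {t0..cl t} (\<lambda>s. F (apply_bcontfun f s))" for f t
  have g_ball: "g f t \<in> cball x0 r" if f: "f \<in> S" for f t
  proof -
    have "norm (integral {t0..cl t} (\<lambda>s. F (apply_bcontfun f s))) \<le> integral {t0..cl t} (\<lambda>s. M)"
      by (rule integral_norm_bound_integral[OF Fint[OF f]]) (use bound f S in auto)
    also have "\<dots> = M * (cl t - t0)" using cl[of t] by simp
    also have "\<dots> \<le> M * h" using cl[of t] M by (intro mult_left_mono) auto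
    finally show ?thesis using h by (simp add: g_def dist_norm)
  qed
  have g_bcont: "g f \<in> bcontfun" if f: "f \<in> S" for f
  proof (rule bcontfun_normI)
    have "continuous_on {t0..t0 + h} (\<lambda>u. integral {t0..u} (\<lambda>s. F (apply_bcontfun f s)))"
      by (rule indefinite_integral_continuous_1[OF Fint[OF f]])
    moreover have "continuous_on UNIV cl" unfolding cl_def by (intro continuous_intros)
    ultimately have "continuous_on UNIV (\<lambda>t. integral {t0..cl t} (\<lambda>s. F (apply_bcontfun f s)))"
      by (rule continuous_on_compose2) (use cl in auto)
    then show "continuous_on UNIV (g f)" unfolding g_def by (intro continuous_intros)
    show "norm (g f t) \<le> norm x0 + r" for t
      using g_ball[OF f, of t] norm_triangle_sub[of "g f t" x0] by (simp add: dist_norm norm_minus_commute)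
  qed
  define P where "P f = Bcontfun (g f)" for f
  have P: "apply_bcontfun (P f) = g f" if "f \<in> S" for f
    unfolding P_def by (rule Bcontfun_inverse[OF g_bcont[OF that]])
  have "\<exists>!f. f \<in> S \<and> P f = f"
  proof (rule Banach_fix[where c = "1 / 2"])
    show "complete S" unfolding S_def by (intro complete_eq_closed[THEN iffD2] closed_PiC) auto
    have "const_bcontfun x0 \<in> S" using r by (simp add: S)
    then show "S \<noteq> {}" by blast
    show "P ` S \<subseteq> S" using g_ball P by (auto simp: S)
    show "dist (P f1) (P f2) \<le> 1 / 2 * dist f1 f2" if f: "f1 \<in> S" "f2 \<in> S" for f1 f2
    proof (rule dist_bound)
      fix t
      have "norm (integral {t0..cl t} (\<lambda>s. F (apply_bcontfun f1 s) - F (apply_bcontfun f2 s)))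
         \<le> integral {t0..cl t} (\<lambda>s. K * dist f1 f2)"
      proof (rule integral_norm_bound_integral)
        fix s
        have "dist (F (apply_bcontfun f1 s)) (F (apply_bcontfun f2 s)) \<le> K * dist (apply_bcontfun f1 s) (apply_bcontfun f2 s)"
          using f S by (intro lipschitz_onD[OF lip]) auto
        also have "\<dots> \<le> K * dist f1 f2" using K by (intro mult_left_mono dist_bounded) auto
        finally show "norm (F (apply_bcontfun f1 s) - F (apply_bcontfun f2 s)) \<le> K * dist f1 f2" by (simp add: dist_norm)
      qed (use f in \<open>auto intro!: integrable_diff Fint\<close>)
      also have "\<dots> = (cl t - t0) * K * dist f1 f2" using cl[of t] by simp
      also have "\<dots> \<le> 1 / 2 * dist f1 f2"
      proof (rule mult_right_mono)
        have "(cl t - t0) * K \<le> h * K" using cl[of t] K by (intro mult_right_mono) auto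
        then show "(cl t - t0) * K \<le> 1 / 2" using h by linarith
      qed simp
      finally show "dist (apply_bcontfun (P f1) t) (apply_bcontfun (P f2) t) \<le> 1 / 2 * dist f1 f2"
        using f by (simp add: P g_def dist_norm integral_diff Fint)
    qed
  qed auto
  then obtain f where f: "f \<in> S" "P f = f" by blast
  show ?thesis
  proof (rule that[of h "apply_bcontfun f"])
    fix t assume t: "t \<in> {t0..t0 + h}"
    then have "cl t = t" by (auto simp: cl_def)
    moreover have "apply_bcontfun f t = g f t" using P[OF f(1)] f(2) by simp
    ultimately have "apply_bcontfun f t = x0 + integral {t0..t} (\<lambda>s. F (apply_bcontfun f s))" by (simp add: g_def)
    moreover have "apply_bcontfun f t \<in> cball x0 r" using f(1) S by blast
    ultimately show "apply_bcontfun f t \<in> cball x0 r \<and> apply_bcontfun f t = x0 + integral {t0..t} (\<lambda>s. F (apply_bcontfun f s))"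
      by (rule conjI[rotated])
  qed (use h in auto)
qed

section \<open>Calculus of bounded Lipschitz maps\<close>

definition lip_bounded :: "'a::metric_space set \<Rightarrow> ('a \<Rightarrow> 'b::real_normed_vector) \<Rightarrow> bool" where
  "lip_bounded S f \<longleftrightarrow> (\<exists>K B. K-lipschitz_on S f \<and> (\<forall>x\<in>S. norm (f x) \<le> B))"

lemma lip_bounded_linear:
  assumes "bounded_linear h" "lip_bounded S f"
  shows "lip_bounded S (\<lambda>x. h (f x))"
proof -
  obtain K B where KB: "K-lipschitz_on S f" "\<And>x. x \<in> S \<Longrightarrow> norm (f x) \<le> B" using assms(2) by (auto simp: lip_bounded_def)
  obtain H where H: "H \<ge> 0" "\<And>x. norm (h x) \<le> norm x * H" using bounded_linear.nonneg_bounded[OF assms(1)] by blast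
  have "(H * K)-lipschitz_on S (\<lambda>x. h (f x))"
  proof (rule lipschitz_onI)
    fix x y assume xy: "x \<in> S" "y \<in> S"
    have "dist (h (f x)) (h (f y)) \<le> dist (f x) (f y) * H"
      using H(2)[of "f x - f y"] by (simp add: dist_norm linear_diff[OF bounded_linear.linear[OF assms(1)]])
    also have "\<dots> \<le> (K * dist x y) * H" using lipschitz_onD[OF KB(1) xy] H by (intro mult_right_mono) auto
    finally show "dist (h (f x)) (h (f y)) \<le> H * K * dist x y" by (simp add: mult_ac)
  qed (use H lipschitz_on_nonneg[OF KB(1)] in auto)
  moreover have "norm (h (f x)) \<le> B * H" if "x \<in> S" for x
    using H(2)[of "f x"] mult_right_mono[OF KB(2)[OF that] H(1)] by linarith
  ultimately show ?thesis unfolding lip_bounded_def by blast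
qed

lemma lip_bounded_id: "bounded S \<Longrightarrow> lip_bounded S (\<lambda>x. x)"
  unfolding lip_bounded_def bounded_iff using lipschitz_on_id by blast

lemma lip_bounded_const: "lip_bounded S (\<lambda>x. c)"
  unfolding lip_bounded_def using lipschitz_on_constant by blast

lemma lip_bounded_add:
  assumes "lip_bounded S f" "lip_bounded S g"
  shows "lip_bounded S (\<lambda>x. f x + g x)"
proof -
  obtain K B where KB: "K-lipschitz_on S f" "\<And>x. x \<in> S \<Longrightarrow> norm (f x) \<le> B" using assms by (auto simp: lip_bounded_def)
  obtain K' B' where KB': "K'-lipschitz_on S g" "\<And>x. x \<in> S \<Longrightarrow> norm (g x) \<le> B'" using assms by (auto simp: lip_bounded_def)
  have "norm (f x + g x) \<le> B + B'" if "x \<in> S" for x using KB(2)[OF that] KB'(2)[OF that] by (rule norm_triangle_mono)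
  then show ?thesis unfolding lip_bounded_def using lipschitz_on_add[OF KB(1) KB'(1)] by blast
qed

text \<open>The Lipschitz constant of a product involves the sizes of both factors, which is why
  \<open>lip_bounded\<close> carries a bound as well.\<close>

lemma lip_bounded_scaleR:
  assumes "lip_bounded S f" "lip_bounded S g"
  shows "lip_bounded S (\<lambda>x. f x *\<^sub>R g x)"
proof -
  obtain K B where KB: "K-lipschitz_on S f" "\<And>x. x \<in> S \<Longrightarrow> norm (f x) \<le> B" using assms by (auto simp: lip_bounded_def)
  obtain K' B' where KB': "K'-lipschitz_on S g" "\<And>x. x \<in> S \<Longrightarrow> norm (g x) \<le> B'" using assms by (auto simp: lip_bounded_def)
  have K0: "K \<ge> 0" "K' \<ge> 0" using lipschitz_on_nonneg KB(1) KB'(1) by blast+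
  have "(K * \<bar>B'\<bar> + \<bar>B\<bar> * K')-lipschitz_on S (\<lambda>x. f x *\<^sub>R g x)"
  proof (rule lipschitz_onI)
    fix x y assume xy: "x \<in> S" "y \<in> S"
    have "f x *\<^sub>R g x - f y *\<^sub>R g y = (f x - f y) *\<^sub>R g x + f y *\<^sub>R (g x - g y)" by (simp add: algebra_simps)
    then have "dist (f x *\<^sub>R g x) (f y *\<^sub>R g y) \<le> norm ((f x - f y) *\<^sub>R g x) + norm (f y *\<^sub>R (g x - g y))"
      unfolding dist_norm by (simp only: norm_triangle_ineq)
    also have "\<dots> = dist (f x) (f y) * norm (g x) + norm (f y) * dist (g x) (g y)" by (simp add: dist_norm)
    also have "\<dots> \<le> (K * dist x y) * \<bar>B'\<bar> + \<bar>B\<bar> * (K' * dist x y)"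
      using lipschitz_onD[OF KB(1) xy] lipschitz_onD[OF KB'(1) xy] KB(2)[OF xy(2)] KB'(2)[OF xy(1)] K0
      by (intro add_mono mult_mono) auto
    finally show "dist (f x *\<^sub>R g x) (f y *\<^sub>R g y) \<le> (K * \<bar>B'\<bar> + \<bar>B\<bar> * K') * dist x y" by (simp add: algebra_simps)
  qed (use K0 in auto)
  moreover have "norm (f x *\<^sub>R g x) \<le> \<bar>B\<bar> * \<bar>B'\<bar>" if "x \<in> S" for x
    unfolding norm_scaleR using KB(2)[OF that] KB'(2)[OF that] by (intro mult_mono) auto
  ultimately show ?thesis unfolding lip_bounded_def by blast
qed

lemma lip_bounded_Pair:
  assumes "lip_bounded S f" "lip_bounded S g"
  shows "lip_bounded S (\<lambda>x. (f x, g x))"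
proof -
  have "bounded_linear (\<lambda>u. (u, 0))" "bounded_linear (\<lambda>v. (0, v))"
    by (auto intro!: bounded_linear_Pair bounded_linear_ident bounded_linear_zero)
  from lip_bounded_add[OF lip_bounded_linear[OF this(1) assms(1)] lip_bounded_linear[OF this(2) assms(2)]]
  show ?thesis by simp
qed

lemma lip_bounded_divide:
  assumes "lip_bounded S f" "c > 0" "\<And>x. x \<in> S \<Longrightarrow> f x \<ge> c"
  shows "lip_bounded S (\<lambda>x. b / f x :: real)"
proof -
  obtain K B where KB: "K-lipschitz_on S f" "\<And>x. x \<in> S \<Longrightarrow> norm (f x) \<le> B" using assms by (auto simp: lip_bounded_def)
  have K0: "K \<ge> 0" using lipschitz_on_nonneg KB(1) by blast
  have "(\<bar>b\<bar> * K / c\<^sup>2)-lipschitz_on S (\<lambda>x. b / f x)"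
  proof (rule lipschitz_onI)
    fix x y assume xy: "x \<in> S" "y \<in> S"
    have f: "f x \<ge> c" "f y \<ge> c" using assms(3) xy by auto
    have "b / f x - b / f y = b * (f y - f x) / (f x * f y)" using f \<open>c > 0\<close> by (simp add: field_simps)
    then have "dist (b / f x) (b / f y) = \<bar>b\<bar> * dist (f x) (f y) / (f x * f y)"
      using f \<open>c > 0\<close> by (simp add: dist_real_def abs_mult abs_divide abs_minus_commute)
    also have "\<dots> \<le> \<bar>b\<bar> * (K * dist x y) / (c * c)"
      using f \<open>c > 0\<close> lipschitz_onD[OF KB(1) xy] K0 by (intro frac_le mult_mono) auto
    finally show "dist (b / f x) (b / f y) \<le> \<bar>b\<bar> * K / c\<^sup>2 * dist x y" by (simp add: power2_eq_square)
  qed (use K0 in auto)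
  moreover have "norm (b / f x) \<le> \<bar>b\<bar> / c" if "x \<in> S" for x
    using assms(3)[OF that] \<open>c > 0\<close> by (auto intro!: frac_le)
  ultimately show ?thesis unfolding lip_bounded_def by blast
qed

context hybrid_momentum
begin

text \<open>\<phi> grows quadratically, so a bounded argument is essential. In 3 L B1 the gradient
  contributes L B1, and the quadratic error contributes 2 L B1 because two arguments differ by at
  most 2 B1.\<close>

lemma lip_bounded_phi:
  assumes "lip_bounded S f"
  shows "lip_bounded S (\<lambda>x. \<phi> (f x))"
proof -
  obtain K B where KB: "K-lipschitz_on S f" "\<And>x. x \<in> S \<Longrightarrow> norm (f x) \<le> B" using assms by (auto simp: lip_bounded_def)
  have K0: "K \<ge> 0" using lipschitz_on_nonneg KB(1) by blast
  define B1 where "B1 = \<bar>B\<bar> + norm zs"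
  have B1: "norm (f x - zs) \<le> B1" "norm (f x) \<le> B1" if "x \<in> S" for x
    using KB(2)[OF that] norm_triangle_ineq4[of "f x" zs] norm_ge_zero[of zs] abs_ge_self[of B]
    unfolding B1_def by linarith+
  have lipphi: "\<bar>\<phi> (f x) - \<phi> (f y)\<bar> \<le> (3 * L * B1) * norm (f x - f y)" if xy: "x \<in> S" "y \<in> S" for x y
  proof -
    define u where "u = f x - f y"
    have "\<bar>\<phi> (f x) - \<phi> (f y) - grad (f y) \<bullet> u\<bar> \<le> L * (norm u)\<^sup>2"
      using first_order_error[of "f y" u] by (simp add: u_def)
    moreover have "\<bar>grad (f y) \<bullet> u\<bar> \<le> (L * B1) * norm u"
    proof -
      have "norm (grad (f y)) \<le> L * B1"
        using norm_grad_le[of "f y"] mult_left_mono[OF B1(1)[OF xy(2)], of L] L_pos by linarith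
      then show ?thesis using Cauchy_Schwarz_ineq2[of "grad (f y)" u] mult_right_mono[of _ _ "norm u"] by (meson norm_ge_zero order_trans)
    qed
    moreover have "L * (norm u)\<^sup>2 \<le> (2 * L * B1) * norm u"
    proof -
      have "norm u \<le> 2 * B1" using norm_triangle_ineq4[of "f x" "f y"] B1(2)[OF xy(1)] B1(2)[OF xy(2)] unfolding u_def by linarith
      then have "L * norm u * norm u \<le> L * (2 * B1) * norm u" using L_pos by (intro mult_right_mono mult_left_mono) auto
      then show ?thesis by (simp add: power2_eq_square mult_ac)
    qed
    ultimately show ?thesis unfolding u_def[symmetric] by linarith
  qed
  show ?thesis
  proof (cases "S = {}")
    case True
    then show ?thesis by (auto simp: lip_bounded_def intro!: exI[of _ 0])
  next
    case False
    then have B1nn: "B1 \<ge> 0" by (simp add: B1_def)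
    have "(3 * L * B1 * K)-lipschitz_on S (\<lambda>x. \<phi> (f x))"
    proof (rule lipschitz_onI)
      fix x y assume xy: "x \<in> S" "y \<in> S"
      have "dist (\<phi> (f x)) (\<phi> (f y)) \<le> (3 * L * B1) * dist (f x) (f y)"
        using lipphi[OF xy] by (simp add: dist_norm)
      also have "\<dots> \<le> (3 * L * B1) * (K * dist x y)"
        using lipschitz_onD[OF KB(1) xy] L_pos B1nn by (intro mult_left_mono) auto
      finally show "dist (\<phi> (f x)) (\<phi> (f y)) \<le> 3 * L * B1 * K * dist x y" by (simp add: mult_ac)
    qed (use L_pos B1nn K0 in auto)
    moreover have "norm (\<phi> (f x)) \<le> \<bar>\<phi> zs\<bar> + L * B1\<^sup>2" if "x \<in> S" for x
    proof -
      have "L * (norm (f x - zs))\<^sup>2 \<le> L * B1\<^sup>2" using B1(1)[OF that] L_pos by (intro mult_left_mono power_mono) auto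
      then show ?thesis using gap_upper[of "f x"] gap_nonneg[of "f x"] unfolding real_norm_def by linarith
    qed
    ultimately show ?thesis unfolding lip_bounded_def by blast
  qed
qed

lemma flow_map_locally_lipschitz:
  assumes "fst (snd (snd p)) > 0"
  obtains r K where "r > 0" "K-lipschitz_on (cball p r) (flow_map \<phi> \<kappa> k a \<epsilon>)"
proof -
  \<comment> \<open>Half the timer value keeps 2/\<tau> away from its singularity on the whole
    ball.\<close>
  define r where "r = fst (snd (snd p)) / 2"
  have r: "r > 0" using assms by (simp add: r_def)
  let ?S = "cball p r"
  have low: "r \<le> fst (snd (snd x))" if "x \<in> ?S" for x
  proof -
    have "\<bar>fst (snd (snd p)) - fst (snd (snd x))\<bar> \<le> r"
      using hstate_component_norms(3)[of "p - x"] that by (simp add: dist_norm)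
    then show ?thesis unfolding r_def by linarith
  qed
  note id = lip_bounded_id[OF bounded_cball[of p r]]
  note fs = lip_bounded_linear[OF bounded_linear_fst] and sn = lip_bounded_linear[OF bounded_linear_snd]
  note c1 = fs[OF id] and c2 = fs[OF sn[OF id]] and c3 = fs[OF sn[OF sn[OF id]]]
    and c4 = fs[OF sn[OF sn[OF sn[OF id]]]] and c5 = sn[OF sn[OF sn[OF sn[OF id]]]]
  have "bounded_linear (\<lambda>v :: real^'n. \<chi> l. d l * v $ l)" for d
    unfolding linear_conv_bounded_linear[symmetric]
    by (rule linearI) (simp_all add: vec_eq_iff algebra_simps)
  note rot = lip_bounded_linear[OF this]
  have "lip_bounded ?S (\<lambda>x. ((2 / fst (snd (snd x))) *\<^sub>R (fst (snd x) + (- 1) *\<^sub>R fst x),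
     ((- (4 / a) * k) *\<^sub>R (fst (snd (snd x)) *\<^sub>R \<phi> (fst x + a *\<^sub>R fst (snd (snd (snd x)))))) *\<^sub>R fst (snd (snd (snd x))),
     1 / 2 :: real, \<chi> l. ((1 / \<epsilon>) * (2 * pi * \<kappa> l)) * snd (snd (snd (snd x))) $ l,
     \<chi> l. (- (1 / \<epsilon>) * (2 * pi * \<kappa> l)) * fst (snd (snd (snd x))) $ l))"
    by (intro lip_bounded_Pair lip_bounded_scaleR lip_bounded_add lip_bounded_const lip_bounded_phi
        c1 c2 c3 c4 c5 rot lip_bounded_divide[OF c3 r low])
  then have "lip_bounded ?S (flow_map \<phi> \<kappa> k a \<epsilon>)"
    by (rule back_subst[of "lip_bounded ?S"]) (auto simp: flow_map_def fun_eq_iff case_prod_unfold mult_ac)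
  then show ?thesis using that r by (auto simp: lip_bounded_def)
qed

text \<open>The Picard solution stays in the flow set because \<tau> - t/2 and the squared radii of
  all circles are constants of motion, and because h is capped by the time the timer needs to reach
  Tmax.\<close>

lemma local_flow:
  fixes t0 :: real
  assumes p: "p \<in> flow_set Tmin Tmax" and less: "fst (snd (snd p)) < Tmax"
  obtains h y where "h > 0" "continuous_on {t0..t0 + h} y"
    "\<And>t. t \<in> {t0..t0 + h} \<Longrightarrow> y t \<in> flow_set Tmin Tmax \<and> y t = p + integral {t0..t} (\<lambda>s. flow_map \<phi> \<kappa> k a \<epsilon> (y s))"
proof -
  let ?F = "flow_map \<phi> \<kappa> k a \<epsilon>"
  have \<tau>p: "fst (snd (snd p)) \<ge> Tmin" using p by (auto simp: flow_set_def)
  then obtain r K where r: "r > 0" "K-lipschitz_on (cball p r) ?F"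
    using flow_map_locally_lipschitz[of p a \<epsilon>] Tmin_pos by auto
  obtain h y where h: "h > 0" "h \<le> 2 * (Tmax - fst (snd (snd p)))" and cont: "continuous_on {t0..t0 + h} y"
    and y: "\<And>t. t \<in> {t0..t0 + h} \<Longrightarrow> y t \<in> cball p r \<and> y t = p + integral {t0..t} (\<lambda>s. ?F (y s))"
    using picard_local[OF r(2,1), of "2 * (Tmax - fst (snd (snd p)))" t0] less by auto
  have Fc: "continuous_on {t0..t0 + h} (\<lambda>t. ?F (y t))"
    by (rule continuous_on_compose2[OF lipschitz_on_continuous_on[OF r(2)] cont]) (use y in blast)
  have y0: "y t0 = p" using y[of t0] h by simp
  have dy: "(y has_vector_derivative ?F (y t)) (at t within {t0..t0 + h})" if t: "t \<in> {t0..t0 + h}" for t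
  proof -
    have "((\<lambda>t. p + integral {t0..t} (\<lambda>s. ?F (y s))) has_vector_derivative ?F (y t)) (at t within {t0..t0 + h})"
      using has_vector_derivative_add[OF has_vector_derivative_const integral_has_vector_derivative[OF Fc t]] by simp
    then show ?thesis by (rule has_vector_derivative_transform[rotated -1]) (use t y in auto)
  qed
  define \<tau> where "\<tau> t = fst (snd (snd (y t)))" for t
  define c where "c t = fst (snd (snd (snd (y t))))" for t
  define s where "s t = snd (snd (snd (snd (y t))))" for t
  note hs = bounded_linear.has_vector_derivative[OF bounded_linear_snd]
  note hf = bounded_linear.has_vector_derivative[OF bounded_linear_fst]
  have d\<tau>: "((\<lambda>t. \<tau> t - t / 2) has_real_derivative 0) (at t within {t0..t0 + h})" if t: "t \<in> {t0..t0 + h}" for t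
  proof -
    have "(\<tau> has_real_derivative 1 / 2) (at t within {t0..t0 + h})"
      using hf[OF hs[OF hs[OF dy[OF t]]]]
      by (simp add: \<tau>_def[abs_def] has_real_derivative_iff_has_vector_derivative flow_map_def case_prod_unfold)
    then show ?thesis by (auto intro!: derivative_eq_intros)
  qed
  have dcs: "((\<lambda>t. (c t $ l)\<^sup>2 + (s t $ l)\<^sup>2) has_real_derivative 0) (at t within {t0..t0 + h})" if t: "t \<in> {t0..t0 + h}" for t l
  proof -
    have "(c has_vector_derivative (\<chi> l. (1 / \<epsilon>) * (2 * pi * \<kappa> l) * s t $ l)) (at t within {t0..t0 + h})"
      using hf[OF hs[OF hs[OF hs[OF dy[OF t]]]]] by (simp add: c_def[abs_def] s_def flow_map_def case_prod_unfold)
    from has_real_derivative_vec_nth[OF this, of l]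
    have 1: "((\<lambda>t. c t $ l) has_real_derivative (1 / \<epsilon>) * (2 * pi * \<kappa> l) * s t $ l) (at t within {t0..t0 + h})" by simp
    have "(s has_vector_derivative (\<chi> l. - (1 / \<epsilon>) * (2 * pi * \<kappa> l) * c t $ l)) (at t within {t0..t0 + h})"
      using hs[OF hs[OF hs[OF hs[OF dy[OF t]]]]] by (simp add: c_def s_def[abs_def] flow_map_def case_prod_unfold)
    from has_real_derivative_vec_nth[OF this, of l]
    have 2: "((\<lambda>t. s t $ l) has_real_derivative - (1 / \<epsilon>) * (2 * pi * \<kappa> l) * c t $ l) (at t within {t0..t0 + h})" by simp
    show ?thesis by (rule derivative_eq_intros 1 2 refl)+ (simp add: algebra_simps)
  qed
  have "y t \<in> flow_set Tmin Tmax" if t: "t \<in> {t0..t0 + h}" for t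
  proof -
    have t0: "t0 \<in> {t0..t0 + h}" using h by simp
    obtain c1 where "\<And>u. u \<in> {t0..t0 + h} \<Longrightarrow> \<tau> u - u / 2 = c1"
      using has_field_derivative_zero_constant[OF _ d\<tau>] by (metis convex_real_interval(5))
    from this[OF t] this[OF t0] have tt: "\<tau> t = fst (snd (snd p)) + (t - t0) / 2" by (simp add: \<tau>_def y0 field_simps)
    have "(c t $ l)\<^sup>2 + (s t $ l)\<^sup>2 = 1" for l
    proof -
      obtain c2 where "\<And>u. u \<in> {t0..t0 + h} \<Longrightarrow> (c u $ l)\<^sup>2 + (s u $ l)\<^sup>2 = c2"
        using has_field_derivative_zero_constant[OF _ dcs[of _ l]] by (metis convex_real_interval(5))
      from this[OF t] this[OF t0] show ?thesis using p by (auto simp: flow_set_def torus_def c_def s_def y0)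
    qed
    moreover have "0 \<le> t - t0" "t - t0 \<le> h" using t by auto
    then have "Tmin \<le> \<tau> t" "\<tau> t \<le> Tmax" using tt \<tau>p h(2) by argo+
    ultimately show ?thesis by (auto simp: flow_set_def torus_def c_def s_def \<tau>_def case_prod_unfold)
  qed
  then show ?thesis using that[OF h(1) cont] y by blast
qed

end

section \<open>Completeness of bounded maximal solutions\<close>

lemma compact_htdI:
  assumes "ts 0 = 0" "\<And>i. i < J \<Longrightarrow> ts i \<le> ts (Suc i)"
    "\<And>s i. (s, i) \<in> E \<longleftrightarrow> i < J \<and> ts i \<le> s \<and> s \<le> ts (Suc i)"
  shows "compact_htd E"
  unfolding compact_htd_def using assms by (intro exI[of _ J] exI[of _ ts]) auto

lemma htd_interval:
  assumes E: "htd E" and "(t1, j) \<in> E" "(t, j) \<in> E" "t1 \<le> s" "s \<le> t"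
  shows "(s, j) \<in> E"
proof -
  obtain ts where ts: "ts (Suc j) = t" "\<And>i r. i \<le> j \<Longrightarrow> r \<in> {ts i..ts (Suc i)} \<Longrightarrow> (r, i) \<in> E"
    "\<And>i r. i \<le> j \<Longrightarrow> r \<le> t \<Longrightarrow> (r, i) \<in> E \<Longrightarrow> r \<in> {ts i..ts (Suc i)}"
    using htd_history[OF E assms(3)] by metis
  have "t1 \<in> {ts j..ts (Suc j)}" using assms by (intro ts(3)) auto
  then show ?thesis using assms by (intro ts(2)) (auto simp: ts(1))
qed

context hybrid_momentum
begin

abbreviation nominal :: "real \<Rightarrow> real \<Rightarrow> (real \<times> nat) set \<Rightarrow> (real \<times> nat \<Rightarrow> 'n hstate) \<Rightarrow> bool" where
  "nominal a \<epsilon> E x \<equiv> H_solution \<phi> \<kappa> k Tmin Tmax a \<epsilon> (\<lambda>_. 0) E x"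

lemma nominal_in_flow_set:
  assumes "nominal a \<epsilon> E x" "(t, j) \<in> E"
  shows "x (t, j) \<in> flow_set Tmin Tmax"
  using solution_near_flow_set[OF assms(1) _ Tmin_less assms(2), of 0] by auto

lemma nominal_integral:
  assumes "nominal a \<epsilon> E x" "(s, j) \<in> E" "(t, j) \<in> E" "s \<le> t"
  shows "(\<lambda>r. flow_map \<phi> \<kappa> k a \<epsilon> (x (r, j))) integrable_on {s..t}"
    and "x (t, j) - x (s, j) = integral {s..t} (\<lambda>r. flow_map \<phi> \<kappa> k a \<epsilon> (x (r, j)))"
  using solution_integral[OF assms(1)[unfolded H_solution_def] assms(2-4)] by simp_all

lemma nominal_timer:
  assumes "nominal a \<epsilon> E x" "(s, j) \<in> E" "(t, j) \<in> E" "s \<le> t"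
  shows "fst (snd (snd (x (t, j)))) - fst (snd (snd (x (s, j)))) = (t - s) / 2"
proof -
  let ?f = "\<lambda>r. flow_map \<phi> \<kappa> k a \<epsilon> (x (r, j))"
  define h :: "'n hstate \<Rightarrow> real" where "h p = fst (snd (snd p))" for p
  have h: "bounded_linear h"
    unfolding h_def[abs_def]
    by (intro bounded_linear_fst_comp bounded_linear_snd_comp bounded_linear_ident)
  have "h (x (t, j)) - h (x (s, j)) = h (integral {s..t} ?f)"
    unfolding nominal_integral(2)[OF assms, symmetric] by (simp add: h_def)
  also have "\<dots> = integral {s..t} (h \<circ> ?f)"
    by (rule integral_linear[OF nominal_integral(1)[OF assms] h, symmetric])
  also have "h \<circ> ?f = (\<lambda>r. 1 / 2)" by (simp add: fun_eq_iff h_def flow_map_def case_prod_unfold)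
  finally show ?thesis using assms(4) by (simp add: h_def)
qed

text \<open>At a jump the timer equals Tmax, so continuing to flow on the level that was left would
  push it above Tmax. This excludes for nominal solutions the branching domains that
  \<open>htd\<close> permits.\<close>

lemma nominal_no_branch:
  assumes sol: "nominal a \<epsilon> E x" and TJ: "(T, J) \<in> E" and si: "(s, i) \<in> E" "i < J"
  shows "s \<le> T"
proof (rule ccontr)
  assume "\<not> s \<le> T"
  note S' = sol[unfolded H_solution_def is_solution_def]
  have E: "htd E" using S' by blast
  obtain ts where ts: "ts (Suc J) = T" "\<And>i. i \<le> J \<Longrightarrow> ts i \<le> ts (Suc i)"
    "\<And>i r. i \<le> J \<Longrightarrow> r \<in> {ts i..ts (Suc i)} \<Longrightarrow> (r, i) \<in> E"
    "\<And>i r. i \<le> J \<Longrightarrow> r \<le> T \<Longrightarrow> (r, i) \<in> E \<Longrightarrow> r \<in> {ts i..ts (Suc i)}"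
    using htd_history[OF E TJ] by metis
  define u where "u = ts (Suc i)"
  have inE: "(u, i) \<in> E" "(u, Suc i) \<in> E"
    using ts(2)[of i] ts(2)[of "Suc i"] ts(3)[of i u] ts(3)[of "Suc i" u] si(2) by (auto simp: u_def)
  have "u \<le> T"
  proof -
    have "m \<le> Suc J \<Longrightarrow> Suc i \<le> m \<Longrightarrow> u \<le> ts m" for m
    proof (induction m)
      case (Suc m)
      then show ?case using ts(2)[of m] by (cases "m = i") (auto simp: u_def)
    qed simp
    from this[of "Suc J"] show ?thesis using si(2) ts(1) by simp
  qed
  then have "u < s" using \<open>\<not> s \<le> T\<close> by simp
  have "x (u, i) + 0 \<in> jump_set Tmax" using S' inE by blast
  then have "fst (snd (snd (x (u, i)))) = Tmax" by (auto simp: jump_set_def)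
  moreover have "fst (snd (snd (x (s, i)))) - fst (snd (snd (x (u, i)))) = (s - u) / 2"
    using \<open>u < s\<close> by (intro nominal_timer[OF sol inE(1) si(1)]) auto
  moreover have "fst (snd (snd (x (s, i)))) \<le> Tmax"
    using nominal_in_flow_set[OF sol si(1)] by (auto simp: flow_set_def)
  ultimately show False using \<open>u < s\<close> by argo
qed

lemma continuous_on_flow_map_flow_set: "continuous_on (flow_set Tmin Tmax) (flow_map \<phi> \<kappa> k a \<epsilon>)"
  using Tmin_pos by (intro continuous_on_flow_map) (auto simp: flow_set_def)

text \<open>The last interval is replaced by a longer curve z that agrees with x where x is defined.
  The same lemma serves to close this interval at its supremum and to flow beyond it.\<close>

lemma extend_by_flow:
  assumes sol: "nominal a \<epsilon> E x" and t1: "(t1, J) \<in> E" and top: "\<And>s i. (s, i) \<in> E \<Longrightarrow> i \<le> J"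
    and IJ: "\<And>s. (s, J) \<in> E \<Longrightarrow> t1 \<le> s \<and> s \<le> T"
    and z_cont: "continuous_on {t1..T} z" and zC: "\<And>s. s \<in> {t1..T} \<Longrightarrow> z s \<in> flow_set Tmin Tmax"
    and z_int: "\<And>s. s \<in> {t1..T} \<Longrightarrow> z s = z t1 + integral {t1..s} (\<lambda>r. flow_map \<phi> \<kappa> k a \<epsilon> (z r))"
    and zx: "\<And>s. (s, J) \<in> E \<Longrightarrow> z s = x (s, J)"
  shows "nominal a \<epsilon> (E \<union> {t1..T} \<times> {J}) (\<lambda>p. if snd p = J then z (fst p) else x p)"
proof -
  let ?F = "flow_map \<phi> \<kappa> k a \<epsilon>"
  define E' where "E' = E \<union> {t1..T} \<times> {J}"
  define x' where "x' p = (if snd p = J then z (fst p) else x p)" for p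
  note S' = sol[unfolded H_solution_def is_solution_def]
  have E: "htd E" using S' by blast
  have agree: "x' p = x p" if "p \<in> E" for p using that zx by (cases p) (auto simp: x'_def)
  have E'J: "(s, J) \<in> E' \<longleftrightarrow> s \<in> {t1..T}" for s using IJ by (auto simp: E'_def)
  have E'n: "(s, i) \<in> E' \<longleftrightarrow> (s, i) \<in> E" if "i \<noteq> J" for s i using that by (auto simp: E'_def)
  have in_C: "x' p \<in> flow_set Tmin Tmax" if "p \<in> E'" for p
  proof (cases "snd p = J")
    case True
    then show ?thesis using that zC E'J by (cases p) (auto simp: x'_def)
  next
    case False
    then show ?thesis using that nominal_in_flow_set[OF sol] E'n by (cases p) (auto simp: x'_def)
  qed
  obtain ts where ts: "ts 0 = 0" "ts (Suc J) = t1" "\<And>i. i \<le> J \<Longrightarrow> ts i \<le> ts (Suc i)"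
    "\<And>i r. i \<le> J \<Longrightarrow> r \<in> {ts i..ts (Suc i)} \<Longrightarrow> (r, i) \<in> E"
    "\<And>i r. i \<le> J \<Longrightarrow> r \<le> t1 \<Longrightarrow> (r, i) \<in> E \<Longrightarrow> r \<in> {ts i..ts (Suc i)}"
    using htd_history[OF E t1] by metis
  have tsJ: "ts J = t1" using ts(4)[of J "ts J"] ts(3)[of J] IJ[of "ts J"] ts(2) by auto
  have t10: "t1 \<ge> 0" using E t1 by (auto simp: htd_def)
  have E0: "s \<ge> 0" if "(s, i) \<in> E" for s i using E that by (auto simp: htd_def)
  have htd': "htd E'"
    unfolding htd_def
  proof (intro conjI allI impI)
    show "E' \<subseteq> {0..} \<times> UNIV" using E t10 by (auto simp: htd_def E'_def)
    fix T' J' assume TJ: "(T', J') \<in> E'"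
    show "compact_htd (E' \<inter> {0..T'} \<times> {0..J'})"
    proof (cases "J' = J")
      case False
      then have "(T', J') \<in> E" "J' < J" using TJ E'n top[of T' J'] by auto
      then have "E' \<inter> {0..T'} \<times> {0..J'} = E \<inter> {0..T'} \<times> {0..J'}" by (auto simp: E'_def)
      then show ?thesis using E \<open>(T', J') \<in> E\<close> by (auto simp: htd_def)
    next
      case True
      then have T': "T' \<in> {t1..T}" using TJ E'J by simp
      \<comment> \<open>The jump times of the history of t1, with the end of the last interval moved
        to T'.\<close>
      define us where "us = ts(Suc J := T')"
      show ?thesis
      proof (rule compact_htdI[of us "Suc J"])
        show "us 0 = 0" using ts(1) by (simp add: us_def)
        show "us i \<le> us (Suc i)" if "i < Suc J" for i
          using that ts(3)[of i] tsJ T' by (auto simp: us_def)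
        fix s i
        show "(s, i) \<in> E' \<inter> {0..T'} \<times> {0..J'} \<longleftrightarrow> i < Suc J \<and> us i \<le> s \<and> s \<le> us (Suc i)"
        proof (cases "i = J")
          case True
          then have "(s, i) \<in> E' \<longleftrightarrow> t1 \<le> s \<and> s \<le> T" "us i = t1" "us (Suc i) = T'"
            using E'J[of s] tsJ by (simp_all add: us_def)
          moreover have "i < Suc J" "i \<le> J'" using True \<open>J' = J\<close> by simp_all
          moreover have "t1 \<le> T'" "T' \<le> T" using T' by auto
          ultimately show ?thesis using t10 by fastforce
        next
          case False
          have mono: "ts (Suc i) \<le> t1" if "i < J"
          proof -
            have "m \<le> J \<Longrightarrow> Suc i \<le> m \<Longrightarrow> ts (Suc i) \<le> ts m" for m
            proof (induction m)
              case (Suc m)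
              then show ?case using ts(3)[of m] by (cases "m = i") auto
            qed simp
            from this[of J] show ?thesis using that tsJ by simp
          qed
          have "(s, i) \<in> E \<and> i < J \<longleftrightarrow> i < J \<and> ts i \<le> s \<and> s \<le> ts (Suc i)"
            using ts(4)[of i s] ts(5)[of i s] nominal_no_branch[OF sol t1, of s i] by auto
          moreover have "s \<le> T'" if "(s, i) \<in> E" "i < J" using nominal_no_branch[OF sol t1 that] T' by simp
          ultimately show ?thesis using False E'n[of i s] E0[of s i] top[of s i] \<open>J' = J\<close> by (auto simp: us_def)
        qed
      qed
    qed
  qed
  have Fz: "continuous_on {t1..T} (\<lambda>r. ?F (z r))"
    by (rule continuous_on_compose2[OF continuous_on_flow_map_flow_set z_cont]) (use zC in blast)
  have "is_solution (flow_set Tmin Tmax) ?F (jump_set Tmax) (jump_map Tmin) (\<lambda>_. 0) E' x'"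
    unfolding is_solution_def
  proof (intro conjI allI impI ballI)
    show "htd E'" by (rule htd')
    show "(0, 0) \<in> E'" using S' by (simp add: E'_def)
    show "x' (0, 0) + 0 \<in> closure (flow_set Tmin Tmax) \<union> jump_set Tmax"
      using S' agree[of "(0, 0)"] by simp
    show "x' (t, j) + 0 \<in> flow_set Tmin Tmax" if "t \<in> interior {s. (s, j) \<in> E'}" for t j
      using in_C[of "(t, j)"] interior_subset that by auto
    fix j s t assume st: "(s, j) \<in> E'" "(t, j) \<in> E'" "s \<le> t"
    have *: "(\<lambda>r. ?F (x' (r, j))) absolutely_integrable_on {s..t} \<and>
      x' (t, j) - x' (s, j) = integral {s..t} (\<lambda>r. ?F (x' (r, j)))"
    proof (cases "j = J")
      case True
      then have m: "s \<in> {t1..T}" "t \<in> {t1..T}" using st E'J by auto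
      have "continuous_on {s..t} (\<lambda>r. ?F (z r))" using m by (intro continuous_on_subset[OF Fz]) auto
      then have "(\<lambda>r. ?F (z r)) absolutely_integrable_on {s..t}" by (rule absolutely_integrable_continuous_real)
      moreover have "integral {t1..s} (\<lambda>r. ?F (z r)) + integral {s..t} (\<lambda>r. ?F (z r)) = integral {t1..t} (\<lambda>r. ?F (z r))"
        by (rule Henstock_Kurzweil_Integration.integral_combine) (use m st(3) in \<open>auto intro!: integrable_continuous_real continuous_on_subset[OF Fz]\<close>)
      then have "z t - z s = integral {s..t} (\<lambda>r. ?F (z r))"
        using z_int[OF m(1)] z_int[OF m(2)] by (metis add_diff_cancel_left add_diff_cancel_left')
      ultimately show ?thesis using True by (simp add: x'_def)
    next
      case False
      then have "(s, j) \<in> E" "(t, j) \<in> E" using st E'n by auto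
      then have "(\<lambda>r. ?F (x (r, j))) absolutely_integrable_on {s..t} \<and> x (t, j) - x (s, j) = integral {s..t} (\<lambda>r. ?F (x (r, j)))"
        using S' st(3) by simp
      then show ?thesis using False by (simp add: x'_def)
    qed
    then show "(\<lambda>r. ?F (x' (r, j) + 0) + 0) absolutely_integrable_on {s..t}"
      "x' (t, j) - x' (s, j) = integral {s..t} (\<lambda>r. ?F (x' (r, j) + 0) + 0)" by auto
  next
    fix t j assume a: "(t, j) \<in> E'" "(t, Suc j) \<in> E'"
    have "Suc j \<le> J" using a(2) top[of t "Suc j"] by (auto simp: E'_def)
    then have jJ: "j < J" by simp
    have tj: "(t, j) \<in> E" using a E'n jJ by auto
    \<comment> \<open>The enlargement creates no new jump: the last level starts at t1, and by
      \<open>nominal_no_branch\<close> the preceding levels end no later than t1.\<close>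
    have "(t, Suc j) \<in> E"
    proof (cases "Suc j = J")
      case True
      then have "t = t1" using a E'J nominal_no_branch[OF sol t1 tj jJ] by auto
      then show ?thesis using t1 True by simp
    qed (use a E'n in auto)
    then show "x' (t, j) + 0 \<in> jump_set Tmax" "x' (t, Suc j) = jump_map Tmin (x' (t, j) + 0) + 0"
      using S' tj agree[of "(t, j)"] agree[of "(t, Suc j)"] by auto
  qed
  then show ?thesis unfolding H_solution_def E'_def x'_def .
qed

text \<open>The new level consists of the single time T, so its integral condition concerns a
  degenerate interval.\<close>

lemma extend_by_jump:
  assumes sol: "nominal a \<epsilon> E x" and T: "(T, J) \<in> E" and top: "\<And>s i. (s, i) \<in> E \<Longrightarrow> i \<le> J"
    and IJ: "\<And>s. (s, J) \<in> E \<Longrightarrow> s \<le> T" and D: "x (T, J) \<in> jump_set Tmax"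
  shows "nominal a \<epsilon> (insert (T, Suc J) E) (x((T, Suc J) := jump_map Tmin (x (T, J))))"
proof -
  let ?F = "flow_map \<phi> \<kappa> k a \<epsilon>"
  define E' where "E' = insert (T, Suc J) E"
  define x' where "x' = x((T, Suc J) := jump_map Tmin (x (T, J)))"
  note S' = sol[unfolded H_solution_def is_solution_def]
  have E: "htd E" using S' by blast
  have new: "(s, Suc J) \<notin> E" for s using top[of s "Suc J"] by auto
  have agree: "x' (s, i) = x (s, i)" if "i \<noteq> Suc J" for s i using that by (auto simp: x'_def)
  have E'n: "(s, i) \<in> E' \<longleftrightarrow> (s, i) \<in> E" if "i \<noteq> Suc J" for s i using that by (auto simp: E'_def)
  have E'J: "(s, Suc J) \<in> E' \<longleftrightarrow> s = T" for s using new by (auto simp: E'_def)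
  have in_C: "x' (s, i) \<in> flow_set Tmin Tmax" if "(s, i) \<in> E'" for s i
  proof (cases "i = Suc J")
    case True
    have "jump_map Tmin (x (T, J)) \<in> flow_set Tmin Tmax"
      using D Tmin_less by (auto simp: jump_set_def flow_set_def jump_map_def)
    then show ?thesis using that E'J True by (simp add: x'_def)
  next
    case False
    then show ?thesis using that E'n[OF False] nominal_in_flow_set[OF sol] agree by simp
  qed
  obtain ts where ts: "ts 0 = 0" "ts (Suc J) = T" "\<And>i. i \<le> J \<Longrightarrow> ts i \<le> ts (Suc i)"
    "\<And>i r. i \<le> J \<Longrightarrow> r \<in> {ts i..ts (Suc i)} \<Longrightarrow> (r, i) \<in> E"
    "\<And>i r. i \<le> J \<Longrightarrow> r \<le> T \<Longrightarrow> (r, i) \<in> E \<Longrightarrow> r \<in> {ts i..ts (Suc i)}"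
    using htd_history[OF E T] by metis
  have T0: "T \<ge> 0" and E0: "\<And>s i. (s, i) \<in> E \<Longrightarrow> s \<ge> 0" using E T by (auto simp: htd_def)
  have leT: "s \<le> T" if "(s, i) \<in> E" for s i
    using IJ[of s] top[OF that] nominal_no_branch[OF sol T that] that by (cases "i = J") auto
  have htd': "htd E'"
    unfolding htd_def
  proof (intro conjI allI impI)
    show "E' \<subseteq> {0..} \<times> UNIV" using E T0 by (auto simp: htd_def E'_def)
    fix T' J' assume TJ: "(T', J') \<in> E'"
    show "compact_htd (E' \<inter> {0..T'} \<times> {0..J'})"
    proof (cases "J' = Suc J")
      case False
      then have "(T', J') \<in> E" using TJ E'n by auto
      moreover from this have "E' \<inter> {0..T'} \<times> {0..J'} = E \<inter> {0..T'} \<times> {0..J'}"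
        using top[of T' J'] by (auto simp: E'_def)
      ultimately show ?thesis using E by (auto simp: htd_def)
    next
      case True
      then have T': "T' = T" using TJ E'J by simp
      define us where "us = ts(Suc (Suc J) := T)"
      show ?thesis
      proof (rule compact_htdI[of us "Suc (Suc J)"])
        show "us 0 = 0" using ts(1) by (simp add: us_def)
        show "us i \<le> us (Suc i)" if "i < Suc (Suc J)" for i
          using that ts(2) ts(3)[of i] by (auto simp: us_def less_Suc_eq)
        fix s i
        show "(s, i) \<in> E' \<inter> {0..T'} \<times> {0..J'} \<longleftrightarrow> i < Suc (Suc J) \<and> us i \<le> s \<and> s \<le> us (Suc i)"
        proof (cases "i = Suc J")
          case True
          then have "(s, i) \<in> E' \<longleftrightarrow> s = T" "us i = T" "us (Suc i) = T"
            using E'J[of s] ts(2) by (simp_all add: us_def)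
          moreover have "i < Suc (Suc J)" "i \<le> J'" using True \<open>J' = Suc J\<close> by simp_all
          ultimately show ?thesis using T0 T' by fastforce
        next
          case False
          have "(s, i) \<in> E \<longleftrightarrow> i \<le> J \<and> ts i \<le> s \<and> s \<le> ts (Suc i)"
            using ts(4)[of i s] ts(5)[of i s] top[of s i] leT[of s i] by auto
          moreover have "(s, i) \<in> E' \<inter> {0..T'} \<times> {0..J'} \<longleftrightarrow> (s, i) \<in> E"
            using E'n[OF False, of s] leT[of s i] E0[of s i] top[of s i] T' True by auto
          ultimately show ?thesis using False by (auto simp: us_def)
        qed
      qed
    qed
  qed
  have "is_solution (flow_set Tmin Tmax) ?F (jump_set Tmax) (jump_map Tmin) (\<lambda>_. 0) E' x'"
    unfolding is_solution_def
  proof (intro conjI allI impI ballI)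
    show "htd E'" by (rule htd')
    show "(0, 0) \<in> E'" using S' by (simp add: E'_def)
    show "x' (0, 0) + 0 \<in> closure (flow_set Tmin Tmax) \<union> jump_set Tmax"
      using S' agree[of 0 0] by simp
    show "x' (t, j) + 0 \<in> flow_set Tmin Tmax" if "t \<in> interior {s. (s, j) \<in> E'}" for t j
      using in_C[of t j] interior_subset that by auto
    fix j s t assume st: "(s, j) \<in> E'" "(t, j) \<in> E'" "s \<le> t"
    have *: "(\<lambda>r. ?F (x' (r, j))) absolutely_integrable_on {s..t} \<and>
      x' (t, j) - x' (s, j) = integral {s..t} (\<lambda>r. ?F (x' (r, j)))"
    proof (cases "j = Suc J")
      case True
      then have m: "s = T" "t = T" using st E'J by auto
      have "(\<lambda>r. ?F (x' (r, j))) absolutely_integrable_on {T..T}"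
        by (rule absolutely_integrable_continuous_real) simp
      then show ?thesis using m by simp
    next
      case False
      then have "(s, j) \<in> E" "(t, j) \<in> E" using st E'n by auto
      then have "(\<lambda>r. ?F (x (r, j))) absolutely_integrable_on {s..t} \<and> x (t, j) - x (s, j) = integral {s..t} (\<lambda>r. ?F (x (r, j)))"
        using S' st(3) by simp
      then show ?thesis using False by (simp add: agree)
    qed
    then show "(\<lambda>r. ?F (x' (r, j) + 0) + 0) absolutely_integrable_on {s..t}"
      "x' (t, j) - x' (s, j) = integral {s..t} (\<lambda>r. ?F (x' (r, j) + 0) + 0)" by auto
  next
    fix t j assume a: "(t, j) \<in> E'" "(t, Suc j) \<in> E'"
    have jJ: "j \<noteq> Suc J" using a top[of t "Suc j"] by (auto simp: E'_def)
    have "x' (t, j) \<in> jump_set Tmax \<and> x' (t, Suc j) = jump_map Tmin (x' (t, j))"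
    proof (cases "j = J")
      case True
      then show ?thesis using a E'J D by (auto simp: x'_def)
    next
      case False
      then have "(t, j) \<in> E" "(t, Suc j) \<in> E" using a E'n jJ by auto
      then show ?thesis using S' False jJ by (simp add: agree)
    qed
    then show "x' (t, j) + 0 \<in> jump_set Tmax" "x' (t, Suc j) = jump_map Tmin (x' (t, j) + 0) + 0" by auto
  qed
  then show ?thesis unfolding H_solution_def E'_def x'_def .
qed

lemma flow_concat:
  assumes z: "continuous_on {t1..T} z" "\<And>s. s \<in> {t1..T} \<Longrightarrow> z s = z t1 + integral {t1..s} (\<lambda>r. F (z r))"
    and y: "continuous_on {T..U} y" "\<And>s. s \<in> {T..U} \<Longrightarrow> y s = z T + integral {T..s} (\<lambda>r. F (y r))"
    and F: "continuous_on S F" and inS: "\<And>s. s \<in> {t1..T} \<Longrightarrow> z s \<in> S" "\<And>s. s \<in> {T..U} \<Longrightarrow> y s \<in> S"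
    and le: "t1 \<le> T" "T \<le> U"
  defines "v \<equiv> \<lambda>s :: real. if s \<le> T then z s else (y s :: 'b::euclidean_space)"
  shows "continuous_on {t1..U} v" "\<And>s. s \<in> {t1..U} \<Longrightarrow> v s = v t1 + integral {t1..s} (\<lambda>r. F (v r))"
proof -
  have yT: "y T = z T" using y(2)[of T] le by simp
  have "continuous_on ({t1..T} \<union> {T..U}) v"
    unfolding v_def by (rule continuous_on_cases) (use z y yT in auto)
  moreover have "{t1..T} \<union> {T..U} = {t1..U}" using le by auto
  ultimately show vc: "continuous_on {t1..U} v" by simp
  have vS: "v s \<in> S" if "s \<in> {t1..U}" for s using that inS by (auto simp: v_def)
  have Fv: "continuous_on {t1..U} (\<lambda>r. F (v r))"
    by (rule continuous_on_compose2[OF F vc]) (use vS in blast)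
  have vt1: "v t1 = z t1" using le by (simp add: v_def)
  have lower: "integral {t1..s} (\<lambda>r. F (v r)) = integral {t1..s} (\<lambda>r. F (z r))" if "s \<le> T" for s
    by (rule integral_cong) (use that in \<open>auto simp: v_def\<close>)
  fix s assume s: "s \<in> {t1..U}"
  show "v s = v t1 + integral {t1..s} (\<lambda>r. F (v r))"
  proof (cases "s \<le> T")
    case True
    then show ?thesis using s z(2)[of s] by (simp add: lower vt1) (simp add: v_def)
  next
    case False
    have upper: "integral {T..s} (\<lambda>r. F (v r)) = integral {T..s} (\<lambda>r. F (y r))"
      by (rule integral_cong) (use yT in \<open>auto simp: v_def\<close>)
    have "integral {t1..T} (\<lambda>r. F (v r)) + integral {T..s} (\<lambda>r. F (v r)) = integral {t1..s} (\<lambda>r. F (v r))"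
      by (rule Henstock_Kurzweil_Integration.integral_combine) (use s False le in \<open>auto intro!: integrable_continuous_real continuous_on_subset[OF Fv]\<close>)
    moreover have "v s = z t1 + integral {t1..T} (\<lambda>r. F (z r)) + integral {T..s} (\<lambda>r. F (y r))"
      using False y(2)[of s] z(2)[of T] s le by (simp add: v_def)
    ultimately show ?thesis by (simp add: upper lower vt1 add.assoc)
  qed
qed

text \<open>If t + j is bounded there are finitely many levels, and the last one has a supremum T.
  If T is not attained, the velocity is bounded on the box, so x is Lipschitz and has a limit there;
  if it is attained, the timer decides between a jump and a further flow.\<close>

lemma maximal_bounded_complete:
  assumes max: "H_maximal_solution \<phi> \<kappa> k Tmin Tmax a \<epsilon> E x"
    and bnd: "\<And>t j. (t, j) \<in> E \<Longrightarrow> norm (fst (x (t, j)) - zs) \<le> R \<and> norm (fst (snd (x (t, j))) - zs) \<le> R"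
  shows "complete_domain E"
proof (rule ccontr)
  assume "\<not> complete_domain E"
  then obtain M where M: "\<And>t j. (t, j) \<in> E \<Longrightarrow> t + real j < M"
    by (fastforce simp: complete_domain_def not_le)
  let ?F = "flow_map \<phi> \<kappa> k a \<epsilon>"
  have sol: "nominal a \<epsilon> E x" using max by (simp add: H_maximal_solution_def is_maximal_solution_def H_solution_def)
  have nomax: False if "nominal a \<epsilon> E' x'" "E \<subset> E'" "\<And>p. p \<in> E \<Longrightarrow> x' p = x p" for E' x'
    using max that unfolding H_maximal_solution_def is_maximal_solution_def H_solution_def by blast
  note S = sol[unfolded H_solution_def]
  note S' = S[unfolded is_solution_def]
  have E: "htd E" and E00: "(0, 0) \<in> E" using S' by blast+
  have E0: "s \<ge> 0" if "(s, i) \<in> E" for s i using E that by (auto simp: htd_def)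
  have "snd ` E \<subseteq> {..nat \<lceil>M\<rceil>}"
  proof
    fix j assume "j \<in> snd ` E"
    then obtain t where "(t, j) \<in> E" by auto
    then have "real j < M" using M E0 by fastforce
    then show "j \<in> {..nat \<lceil>M\<rceil>}" by (auto simp: le_nat_iff) linarith
  qed
  then have fin: "finite (snd ` E)" by (rule finite_subset) simp
  define J where "J = Max (snd ` E)"
  have top: "i \<le> J" if "(s, i) \<in> E" for s i using fin that by (auto simp: J_def intro!: Max_ge image_eqI)
  have "J \<in> snd ` E" unfolding J_def using fin E00 by (intro Max_in) auto
  then obtain t' where t': "(t', J) \<in> E" by auto
  obtain ts where ts: "ts (Suc J) = t'" "ts J \<le> ts (Suc J)"
    "\<And>r. r \<in> {ts J..ts (Suc J)} \<Longrightarrow> (r, J) \<in> E" "\<And>r. r \<le> t' \<Longrightarrow> (r, J) \<in> E \<Longrightarrow> r \<in> {ts J..ts (Suc J)}"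
    using htd_history[OF E t'] by (metis order_refl)
  define t1 where "t1 = ts J"
  have t1: "(t1, J) \<in> E" using ts(2,3) by (simp add: t1_def)
  have t1_le: "t1 \<le> s" if "(s, J) \<in> E" for s
    using ts(4)[of s] that ts(1,2) by (cases "s \<le> t'") (auto simp: t1_def)
  define I where "I = {s. (s, J) \<in> E}"
  have "s \<le> M" if "s \<in> I" for s using M[of s J] that by (simp add: I_def)
  then have "bdd_above I" by (rule bdd_aboveI)
  moreover have "I \<noteq> {}" using t1 by (auto simp: I_def)
  ultimately have I: "I \<noteq> {}" "bdd_above I" by blast+
  define T where "T = Sup I"
  have leT: "s \<le> T" if "(s, J) \<in> E" for s unfolding T_def using that I by (intro cSup_upper) (auto simp: I_def)
  have t1T: "t1 \<le> T" by (rule leT[OF t1])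
  have below: "(s, J) \<in> E" if s: "t1 \<le> s" "s < T" for s
  proof -
    obtain u where "u \<in> I" "s < u" using s(2) less_cSup_iff[OF I] by (auto simp: T_def)
    then show ?thesis using htd_interval[OF E t1, of u s] s by (auto simp: I_def)
  qed
  have xC: "x (s, J) \<in> flow_set Tmin Tmax" if "(s, J) \<in> E" for s by (rule nominal_in_flow_set[OF sol that])
  have x_int: "x (s, J) = x (t1, J) + integral {t1..s} (\<lambda>r. ?F (x (r, J)))" if "(s, J) \<in> E" for s
    using nominal_integral(2)[OF sol t1 that t1_le[OF that]] by (simp add: algebra_simps)
  show False
  proof (cases "(T, J) \<in> E")
    case False
    then have "t1 < T" using t1 t1T by (cases "t1 = T") auto
    have clos: "closure {t1..<T} = {t1..T}" using \<open>t1 < T\<close> by simp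
    obtain Mf where Mf: "\<And>p. p \<in> sbox R \<Longrightarrow> norm (?F p) \<le> Mf"
      using compact_imp_bounded[OF compact_continuous_image[OF continuous_on_flow_map_sbox compact_sbox]]
      unfolding bounded_iff by blast
    have box: "x (s, J) \<in> sbox R" if "(s, J) \<in> E" for s
      by (rule near_flow_set_in_sbox[OF xC[OF that], of _ 0]) (use Tmin_pos bnd[OF that] in auto)
    have lipx: "norm (x (s, J) - x (r, J)) \<le> \<bar>Mf\<bar> * \<bar>s - r\<bar>" if rs: "r \<in> {t1..<T}" "s \<in> {t1..<T}" for r s
    proof -
      have *: "norm (x (s, J) - x (r, J)) \<le> \<bar>Mf\<bar> * (s - r)" if "r \<in> {t1..<T}" "s \<in> {t1..<T}" "r \<le> s" for r s
      proof -
        have inE: "(r, J) \<in> E" "(s, J) \<in> E" using that below by auto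
        have "norm (x (s, J) - x (r, J)) = norm (integral {r..s} (\<lambda>r. ?F (x (r, J))))"
          using nominal_integral(2)[OF sol inE that(3)] by simp
        also have "\<dots> \<le> integral {r..s} (\<lambda>r. \<bar>Mf\<bar>)"
        proof (rule integral_norm_bound_integral[OF nominal_integral(1)[OF sol inE that(3)]])
          fix u assume "u \<in> {r..s}"
          then have "(u, J) \<in> E" using that by (intro below) auto
          then show "norm (?F (x (u, J))) \<le> \<bar>Mf\<bar>" using Mf[OF box] by (meson abs_ge_self order_trans)
        qed (rule integrable_continuous_real, simp)
        also have "\<dots> = \<bar>Mf\<bar> * (s - r)" using that by simp
        finally show ?thesis .
      qed
      show ?thesis
      proof (cases "r \<le> s")
        case True
        then show ?thesis using *[OF rs True] by simp
      next
        case False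
        then show ?thesis using *[OF rs(2,1)] by (simp add: norm_minus_commute abs_minus_commute)
      qed
    qed
    have "\<bar>Mf\<bar>-lipschitz_on {t1..<T} (\<lambda>s. x (s, J))"
      by (rule lipschitz_onI) (use lipx in \<open>auto simp: dist_norm\<close>)
    then have uc: "uniformly_continuous_on {t1..<T} (\<lambda>s. x (s, J))" by (rule lipschitz_on_uniformly_continuous)
    obtain z where zu: "uniformly_continuous_on (closure {t1..<T}) z" and zx: "\<And>s. s \<in> {t1..<T} \<Longrightarrow> x (s, J) = z s"
      by (rule uniformly_continuous_on_extension_on_closure[OF uc]) (rule that)
    have zc: "continuous_on {t1..T} z" using uniformly_continuous_imp_continuous[OF zu] by (simp add: clos)
    have zxE: "z s = x (s, J)" if "(s, J) \<in> E" for s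
      using zx[of s] t1_le[OF that] leT[OF that] that False by (cases "s = T") auto
    have zC: "z s \<in> flow_set Tmin Tmax" if s: "s \<in> {t1..T}" for s
    proof -
      have "z ` closure {t1..<T} \<subseteq> flow_set Tmin Tmax"
        by (rule image_closure_subset) (use zc clos closed_flow_set zxE xC below in auto)
      then show ?thesis using s clos by blast
    qed
    have Fz: "continuous_on {t1..T} (\<lambda>r. ?F (z r))"
      by (rule continuous_on_compose2[OF continuous_on_flow_map_flow_set zc]) (use zC in blast)
    have z_int: "z s = z t1 + integral {t1..s} (\<lambda>r. ?F (z r))" if s: "s \<in> {t1..T}" for s
    proof -
      \<comment> \<open>The difference is continuous up to T and vanishes before T, where z
        coincides with x; hence it also vanishes at T.\<close>
      have "z s - (z t1 + integral {t1..s} (\<lambda>r. ?F (z r))) = 0"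
      proof (rule continuous_constant_on_closure[where S = "{t1..<T}" and f = "\<lambda>s. z s - (z t1 + integral {t1..s} (\<lambda>r. ?F (z r)))"])
        show "continuous_on (closure {t1..<T}) (\<lambda>s. z s - (z t1 + integral {t1..s} (\<lambda>r. ?F (z r))))"
          unfolding clos by (intro continuous_intros zc indefinite_integral_continuous_1 integrable_continuous_real Fz)
        show "s \<in> closure {t1..<T}" using s clos by simp
        fix u assume u: "u \<in> {t1..<T}"
        have "integral {t1..u} (\<lambda>r. ?F (z r)) = integral {t1..u} (\<lambda>r. ?F (x (r, J)))"
          by (rule integral_cong) (use u zx in auto)
        moreover have uE: "(u, J) \<in> E" using u by (intro below) auto
        ultimately show "z u - (z t1 + integral {t1..u} (\<lambda>r. ?F (z r))) = 0"
          using x_int[OF uE] by (simp add: zxE[OF t1] zxE[OF uE])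
      qed
      then show ?thesis by simp
    qed
    have "nominal a \<epsilon> (E \<union> {t1..T} \<times> {J}) (\<lambda>p. if snd p = J then z (fst p) else x p)"
      by (rule extend_by_flow[OF sol t1]) (use top t1_le leT zc zC z_int zxE in blast)+
    then show False
      by (rule nomax) (use False t1T zxE in auto)
  next
    case TJ: True
    have Cc: "x (T, J) \<in> flow_set Tmin Tmax" by (rule xC[OF TJ])
    show False
    proof (cases "fst (snd (snd (x (T, J)))) < Tmax")
      case False
      then have D: "x (T, J) \<in> jump_set Tmax" using Cc by (auto simp: flow_set_def jump_set_def)
      have ext: "nominal a \<epsilon> (insert (T, Suc J) E) (x((T, Suc J) := jump_map Tmin (x (T, J))))"
        by (rule extend_by_jump[OF sol TJ _ _ D]) (use top leT in blast)+
      have new: "(T, Suc J) \<notin> E" using top[of T "Suc J"] by auto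
      then show False by (intro nomax[OF ext]) auto
    next
      case True
      obtain h y where h: "h > 0" and yc: "continuous_on {T..T + h} y"
        and y: "\<And>t. t \<in> {T..T + h} \<Longrightarrow> y t \<in> flow_set Tmin Tmax \<and> y t = x (T, J) + integral {T..t} (\<lambda>s. ?F (y s))"
        by (rule local_flow[OF Cc True, of T a \<epsilon>]) (rule that)
      define v where "v s = (if s \<le> T then x (s, J) else y s)" for s
      have inE: "(s, J) \<in> E" if "s \<in> {t1..T}" for s using that below TJ by (cases "s = T") auto
      have xc: "continuous_on {t1..T} (\<lambda>s. x (s, J))" by (rule solution_continuous_on[OF S]) (rule inE)
      have xi: "x (s, J) = x (t1, J) + integral {t1..s} (\<lambda>r. ?F (x (r, J)))" "x (s, J) \<in> flow_set Tmin Tmax"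
        if "s \<in> {t1..T}" for s using x_int[OF inE[OF that]] xC[OF inE[OF that]] by blast+
      have yi: "y s = x (T, J) + integral {T..s} (\<lambda>r. ?F (y r))" "y s \<in> flow_set Tmin Tmax"
        if "s \<in> {T..T + h}" for s using y[OF that] by blast+
      have "T \<le> T + h" using h by simp
      note fc = flow_concat[OF xc xi(1) yc yi(1) continuous_on_flow_map_flow_set xi(2) yi(2) t1T this, folded v_def]
      have vc: "continuous_on {t1..T + h} v" by (rule fc(1))
      have v_int: "v s = v t1 + integral {t1..s} (\<lambda>r. ?F (v r))" if "s \<in> {t1..T + h}" for s
        by (rule fc(2)) (use that in auto)
      have vC: "v s \<in> flow_set Tmin Tmax" if "s \<in> {t1..T + h}" for s
        using that y[of s] xC[OF inE[of s]] by (cases "s \<le> T") (auto simp: v_def)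
      have vx: "v s = x (s, J)" if "(s, J) \<in> E" for s using leT[OF that] by (simp add: v_def)
      have ext: "nominal a \<epsilon> (E \<union> {t1..T + h} \<times> {J}) (\<lambda>p. if snd p = J then v (fst p) else x p)"
      proof (rule extend_by_flow[OF sol t1])
        show "t1 \<le> s \<and> s \<le> T + h" if "(s, J) \<in> E" for s using t1_le[OF that] leT[OF that] h by simp
      qed (use top vc vC v_int vx in blast)+
      have "(T + h, J) \<notin> E"
      proof
        assume "(T + h, J) \<in> E"
        from leT[OF this] show False using h by simp
      qed
      moreover have "(T + h, J) \<in> {t1..T + h} \<times> {J}" using t1T h by simp
      ultimately have "E \<subset> E \<union> {t1..T + h} \<times> {J}" by blast
      then show False by (rule nomax[OF ext]) (use vx in auto)
    qed
  qed
qed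

end

section \<open>Stability and convergence of the cost\<close>

lemma semiglobal_less:
  assumes "semiglobal P" "c > 0"
  shows "semiglobal (\<lambda>a \<epsilon>. a < c \<and> P a \<epsilon>)"
proof -
  obtain as where as: "as > 0" "\<And>a. 0 < a \<Longrightarrow> a < as \<Longrightarrow> \<exists>es>0. \<forall>\<epsilon>. 0 < \<epsilon> \<and> \<epsilon> < es \<longrightarrow> P a \<epsilon>"
    using assms(1) unfolding semiglobal_def by blast
  show ?thesis
    unfolding semiglobal_def
    by (rule exI[of _ "min as c"]) (use as assms(2) in auto)
qed

context hybrid_momentum
begin

text \<open>Half the rate of \<open>V\<close>, since distances scale like its square root. Dividing
  by 1 + 1/dwell passes from t to t + j, as j is at most t/dwell + 1.\<close>

definition decay_rate :: real where "decay_rate = rate / 2 / (1 + 1 / dwell)"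
text \<open>In 4 = 2 * 2 one factor comes from squaring a sum of two norms, the other from bounding
  both initial deviations by the same distance. The factor \<open>exp decay_rate\<close> pays for
  the one jump that has no dwell time before it.\<close>

definition overshoot :: real where "overshoot = sqrt (4 * c_hi / c_lo) * exp decay_rate"

lemma decay_rate_pos: "decay_rate > 0" and overshoot_pos: "overshoot > 0"
  using rate_pos dwell_pos c_hi_pos c_lo_pos by (auto simp: decay_rate_def overshoot_def intro!: divide_pos_pos add_pos_pos)

text \<open>The comparison point in the attractor takes its timer and torus components from
  p.\<close>

lemma infdist_attractor_le:
  assumes p: "p \<in> flow_set Tmin Tmax" and d: "norm (x - p) \<le> b"
  shows "infdist x (attractor zs Tmin Tmax) \<le> norm (fst x - zs) + norm (fst (snd x) - zs) + b"
proof -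
  obtain x1 x2 r where x: "x = (x1, x2, r)" by (cases x) auto
  obtain p1 p2 q where p': "p = (p1, p2, q)" by (cases p) auto
  have "(zs, zs, q) \<in> attractor zs Tmin Tmax" using p by (cases q) (auto simp: p' flow_set_def attractor_def)
  then have "infdist x (attractor zs Tmin Tmax) \<le> dist x (zs, zs, q)" by (rule infdist_le)
  also have "\<dots> \<le> norm (x1 - zs) + (norm (x2 - zs) + norm (r - q))"
    using norm_Pair_le[of "x1 - zs" "(x2 - zs, r - q)"] norm_Pair_le[of "x2 - zs" "r - q"]
    by (simp add: dist_norm x)
  also have "norm (r - q) \<le> b"
    using d norm_snd_le[of "(x2 - p2, r - q)" "x1 - p1"] norm_snd_le[of "r - q" "x2 - p2"] by (simp add: x p')
  finally show ?thesis by (simp add: x)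
qed

lemma le_infdist_attractor:
  "norm (fst x - zs) \<le> infdist x (attractor zs Tmin Tmax)"
  "norm (fst (snd x) - zs) \<le> infdist x (attractor zs Tmin Tmax)"
proof -
  have "(zs, zs, Tmin, \<chi> l. 1, 0) \<in> attractor zs Tmin Tmax"
    using Tmin_less by (simp add: attractor_def torus_def)
  then have ne: "attractor zs Tmin Tmax \<noteq> {}" by blast
  have *: "norm (fst x - zs) \<le> dist x q" "norm (fst (snd x) - zs) \<le> dist x q" if "q \<in> attractor zs Tmin Tmax" for q
    using hstate_component_norms(1,2)[of "x - q"] that by (auto simp: attractor_def dist_norm)
  show "norm (fst x - zs) \<le> infdist x (attractor zs Tmin Tmax)"
    "norm (fst (snd x) - zs) \<le> infdist x (attractor zs Tmin Tmax)"
    unfolding infdist_notempty[OF ne] using * by (auto intro!: cINF_greatest[OF ne])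
qed

text \<open>The tolerance \<open>c_lo * \<nu>\<^sup>2 / 8\<close> becomes (\<nu>/2)^2 after division
  by \<open>c_lo\<close> and doubling, hence \<nu>/2 after the square root. The other \<nu>/2 covers
  the distance b' to the flow set.\<close>

lemma exp_bound_of_estimate:
  assumes \<nu>: "\<nu> > 0" and est: "solution_estimate B (c_lo * \<nu>\<^sup>2 / 8) a \<epsilon> b"
    and e: "\<And>t. norm (e t) \<le> b'" and b': "b' \<le> b" "b' \<le> \<nu> / 2" "b' \<le> Tmin / 2"
    and sol: "H_solution \<phi> \<kappa> k Tmin Tmax a \<epsilon> e E x" and x0: "VV (x (0, 0)) \<le> B"
  shows "exp_bound overshoot decay_rate (attractor zs Tmin Tmax) \<nu> E x"
  unfolding exp_bound_def
proof (intro allI impI)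
  fix t j assume tj: "(t, j) \<in> E"
  define \<delta> where "\<delta> = c_lo * \<nu>\<^sup>2 / 8"
  note S' = sol[unfolded H_solution_def is_solution_def]
  have E00: "(0, 0) \<in> E" and t0: "t \<ge> 0" using S' tj by (auto simp: htd_def)
  have near: "\<exists>p\<in>flow_set Tmin Tmax. norm (x (r, i) - p) \<le> b'" if "(r, i) \<in> E" for r i
    by (rule solution_near_flow_set[OF sol e Tmin_less that])
  have tau: "Tmin / 2 \<le> fst (snd (snd (x (r, i))))" "fst (snd (snd (x (r, i)))) \<le> 2 * Tmax" if rE: "(r, i) \<in> E" for r i
  proof -
    obtain p where p: "p \<in> flow_set Tmin Tmax" "norm (x (r, i) - p) \<le> b'" using near[OF rE] by blast
    have "\<bar>fst (snd (snd (x (r, i)))) - fst (snd (snd p))\<bar> \<le> b'"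
      using hstate_component_norms(3)[of "x (r, i) - p"] p(2) by simp
    moreover have "Tmin \<le> fst (snd (snd p))" "fst (snd (snd p)) \<le> Tmax" using p(1) by (auto simp: flow_set_def)
    ultimately show "Tmin / 2 \<le> fst (snd (snd (x (r, i))))" "fst (snd (snd (x (r, i)))) \<le> 2 * Tmax"
      using b'(3) Tmin_less Tmin_pos by linarith+
  qed
  define d0 where "d0 = infdist (x (0, 0)) (attractor zs Tmin Tmax)"
  have d0: "d0 \<ge> 0" by (simp add: d0_def infdist_nonneg)
  have V0: "VV (x (0, 0)) \<le> 2 * c_hi * d0\<^sup>2"
  proof -
    have "VV (x (0, 0)) \<le> c_hi * ((norm (fst (x (0, 0)) - zs))\<^sup>2 + (norm (fst (snd (x (0, 0))) - zs))\<^sup>2)"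
      using tau[OF E00] Tmin_pos by (intro V_upper) auto
    also have "\<dots> \<le> c_hi * (d0\<^sup>2 + d0\<^sup>2)"
      unfolding d0_def using c_hi_pos by (intro mult_left_mono add_mono power_mono le_infdist_attractor) auto
    finally show ?thesis by simp
  qed
  have Vt: "VV (x (t, j)) \<le> gam ^ j * exp (- rate * t) * VV (x (0, 0)) + \<delta>" and dw: "(real j - 1) * dwell \<le> t"
    using est[unfolded solution_estimate_def, rule_format, OF _ sol x0 tj] order_trans[OF e b'(1)]
    by (auto simp: \<delta>_def)
  have "gam ^ j * exp (- rate * t) * VV (x (0, 0)) \<le> 1 * exp (- rate * t) * (2 * c_hi * d0\<^sup>2)"
    using gam_pos gam_le_1 V0 V_nonneg by (intro mult_mono power_le_one) auto
  then have "gam ^ j * exp (- rate * t) * VV (x (0, 0)) \<le> exp (- rate * t) * (2 * c_hi * d0\<^sup>2)"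
    by (simp only: mult_1)
  then have Vt': "VV (x (t, j)) \<le> exp (- rate * t) * (2 * c_hi * d0\<^sup>2) + \<delta>" using Vt by linarith
  define m where "m = norm (fst (x (t, j)) - zs) + norm (fst (snd (x (t, j))) - zs)"
  define A where "A = sqrt (4 * c_hi / c_lo) * exp (- rate * t / 2) * d0"
  have A: "A \<ge> 0" using d0 c_hi_pos c_lo_pos by (simp add: A_def)
  have "m\<^sup>2 \<le> 2 * ((norm (fst (x (t, j)) - zs))\<^sup>2 + (norm (fst (snd (x (t, j))) - zs))\<^sup>2)"
    unfolding m_def using norm_diff_sq_le[of "norm (fst (x (t, j)) - zs)" "- norm (fst (snd (x (t, j))) - zs)"] by simp
  also have "\<dots> \<le> 2 * (VV (x (t, j)) / c_lo)"
    using V_lower[OF tau(1)[OF tj], of "fst (x (t, j))" "fst (snd (x (t, j)))"] c_lo_pos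
    by (simp add: field_simps)
  also have "\<dots> \<le> 2 * ((exp (- rate * t) * (2 * c_hi * d0\<^sup>2) + \<delta>) / c_lo)"
    using Vt' c_lo_pos by (intro mult_left_mono divide_right_mono) auto
  also have "\<dots> = A\<^sup>2 + (\<nu> / 2)\<^sup>2"
  proof -
    have "(exp (- rate * t / 2))\<^sup>2 = exp (- rate * t)" by (simp add: exp_double[symmetric])
    then have "A\<^sup>2 = 4 * c_hi / c_lo * exp (- rate * t) * d0\<^sup>2"
      unfolding A_def power_mult_distrib using c_hi_pos c_lo_pos by simp
    then show ?thesis using c_lo_pos by (simp add: \<delta>_def field_simps)
  qed
  also have "\<dots> \<le> (A + \<nu> / 2)\<^sup>2" using A \<nu> by (simp add: power2_sum)
  finally have m: "m \<le> A + \<nu> / 2" using A \<nu> by (intro power2_le_imp_le[of m "A + \<nu> / 2"]) auto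
  obtain p where p: "p \<in> flow_set Tmin Tmax" "norm (x (t, j) - p) \<le> b'" using near[OF tj] by blast
  have "infdist (x (t, j)) (attractor zs Tmin Tmax) \<le> m + b'"
    using infdist_attractor_le[OF p] by (simp add: m_def)
  also have "\<dots> \<le> A + \<nu>" using m b' by simp
  also have "A \<le> overshoot * d0 * exp (- decay_rate * (t + real j))"
  proof -
    have "t + real j \<le> (1 + 1 / dwell) * t + 1"
    proof -
      have "real j - 1 \<le> t / dwell" using dw dwell_pos by (simp add: field_simps)
      then show ?thesis by (simp add: algebra_simps)
    qed
    then have "decay_rate * (t + real j) \<le> decay_rate * ((1 + 1 / dwell) * t + 1)"
      using decay_rate_pos by (intro mult_left_mono) auto
    also have "\<dots> = (decay_rate * (1 + 1 / dwell)) * t + decay_rate" by (simp add: algebra_simps)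
    also have "decay_rate * (1 + 1 / dwell) = rate / 2"
    proof -
      have "1 + 1 / dwell > 0" using dwell_pos by (simp add: add_pos_pos)
      moreover have "rate / 2 / u * u = rate / 2" if "u > 0" for u using that by simp
      ultimately show ?thesis unfolding decay_rate_def by blast
    qed
    finally have "exp (- rate * t / 2) \<le> exp (decay_rate + (- decay_rate * (t + real j)))" by simp
    also have "\<dots> = exp decay_rate * exp (- decay_rate * (t + real j))" by (rule exp_add)
    finally have "sqrt (4 * c_hi / c_lo) * exp (- rate * t / 2) * d0
       \<le> sqrt (4 * c_hi / c_lo) * (exp decay_rate * exp (- decay_rate * (t + real j))) * d0"
      using d0 c_hi_pos c_lo_pos by (intro mult_right_mono mult_left_mono) auto
    then show ?thesis by (simp add: A_def overshoot_def mult_ac)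
  qed
  finally show "infdist (x (t, j)) (attractor zs Tmin Tmax)
     \<le> overshoot * infdist (x (0, 0)) (attractor zs Tmin Tmax) * exp (- decay_rate * (t + real j)) + \<nu>"
    by (simp add: d0_def)
qed

lemma compact_V_bound:
  assumes "compact K"
  obtains B where "B > 0" "\<And>p. p \<in> K \<Longrightarrow> VV p \<le> B"
proof -
  have "continuous_on K VV"
    by (rule continuous_on_compose2[OF continuous_on_V[of UNIV]]) (auto intro!: continuous_intros)
  then have "bounded (VV ` K)" using assms by (intro compact_imp_bounded compact_continuous_image)
  then obtain B where "\<And>p. p \<in> K \<Longrightarrow> \<bar>VV p\<bar> \<le> B" by (auto simp: bounded_iff)
  then show ?thesis by (intro that[of "\<bar>B\<bar> + 1"]) (auto intro: order_trans abs_ge_self add_increasing2, fastforce)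
qed

lemma nominal_bounded:
  assumes est: "solution_estimate B \<delta> a \<epsilon> b" and b: "b > 0" and sol: "nominal a \<epsilon> E x"
    and x0: "VV (x (0, 0)) \<le> B" and tj: "(t, j) \<in> E"
  shows "norm (fst (x (t, j)) - zs) < rad (B + \<delta>)" "norm (fst (snd (x (t, j))) - zs) < rad (B + \<delta>)"
proof -
  have t0: "t \<ge> 0" using sol tj by (auto simp: H_solution_def is_solution_def htd_def)
  have "VV (x (t, j)) \<le> gam ^ j * exp (- rate * t) * VV (x (0, 0)) + \<delta>"
    using est[unfolded solution_estimate_def, rule_format, OF _ sol x0 tj] b by simp
  also have "gam ^ j * exp (- rate * t) * VV (x (0, 0)) \<le> 1 * 1 * B"
    using gam_pos gam_le_1 x0 V_nonneg rate_pos t0 by (intro mult_mono power_le_one) auto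
  finally have "VV (x (t, j)) \<le> B + \<delta>" by simp
  moreover have "Tmin / 2 \<le> fst (snd (snd (x (t, j))))"
    using nominal_in_flow_set[OF sol tj] Tmin_pos by (auto simp: flow_set_def)
  ultimately show "norm (fst (x (t, j)) - zs) < rad (B + \<delta>)" "norm (fst (snd (x (t, j))) - zs) < rad (B + \<delta>)"
    by (rule V_le_imp_bounded[rotated])+
qed

lemma SGPES_attractor: "SGPES \<phi> \<kappa> k Tmin Tmax (attractor zs Tmin Tmax) overshoot decay_rate"
  unfolding SGPES_def semiglobal_def[symmetric]
proof (intro allI impI)
  fix K :: "'n hstate set" and \<nu> :: real assume "compact K \<and> \<nu> > 0"
  then obtain B where B: "B > 0" "\<And>p. p \<in> K \<Longrightarrow> VV p \<le> B" and \<nu>: "\<nu> > 0" using compact_V_bound by metis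
  have "semiglobal (\<lambda>a \<epsilon>. \<exists>b>0. solution_estimate B (c_lo * \<nu>\<^sup>2 / 8) a \<epsilon> b)"
    using B(1) \<nu> c_lo_pos by (intro core_estimate) auto
  then show "semiglobal (\<lambda>a \<epsilon>. (\<forall>E x. H_solution \<phi> \<kappa> k Tmin Tmax a \<epsilon> (\<lambda>_. 0) E x \<and> x (0, 0) \<in> K \<longrightarrow>
       exp_bound overshoot decay_rate (attractor zs Tmin Tmax) \<nu> E x) \<and>
     (\<forall>E x. H_maximal_solution \<phi> \<kappa> k Tmin Tmax a \<epsilon> E x \<and> x (0, 0) \<in> K \<longrightarrow> complete_domain E))"
  proof (rule semiglobal_mono, intro conjI allI impI)
    fix a \<epsilon> E x assume "\<exists>b>0. solution_estimate B (c_lo * \<nu>\<^sup>2 / 8) a \<epsilon> b"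
    then obtain b where b: "b > 0" and est: "solution_estimate B (c_lo * \<nu>\<^sup>2 / 8) a \<epsilon> b" by blast
    show "exp_bound overshoot decay_rate (attractor zs Tmin Tmax) \<nu> E x" if "nominal a \<epsilon> E x \<and> x (0, 0) \<in> K"
      by (rule exp_bound_of_estimate[OF \<nu> est, of "\<lambda>_. 0" 0]) (use that b \<nu> Tmin_pos B in auto)
    assume mx: "H_maximal_solution \<phi> \<kappa> k Tmin Tmax a \<epsilon> E x \<and> x (0, 0) \<in> K"
    then have nom: "nominal a \<epsilon> E x" by (simp add: H_maximal_solution_def is_maximal_solution_def H_solution_def)
    show "complete_domain E"
    proof (rule maximal_bounded_complete[OF conjunct1[OF mx]])
      fix t j assume "(t, j) \<in> E"
      from nominal_bounded[OF est b nom B(2)[OF conjunct2[OF mx]] this]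
      show "norm (fst (x (t, j)) - zs) \<le> rad (B + c_lo * \<nu>\<^sup>2 / 8) \<and> norm (fst (snd (x (t, j))) - zs) \<le> rad (B + c_lo * \<nu>\<^sup>2 / 8)"
        by (intro conjI less_imp_le)
    qed
  qed
qed

lemma structurally_robust_attractor:
  "structurally_robust \<phi> \<kappa> k Tmin Tmax (attractor zs Tmin Tmax) overshoot decay_rate"
  unfolding structurally_robust_def
proof (intro allI impI, rule semiglobal_def[THEN iffD1])
  fix K :: "'n hstate set" and \<nu> :: real assume "compact K \<and> \<nu> > 0"
  then obtain B where B: "B > 0" "\<And>p. p \<in> K \<Longrightarrow> VV p \<le> B" and \<nu>: "\<nu> > 0" using compact_V_bound by metis
  have "semiglobal (\<lambda>a \<epsilon>. \<exists>b>0. solution_estimate B (c_lo * \<nu>\<^sup>2 / 8) a \<epsilon> b)"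
    using B(1) \<nu> c_lo_pos by (intro core_estimate) auto
  then show "semiglobal (\<lambda>a \<epsilon>. \<exists>ebs>0. \<forall>ebar. 0 < ebar \<and> ebar < ebs \<longrightarrow>
      (\<forall>e E x. e \<in> borel_measurable lebesgue \<and> (\<forall>t. norm (e t) \<le> ebar) \<and>
        H_solution \<phi> \<kappa> k Tmin Tmax a \<epsilon> e E x \<and> x (0, 0) \<in> K \<longrightarrow>
        exp_bound overshoot decay_rate (attractor zs Tmin Tmax) \<nu> E x))"
  proof (rule semiglobal_mono)
    fix a \<epsilon> assume "\<exists>b>0. solution_estimate B (c_lo * \<nu>\<^sup>2 / 8) a \<epsilon> b"
    then obtain b where b: "b > 0" and est: "solution_estimate B (c_lo * \<nu>\<^sup>2 / 8) a \<epsilon> b" by blast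
    show "\<exists>ebs>0. \<forall>ebar. 0 < ebar \<and> ebar < ebs \<longrightarrow>
      (\<forall>e E x. e \<in> borel_measurable lebesgue \<and> (\<forall>t. norm (e t) \<le> ebar) \<and>
        H_solution \<phi> \<kappa> k Tmin Tmax a \<epsilon> e E x \<and> x (0, 0) \<in> K \<longrightarrow>
        exp_bound overshoot decay_rate (attractor zs Tmin Tmax) \<nu> E x)"
    proof (rule exI[of _ "min b (min (\<nu> / 2) (Tmin / 2))"], intro conjI allI impI)
      show "0 < min b (min (\<nu> / 2) (Tmin / 2))" using b \<nu> Tmin_pos by simp
      fix ebar e E x
      assume "0 < ebar \<and> ebar < min b (min (\<nu> / 2) (Tmin / 2))"
        and "e \<in> borel_measurable lebesgue \<and> (\<forall>t. norm (e t) \<le> ebar) \<and>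
          H_solution \<phi> \<kappa> k Tmin Tmax a \<epsilon> e E x \<and> x (0, 0) \<in> K"
      then show "exp_bound overshoot decay_rate (attractor zs Tmin Tmax) \<nu> E x"
        by (intro exp_bound_of_estimate[OF \<nu> est, of e ebar]) (use B in auto)
    qed
  qed
qed

section \<open>Decay of the cost at the dithered point\<close>

lemma cost_estimate:
  fixes K0 :: "((real^'n) \<times> (real^'n)) set"
  assumes K0: "compact K0" and \<nu>: "\<nu> > 0"
  shows "semiglobal (\<lambda>a \<epsilon>. \<forall>E x. nominal a \<epsilon> E x \<and> (fst (x (0, 0)), fst (snd (x (0, 0)))) \<in> K0 \<and>
      fst (snd (snd (x (0, 0)))) = Tmin \<and> fst (x (0, 0)) = fst (snd (x (0, 0))) \<longrightarrow>
      (\<forall>t j. (t, j) \<in> E \<longrightarrow>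
         \<phi> (fst (x (t, j)) + a *\<^sub>R fst (snd (snd (snd (x (t, j)))))) - \<phi> zs
         \<le> (Tmax\<^sup>2 / Tmin\<^sup>2) * gam ^ j
             * (\<phi> (fst (x (0, 0)) + a *\<^sub>R fst (snd (snd (snd (x (0, 0)))))) - \<phi> zs) + \<nu>))"
proof -
  have "continuous_on K0 (\<lambda>p. V (fst p, snd p, Tmin))"
    by (rule continuous_on_compose2[OF continuous_on_V[of UNIV]]) (auto intro!: continuous_intros)
  then have "bounded ((\<lambda>p. V (fst p, snd p, Tmin)) ` K0)" using K0 by (intro compact_imp_bounded compact_continuous_image)
  then obtain B0 where B0: "\<And>p. p \<in> K0 \<Longrightarrow> \<bar>V (fst p, snd p, Tmin)\<bar> \<le> B0" by (auto simp: bounded_iff)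
  define B where "B = \<bar>B0\<bar> + 1"
  have B: "B > 0" "V (p1, p2, Tmin) \<le> B" if "(p1, p2) \<in> K0" for p1 p2
    using B0[OF that] by (auto simp: B_def)
  have Bpos: "B > 0" by (simp add: B_def)
  define \<alpha> where "\<alpha> = Tmax\<^sup>2 / Tmin\<^sup>2"
  have \<alpha>: "\<alpha> \<ge> 1" using Tmin_pos Tmin_less by (simp add: \<alpha>_def power_mono)
  \<comment> \<open>\<nu> is spent in thirds: the error of \<open>V\<close> divided by k Tmin^2, the
    dither at time t, and the initial dither amplified by \<alpha>.\<close>
  define \<delta> where "\<delta> = k * Tmin\<^sup>2 * (\<nu> / 3)"
  have \<delta>: "\<delta> > 0" using k_pos Tmin_pos \<nu> by (simp add: \<delta>_def)
  define R where "R = rad (B + \<delta>)"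
  have R: "R > 0" using Bpos \<delta> c_lo_pos by (simp add: R_def rad_def add_nonneg_pos)
  define \<nu>' where "\<nu>' = \<nu> / (3 * \<alpha>)"
  have \<nu>': "\<nu>' > 0" "\<alpha> * \<nu>' = \<nu> / 3" "\<nu>' \<le> \<nu> / 3"
  proof -
    show "\<nu>' > 0" "\<alpha> * \<nu>' = \<nu> / 3" using \<nu> \<alpha> by (simp_all add: \<nu>'_def)
    have "1 * \<nu>' \<le> \<alpha> * \<nu>'" using \<alpha> \<open>\<nu>' > 0\<close> by (intro mult_right_mono) auto
    then show "\<nu>' \<le> \<nu> / 3" using \<open>\<alpha> * \<nu>' = \<nu> / 3\<close> by simp
  qed
  define N where "N = real CARD('n)"
  have N: "N \<ge> 1" by (simp add: N_def Suc_leI)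
  define C where "C = L * R * N + L * N\<^sup>2"
  have C: "C > 0" using L_pos R N by (simp add: C_def add_pos_pos)
  have dither: "\<bar>\<phi> (y + a *\<^sub>R c) - \<phi> y\<bar> \<le> \<nu>'"
    if "norm (y - zs) \<le> R" "norm c \<le> N" "0 < a" "a < min 1 (\<nu>' / C)" for y c :: "real^'n" and a
  proof -
    have "norm (grad y) \<le> L * R" using norm_grad_le[of y] mult_left_mono[OF that(1), of L] L_pos by linarith
    then have "norm (grad y) * norm (a *\<^sub>R c) \<le> (L * R) * (a * N)"
      using that N L_pos R by (intro mult_mono) auto
    then have "\<bar>grad y \<bullet> (a *\<^sub>R c)\<bar> \<le> L * R * N * a"
      using Cauchy_Schwarz_ineq2[of "grad y" "a *\<^sub>R c"] by (simp add: mult_ac)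
    moreover have "L * (norm (a *\<^sub>R c))\<^sup>2 \<le> L * N\<^sup>2 * a"
    proof -
      have "(norm (a *\<^sub>R c))\<^sup>2 \<le> (a * N)\<^sup>2" using that N by (intro power_mono) auto
      also have "\<dots> = N\<^sup>2 * (a * a)" by (simp add: power2_eq_square)
      also have "\<dots> \<le> N\<^sup>2 * (1 * a)" using that by (intro mult_left_mono mult_right_mono) auto
      finally show ?thesis using L_pos by simp
    qed
    moreover have "C * a \<le> \<nu>'" using that C by (simp add: field_simps)
    ultimately show ?thesis using first_order_error[of y "a *\<^sub>R c"] by (simp add: C_def distrib_right)
  qed
  have "semiglobal (\<lambda>a \<epsilon>. a < min 1 (\<nu>' / C) \<and> (\<exists>b>0. solution_estimate B \<delta> a \<epsilon> b))"
    using \<nu>' C by (intro semiglobal_less core_estimate Bpos \<delta>) auto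
  then show ?thesis
  proof (rule semiglobal_mono, intro allI impI)
    fix a \<epsilon> E x t j
    assume a: "0 < a" and small: "a < min 1 (\<nu>' / C) \<and> (\<exists>b>0. solution_estimate B \<delta> a \<epsilon> b)"
      and init: "nominal a \<epsilon> E x \<and> (fst (x (0, 0)), fst (snd (x (0, 0)))) \<in> K0 \<and>
        fst (snd (snd (x (0, 0)))) = Tmin \<and> fst (x (0, 0)) = fst (snd (x (0, 0)))"
      and tj: "(t, j) \<in> E"
    obtain b where a1: "a < min 1 (\<nu>' / C)" and b: "b > 0" and est: "solution_estimate B \<delta> a \<epsilon> b"
      using small by blast
    have sol: "nominal a \<epsilon> E x" and xK: "(fst (x (0, 0)), fst (snd (x (0, 0)))) \<in> K0"
      and \<tau>0: "fst (snd (snd (x (0, 0)))) = Tmin" using init by blast+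
    have eq: "fst (snd (x (0, 0))) = fst (x (0, 0))" by (rule sym) (use init in blast)
    have E00: "(0, 0) \<in> E" and t0: "t \<ge> 0" using sol tj by (auto simp: H_solution_def is_solution_def htd_def)
    have x0: "VV (x (0, 0)) \<le> B" using B(2)[OF xK] by (simp add: \<tau>0)
    have dith: "\<bar>\<phi> (fst (x (r, i)) + a *\<^sub>R fst (snd (snd (snd (x (r, i)))))) - \<phi> (fst (x (r, i)))\<bar> \<le> \<nu>'" if "(r, i) \<in> E" for r i
    proof (rule dither[OF _ _ a a1])
      show "norm (fst (x (r, i)) - zs) \<le> R" using nominal_bounded(1)[OF est b sol x0 that] by (simp add: R_def)
      have "(fst (snd (snd (snd (x (r, i))))), snd (snd (snd (snd (x (r, i)))))) \<in> torus"
        using nominal_in_flow_set[OF sol that] by (auto simp: flow_set_def)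
      then show "norm (fst (snd (snd (snd (x (r, i)))))) \<le> N" unfolding N_def by (rule torus_norm_le)
    qed
    define g where "g p = \<phi> (fst p) - \<phi> zs" for p :: "'n hstate"
    define gz where "gz p = \<phi> (fst p + a *\<^sub>R fst (snd (snd (snd p)))) - \<phi> zs" for p :: "'n hstate"
    have gz_t: "gz (x (t, j)) \<le> g (x (t, j)) + \<nu>'" and gz_0: "g (x (0, 0)) \<le> gz (x (0, 0)) + \<nu>'"
      using dith[OF tj] dith[OF E00] unfolding g_def gz_def by linarith+
    have kT: "k * Tmin\<^sup>2 > 0" using k_pos Tmin_pos by simp
    \<comment> \<open>Equal initial positions and initial timer Tmin allow \<open>V_start\<close>.
      Together with the lower bound k Tmin^2 times the gap at time t, the quotient of the two
      weights is \<alpha>; the surplus factor \<open>gam\<close> is bounded by 1.\<close>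
    have V0: "VV (x (0, 0)) \<le> k * Tmax\<^sup>2 * g (x (0, 0))"
    proof -
      have "VV (x (0, 0)) \<le> gam * (k * Tmax\<^sup>2) * g (x (0, 0))"
        using V_start[of "fst (x (0, 0))"] by (simp add: eq \<tau>0 g_def)
      also have "\<dots> \<le> 1 * (k * Tmax\<^sup>2) * g (x (0, 0))"
        using gam_le_1 k_pos gap_nonneg by (intro mult_right_mono) (auto simp: g_def)
      finally show ?thesis by simp
    qed
    have i1: "k * Tmin\<^sup>2 * g (x (t, j)) \<le> VV (x (t, j))"
    proof -
      have "Tmin \<le> fst (snd (snd (x (t, j))))" using nominal_in_flow_set[OF sol tj] by (auto simp: flow_set_def)
      then have "k * Tmin\<^sup>2 * g (x (t, j)) \<le> k * (fst (snd (snd (x (t, j)))))\<^sup>2 * g (x (t, j))"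
        using k_pos Tmin_pos gap_nonneg by (intro mult_right_mono mult_left_mono power_mono) (auto simp: g_def)
      also have "\<dots> \<le> VV (x (t, j))" by (simp add: V_def g_def)
      finally show ?thesis .
    qed
    have i2: "VV (x (t, j)) \<le> gam ^ j * exp (- rate * t) * VV (x (0, 0)) + \<delta>"
      using est[unfolded solution_estimate_def, rule_format, OF _ sol x0 tj] b by simp
    have i3: "gam ^ j * exp (- rate * t) * VV (x (0, 0)) \<le> gam ^ j * 1 * (k * Tmax\<^sup>2 * (gz (x (0, 0)) + \<nu>'))"
    proof -
      have "k * Tmax\<^sup>2 * g (x (0, 0)) \<le> k * Tmax\<^sup>2 * (gz (x (0, 0)) + \<nu>')"
        using gz_0 k_pos by (intro mult_left_mono) auto
      then show ?thesis using V0 V_nonneg gam_pos rate_pos t0 by (intro mult_mono) auto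
    qed
    have i4: "gam ^ j * 1 * (k * Tmax\<^sup>2 * (gz (x (0, 0)) + \<nu>')) + \<delta>
        = k * Tmin\<^sup>2 * (\<alpha> * gam ^ j * gz (x (0, 0)) + gam ^ j * (\<alpha> * \<nu>') + \<nu> / 3)"
      using Tmin_pos by (simp add: \<alpha>_def \<delta>_def field_simps)
    have "k * Tmin\<^sup>2 * g (x (t, j)) \<le> k * Tmin\<^sup>2 * (\<alpha> * gam ^ j * gz (x (0, 0)) + gam ^ j * (\<alpha> * \<nu>') + \<nu> / 3)"
      by (rule order_trans[OF i1 order_trans[OF i2 order_trans[OF add_right_mono[OF i3] eq_refl[OF i4]]]])
    then have "g (x (t, j)) \<le> \<alpha> * gam ^ j * gz (x (0, 0)) + gam ^ j * (\<alpha> * \<nu>') + \<nu> / 3"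
      by (rule mult_left_le_imp_le[OF _ kT])
    moreover have "gam ^ j * (\<alpha> * \<nu>') \<le> 1 * (\<alpha> * \<nu>')"
      using gam_pos gam_le_1 \<alpha> \<nu>' by (intro mult_right_mono power_le_one) auto
    ultimately have "gz (x (t, j)) \<le> \<alpha> * gam ^ j * gz (x (0, 0)) + \<nu>" using gz_t \<nu>' by linarith
    then show "\<phi> (fst (x (t, j)) + a *\<^sub>R fst (snd (snd (snd (x (t, j)))))) - \<phi> zs
         \<le> (Tmax\<^sup>2 / Tmin\<^sup>2) * gam ^ j
             * (\<phi> (fst (x (0, 0)) + a *\<^sub>R fst (snd (snd (snd (x (0, 0)))))) - \<phi> zs) + \<nu>"
      by (simp add: gz_def \<alpha>_def)
  qed
qed

end

theorem theorem2:
  fixes \<phi> :: "real^'n \<Rightarrow> real" and grad :: "real^'n \<Rightarrow> real^'n"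
    and Hess :: "real^'n \<Rightarrow> real^'n^'n"
    and \<theta> L k Tmin Tmax :: real and zs :: "real^'n" and \<kappa> :: "'n \<Rightarrow> real"
  assumes grad: "\<And>z. (\<phi> has_derivative (\<lambda>h. grad z \<bullet> h)) (at z)"
    and hess: "\<And>z. (grad has_derivative (\<lambda>h. Hess z *v h)) (at z)"
    and hess_cont: "continuous_on UNIV Hess"
    and \<theta>_pos: "\<theta> > 0" and L_pos: "L > 0"
    and lip: "\<And>z1 z2. norm (grad z1 - grad z2) \<le> L * norm (z1 - z2)"
    and strmon: "\<And>z1 z2. (grad z1 - grad z2) \<bullet> (z1 - z2) \<ge> \<theta> * (norm (z1 - z2))^2"
    and zs_min: "\<And>z. \<phi> zs \<le> \<phi> z"
    and \<kappa>_rat: "\<And>l. \<kappa> l \<in> \<rat>" and \<kappa>_pos: "\<And>l. \<kappa> l > 0" and \<kappa>_inj: "inj \<kappa>"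
    and k_pos: "k > 0"
    and T: "0 < Tmin" "Tmin < Tmax"
    and Tcond: "Tmax^2 - Tmin^2 \<ge> 1 / (2 * \<theta> * k)"
  shows "(\<exists>c1 > 0. \<exists>c2 > 0.
            SGPES \<phi> \<kappa> k Tmin Tmax (attractor zs Tmin Tmax) c1 c2 \<and>
            structurally_robust \<phi> \<kappa> k Tmin Tmax (attractor zs Tmin Tmax) c1 c2)
       \<and>
       (\<forall>K0 \<nu>. compact (K0 :: ((real^'n) \<times> (real^'n)) set) \<and> (zs, zs) \<in> interior K0 \<and> \<nu> > 0 \<longrightarrow>
          (\<exists>as > 0. \<forall>a. 0 < a \<and> a < as \<longrightarrow>
            (\<exists>es > 0. \<forall>\<epsilon>. 0 < \<epsilon> \<and> \<epsilon> < es \<longrightarrow>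
              (\<forall>E x. H_solution \<phi> \<kappa> k Tmin Tmax a \<epsilon> (\<lambda>_. 0) E x \<and>
                  (fst (x (0, 0)), fst (snd (x (0, 0)))) \<in> K0 \<and>
                  fst (snd (snd (x (0, 0)))) = Tmin \<and>
                  fst (x (0, 0)) = fst (snd (x (0, 0))) \<longrightarrow>
                (\<forall>t j. (t, j) \<in> E \<and> t > Inf {s. (s, j) \<in> E} \<longrightarrow>
                   \<phi> (fst (x (t, j)) + a *\<^sub>R fst (snd (snd (snd (x (t, j)))))) - \<phi> zs
                   \<le> (Tmax^2 / Tmin^2)
                       * ((1 / (k * Tmax^2)) * (1 / (2 * \<theta>) + k * Tmin^2)) ^ j
                       * (\<phi> (fst (x (0, 0)) + a *\<^sub>R fst (snd (snd (snd (x (0, 0)))))) - \<phi> zs)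
                     + \<nu>)))))"
proof -
  interpret hybrid_momentum \<phi> grad Hess \<theta> L k Tmin Tmax zs \<kappa>
    by unfold_locales (fact assms)+
  have "SGPES \<phi> \<kappa> k Tmin Tmax (attractor zs Tmin Tmax) overshoot decay_rate \<and>
      structurally_robust \<phi> \<kappa> k Tmin Tmax (attractor zs Tmin Tmax) overshoot decay_rate"
    using SGPES_attractor structurally_robust_attractor by blast
  moreover have "\<exists>as > 0. \<forall>a. 0 < a \<and> a < as \<longrightarrow>
            (\<exists>es > 0. \<forall>\<epsilon>. 0 < \<epsilon> \<and> \<epsilon> < es \<longrightarrow>
              (\<forall>E x. H_solution \<phi> \<kappa> k Tmin Tmax a \<epsilon> (\<lambda>_. 0) E x \<and>
                  (fst (x (0, 0)), fst (snd (x (0, 0)))) \<in> K0 \<and>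
                  fst (snd (snd (x (0, 0)))) = Tmin \<and>
                  fst (x (0, 0)) = fst (snd (x (0, 0))) \<longrightarrow>
                (\<forall>t j. (t, j) \<in> E \<and> t > Inf {s. (s, j) \<in> E} \<longrightarrow>
                   \<phi> (fst (x (t, j)) + a *\<^sub>R fst (snd (snd (snd (x (t, j)))))) - \<phi> zs
                   \<le> (Tmax^2 / Tmin^2)
                       * ((1 / (k * Tmax^2)) * (1 / (2 * \<theta>) + k * Tmin^2)) ^ j
                       * (\<phi> (fst (x (0, 0)) + a *\<^sub>R fst (snd (snd (snd (x (0, 0)))))) - \<phi> zs)
                     + \<nu>)))"
    if "compact K0" "\<nu> > 0" for K0 \<nu>
    unfolding semiglobal_def[symmetric]
    by (rule semiglobal_mono[OF cost_estimate[OF that]]) (unfold gam_def, blast)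
  ultimately show ?thesis
    using overshoot_pos decay_rate_pos by blast
qed

end
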